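(* Fix $\varepsilon>0$. There exist $p_0>0$ and numbers $\varepsilon_p$ ($p\ge p_0$) with $\varepsilon_p\to 0$ as $p\to\infty$ such that the following holds whenever $p\ge p_0$. Let $\{X_j\}_{j\in\mathbb Z^+}$ be a sequence of random variables, $X_j$ taking values in a measurable space $(\mathcal X_j,\mathcal A_j)$, with $\phi$-mixing coefficients $\phi(m)$. For each $N\in\mathbb Z^+$ let $g_j=g_{j,N}:\mathcal X_j\to\mathbb R$ ($1\le j\le N$) be measurable with $\mathbb E[g_j(X_j)]=0$, let $R=R_N(X_1,\dots,X_N)$ be a real-valued random variable, and put $$S=S_N=\sum_{j=1}^N g_j(X_j),\qquad T=T_N=S+R,\qquad \sigma_N^2=\mathbb E[S_N^2]=\mathrm{Var}(S_N).$$ Assume: 1. $\phi(m)\le K m^{-p}$ for all $m\in\mathbb Z^+$, where $K>0$ is independent of $N$; 2. there are constants $b,\tilde b>0$ and $N_0\in\mathbb Z^+$ with $\tilde b N\le \mathrm{Var}(S_N)\le bN$ for all $N\ge N_0$; 3. there is $\rho>0$ with $\sup_{N}\sup_{1\le j\le N}\mathbb E[|g_j(X_j)|^3]\le\rho<\infty$; 4. there is $\Sigma>0$ with $\mathrm{Var}(S_N)\ge\Sigma^2>0$. For each $N$ and $1\le j\le k\le N$, let $R_{j,k}=R_{j,k}(X_1,\dots,X_{j-1},X_{k+1},\dots,X_N)$ be a $\sigma^C[j,k]$-measurable random variable, and set $R_{j,j-1}=R$ for all $1\le j\le N$. Define $$\gamma=\gamma(N):=\max\Big\{\mathbb E\big[|R_{j,k}-R_{j,k-1}|^{3/2}\big]^{2/3}:\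 |j-k|\le N^{\varepsilon},\ 1\le j\le k\le N\Big\}.$$ Then $$\sup_{x\in\mathbb R}\big|\mathbb P(T<\sigma_N x)-\Phi(x)\big|\le A N^{-1/2+\varepsilon_p}+A N^{-1/2}\,\mathbb E[|R|]+A\gamma N^{\varepsilon_p},$$ where $A=A(p,K,\Sigma,\rho)$ is a constant independent of $N$.
   Context: $\Phi$ is the standard normal distribution function. $\sigma[a,b]$ is the $\sigma$-algebra generated by $X_j$, $j\in[a,b]\cap\mathbb Z^+$; $\sigma^C[a,b]$ is the $\sigma$-algebra generated by $X_j$, $j\in\{1,\dots,N\}\setminus[a,b]$ (and $\sigma^C[a,b]=\sigma(X_1,\dots,X_N)$ if $b<a$). The $m$-th $\phi$-mixing coefficient of $\{X_j\}$ is $$\phi(m)=\sup_{k\in\mathbb Z^+}\ \sup_{A\in\sigma[1,k],\,\mathbb P(A)>0}\ \sup_{B\in\sigma[k+m,\infty)}|\mathbb P(B\mid A)-\mathbb P(B)|.$$ The quantities $T,S,g_j,R,R_{j,k}$ may all depend on $N$. No stationarity is assumed.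
   Formalization: The constant A is allowed to depend also on b̃ and N_0 of assumption 2 (with A depending on p, K, Σ, ρ only the claim is false); the types of the sample and value spaces are fixed before p_0, ε_p and A. *)

theory Defs
  imports "HOL-Probability.Probability"
begin

text \<open>Throughout, \<open>X j\<close> (\<open>j \<ge> 1\<close>) is a random element of the measurable space \<open>E j\<close>, defined on the
  probability space \<open>M\<close>. The spaces \<open>E j\<close> may differ; only their ambient type is shared.\<close>

definition gen_sigma ::
    "'w measure \<Rightarrow> (nat \<Rightarrow> 'x measure) \<Rightarrow> (nat \<Rightarrow> 'w \<Rightarrow> 'x) \<Rightarrow> nat set \<Rightarrow> 'w measure" where
  "gen_sigma M E X I =
     sigma (space M) (\<Union>j\<in>I. {X j -` B \<inter> space M | B. B \<in> sets (E j)})"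

definition phi_mixing ::
    "'w measure \<Rightarrow> (nat \<Rightarrow> 'x measure) \<Rightarrow> (nat \<Rightarrow> 'w \<Rightarrow> 'x) \<Rightarrow> nat \<Rightarrow> real" where
  "phi_mixing M E X m =
     (SUP k\<in>{1..}.
      SUP A\<in>{A \<in> sets (gen_sigma M E X {1..k}). measure M A > 0}.
      SUP B\<in>sets (gen_sigma M E X {k + m..}).
        \<bar>\<P>(\<omega> in M. \<omega> \<in> B \<bar> \<omega> \<in> A) - measure M B\<bar>)"

definition lin_sum :: "(nat \<Rightarrow> nat \<Rightarrow> 'x \<Rightarrow> real) \<Rightarrow> (nat \<Rightarrow> 'w \<Rightarrow> 'x) \<Rightarrow> nat \<Rightarrow> 'w \<Rightarrow> real" where
  "lin_sum g X N \<omega> = (\<Sum>j=1..N. g N j (X j \<omega>))"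

definition std_normal_cdf :: "real \<Rightarrow> real" where
  "std_normal_cdf = cdf std_normal_distribution"

text \<open>Moments that are not assumed finite are taken in \<open>ennreal\<close>, since the Bochner integral of a
  non-integrable function is \<open>0\<close>. The value below is \<open>E[|f|^(3/2)]^(2/3)\<close>.\<close>

definition norm_3_2 :: "'w measure \<Rightarrow> ('w \<Rightarrow> real) \<Rightarrow> ennreal" where
  "norm_3_2 M f =
     (let I = (\<integral>\<^sup>+\<omega>. ennreal (\<bar>f \<omega>\<bar> powr (3/2)) \<partial>M)
      in if I = \<infinity> then \<infinity> else ennreal (enn2real I powr (2/3)))"

definition gamma_coeff ::
    "'w measure \<Rightarrow> (nat \<Rightarrow> nat \<Rightarrow> nat \<Rightarrow> 'w \<Rightarrow> real) \<Rightarrow> real \<Rightarrow> nat \<Rightarrow> ennreal" where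
  "gamma_coeff M R' \<epsilon> N =
     Max {norm_3_2 M (\<lambda>\<omega>. R' N j k \<omega> - R' N j (k - 1) \<omega>) | j k.
            1 \<le> j \<and> j \<le> k \<and> k \<le> N \<and> \<bar>real j - real k\<bar> \<le> real N powr \<epsilon>}"

text \<open>\<open>R N\<close> and \<open>R' N j k\<close> are the remainder and its modification that does not depend
  on \<open>X j, \<dots>, X k\<close>. Being a (measurable) function of some of the \<open>X i\<close> is expressed as measurability
  with respect to the \<open>\<sigma>\<close>-algebra generated by them.\<close>

locale nonlinear_statistic = prob_space M
  for M :: "'w measure"
    and E :: "nat \<Rightarrow> 'x measure"
    and X :: "nat \<Rightarrow> 'w \<Rightarrow> 'x"
    and g :: "nat \<Rightarrow> nat \<Rightarrow> 'x \<Rightarrow> real"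
    and R :: "nat \<Rightarrow> 'w \<Rightarrow> real"
    and R' :: "nat \<Rightarrow> nat \<Rightarrow> nat \<Rightarrow> 'w \<Rightarrow> real" +
  assumes X_measurable: "\<And>j. 1 \<le> j \<Longrightarrow> X j \<in> measurable M (E j)"
    and g_measurable: "\<And>N j. 1 \<le> j \<Longrightarrow> j \<le> N \<Longrightarrow> g N j \<in> borel_measurable (E j)"
    and g_integrable: "\<And>N j. 1 \<le> j \<Longrightarrow> j \<le> N \<Longrightarrow> integrable M (\<lambda>\<omega>. g N j (X j \<omega>))"
    and g_centered: "\<And>N j. 1 \<le> j \<Longrightarrow> j \<le> N \<Longrightarrow> expectation (\<lambda>\<omega>. g N j (X j \<omega>)) = 0"
    and R_measurable: "\<And>N. 1 \<le> N \<Longrightarrow> R N \<in> borel_measurable (gen_sigma M E X {1..N})"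
    and R'_measurable: "\<And>N j k. 1 \<le> j \<Longrightarrow> j \<le> k \<Longrightarrow> k \<le> N \<Longrightarrow>
          R' N j k \<in> borel_measurable (gen_sigma M E X ({1..N} - {j..k}))"
    and R'_base: "\<And>N j \<omega>. 1 \<le> j \<Longrightarrow> j \<le> N \<Longrightarrow> \<omega> \<in> space M \<Longrightarrow> R' N j (j - 1) \<omega> = R N \<omega>"

end

theory Submission
  imports Defs "HOL-Real_Asymp.Real_Asymp"
begin

text \<open>Put \<open>\<xi>\<^sub>j = g\<^sub>j(X\<^sub>j)/\<sigma>\<close> and \<open>\<Delta> = R/\<sigma>\<close>, and let \<open>f\<close> be a Stein solution, whose derivative is a
  difference of bounded monotone functions up to a constant. With windows of radius \<open>i l\<close> around \<open>j\<close>, where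
  \<open>l\<close> is about \<open>N powr (10/p)\<close>, mixing makes \<open>\<xi>\<^sub>j\<close> and a variable that ignores a larger window independent up
  to a power of \<open>N\<close> in total variation. Since \<open>f\<close> is Lipschitz, replacing \<open>\<Delta>\<close> by its local version
  \<open>R\<^sub>a\<^sub>,\<^sub>b/\<sigma>\<close> in increments of \<open>f\<close> costs only \<open>E|\<xi>\<^sub>j||\<Delta> - R\<^sub>a\<^sub>,\<^sub>b/\<sigma>|\<close>, which Hoelder's inequality with exponents \<open>3\<close>
  and \<open>3/2\<close> bounds by \<open>\<gamma>\<close>. The sum \<open>\<Sum>E \<xi>\<^sub>j f(T)\<close> thus reduces to \<open>E f'(T)\<close> up to the mean
  oscillation of \<open>f'\<close> around \<open>T\<close>, that is, up to a concentration function of \<open>T\<close> with some windows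
  removed. The same identity for a trapezoidal \<open>f'\<close> at scale \<open>N powr (-1/2)\<close>, up to powers of \<open>l\<close>, bounds
  this concentration function by half of itself with one more window removed, plus an error of the right
  order; iterating \<open>l\<close> times makes it small enough.\<close>

section \<open>Decoupling of sub-\<open>\<sigma>\<close>-algebras\<close>

text \<open>Only third moments are available, so local sums are unbounded and the radius over which
  the oscillation of \<open>f'\<close> matters is random. A concentration bound applies only if
  centre and radius are nearly independent; nested windows supply a level where the two are a gap
  apart. As the dependence is nonlinear, closeness in total variation replaces covariance
  inequalities; the factor \<open>prob A\<close> in the phi-mixing bound makes it available.

  The centres are sums with a window deleted and the remainder exchanged, so a self-bounding
  inequality for \<open>T\<close> alone would not close. Concentration is stated for all thinned
  sums, with so few deletions that their second moment stays above \<open>1/2\<close>.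

  The exponent \<open>10/p\<close> makes the decoupling error of order \<open>N powr (- 10)\<close>,
  enough against the factor \<open>N ^ 4\<close> from summing covariances. Gap and number of levels
  are both \<open>l\<close>, and \<open>2 ^ l\<close> exceeds \<open>N\<close> for large
  \<open>N\<close>, so \<open>l\<close> halvings suffice. A window has order \<open>l ^ 2\<close>
  points, the errors carry at most the fifth power of this, and \<open>l ^ 10\<close> is the loss
  \<open>N powr (100/p)\<close>.\<close>

lemma sigma_sets_approx_by_algebra:
  assumes alg: "algebra \<Omega> \<A>"
    and fin: "finite_measure \<mu>" "finite_measure \<nu>"
    and sets: "sets \<mu> = sigma_sets \<Omega> \<A>" "sets \<nu> = sigma_sets \<Omega> \<A>"
    and C: "C \<in> sigma_sets \<Omega> \<A>" and e: "e > 0"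
  shows "\<exists>A\<in>\<A>. measure \<mu> ((C - A) \<union> (A - C)) < e \<and> measure \<nu> ((C - A) \<union> (A - C)) < e"
  using C e
proof (induction arbitrary: e)
  case (Basic a)
  then show ?case by (intro bexI[of _ a]) auto
next
  case Empty
  then show ?case
    using algebra.axioms(1)[OF alg] by (intro bexI[of _ "{}"]) (auto simp: ring_of_sets_iff)
next
  case (Compl a)
  obtain A where A: "A \<in> \<A>" "measure \<mu> ((a - A) \<union> (A - a)) < e" "measure \<nu> ((a - A) \<union> (A - a)) < e"
    using Compl by blast
  have sub: "A \<subseteq> \<Omega>" "a \<subseteq> \<Omega>"
    using A(1) alg Compl(1) sigma_sets_into_sp[of \<A> \<Omega> a]
    by (auto simp: algebra_iff_Un)
  have "((\<Omega> - a) - (\<Omega> - A)) \<union> ((\<Omega> - A) - (\<Omega> - a)) = (a - A) \<union> (A - a)"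
    using sub by auto
  moreover have "\<Omega> - A \<in> \<A>" using alg A(1) by (auto simp: algebra_iff_Un)
  ultimately show ?case using A by metis
next
  \<comment> \<open>Cut the union at an \<open>n\<close> that is good for both measures and
    approximate each of the \<open>n\<close> pieces within \<open>e / (2 * (n + 1))\<close>, so that
    both parts of the error stay below \<open>e / 2\<close>. One approximating set must serve both
    measures, since later their values on it are compared.\<close>
  case (Union a)
  have am: "a i \<in> sets \<mu>" "a i \<in> sets \<nu>" for i using Union sets by auto
  let ?U = "\<lambda>n. \<Union>i<n. a i"
  let ?B = "\<Union>i. a i"
  have tail: "(\<lambda>n. measure \<kappa> (?B - ?U n)) \<longlonglongrightarrow> 0"
    if "finite_measure \<kappa>" "\<And>i. a i \<in> sets \<kappa>" for \<kappa>
  proof -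
    interpret k: finite_measure \<kappa> by fact
    have "(\<lambda>n. measure \<kappa> (?B - ?U n)) \<longlonglongrightarrow> measure \<kappa> (\<Inter>n. ?B - ?U n)"
      using that by (intro k.finite_Lim_measure_decseq) (auto simp: decseq_def)
    moreover have "(\<Inter>n. ?B - ?U n) = {}" by auto
    ultimately show ?thesis by (metis (no_types, lifting) measure_empty)
  qed
  have "\<forall>\<^sub>F n in sequentially. measure \<mu> (?B - ?U n) < e/2 \<and> measure \<nu> (?B - ?U n) < e/2"
    using order_tendstoD(2)[OF tail[OF fin(1) am(1)], of "e/2"]
      order_tendstoD(2)[OF tail[OF fin(2) am(2)], of "e/2"] \<open>e > 0\<close>
    by (simp add: eventually_conj)
  then obtain n where n: "measure \<mu> (?B - ?U n) < e/2" "measure \<nu> (?B - ?U n) < e/2"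
    by (auto simp: eventually_sequentially)
  define e' where "e' = e / (2 * (real n + 1))"
  have e': "e' > 0" using \<open>e > 0\<close> by (auto simp: e'_def)
  have "\<forall>i. \<exists>A\<in>\<A>. measure \<mu> ((a i - A) \<union> (A - a i)) < e' \<and> measure \<nu> ((a i - A) \<union> (A - a i)) < e'"
    using Union e' by blast
  then obtain A where A: "\<And>i. A i \<in> \<A>" "\<And>i. measure \<mu> ((a i - A i) \<union> (A i - a i)) < e'"
    "\<And>i. measure \<nu> ((a i - A i) \<union> (A i - a i)) < e'" by metis
  let ?A = "\<Union>i<n. A i"
  have AA: "?A \<in> \<A>" using A(1) alg
    by (metis algebra.axioms(1) finite_lessThan ring_of_sets.finite_UN)
  have Am: "A i \<in> sets \<mu>" "A i \<in> sets \<nu>" for i using A(1) sets by auto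
  have bd: "measure \<kappa> ((?B - ?A) \<union> (?A - ?B)) < e"
    if "finite_measure \<kappa>" and m: "\<And>i. a i \<in> sets \<kappa>" "\<And>i. A i \<in> sets \<kappa>"
      "measure \<kappa> (?B - ?U n) < e/2" "\<And>i. measure \<kappa> ((a i - A i) \<union> (A i - a i)) < e'" for \<kappa>
  proof -
    interpret k: finite_measure \<kappa> by fact
    have "measure \<kappa> ((?B - ?A) \<union> (?A - ?B)) \<le> measure \<kappa> ((?B - ?U n) \<union> (\<Union>i<n. (a i - A i) \<union> (A i - a i)))"
      using m by (intro k.finite_measure_mono) auto
    also have "\<dots> \<le> measure \<kappa> (?B - ?U n) + measure \<kappa> (\<Union>i<n. (a i - A i) \<union> (A i - a i))"
      using m by (intro measure_Un_le) auto
    also have "measure \<kappa> (\<Union>i<n. (a i - A i) \<union> (A i - a i)) \<le> (\<Sum>i<n. measure \<kappa> ((a i - A i) \<union> (A i - a i)))"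
      using m by (intro measure_UNION_le) auto
    also have "\<dots> \<le> (\<Sum>i<n. e')" using m(4) by (intro sum_mono) (auto intro: less_imp_le)
    also have "\<dots> \<le> e/2" using \<open>e>0\<close> by (auto simp: e'_def field_simps)
    finally show ?thesis using m(3) by simp
  qed
  show ?case
    using bd[OF fin(1) am(1) Am(1) n(1) A(2)] bd[OF fin(2) am(2) Am(2) n(2) A(3)] AA by blast
qed

text \<open>These are the finite unions of rectangles, parametrised by the section map
  \<open>S\<close>. In this form complements and unions act pointwise on \<open>S\<close>, and the
  level sets of \<open>S\<close> form a measurable partition of the first factor; the summation in
  \<open>decoupled_of_phi\<close> runs over exactly this partition.\<close>

definition simple_sections :: "'a measure \<Rightarrow> 'b measure \<Rightarrow> ('a \<times> 'b) set set" where
  "simple_sections U V = {Sigma (space U) S | S. finite (S ` space U) \<and>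
     (\<forall>x\<in>space U. S x \<in> sets V) \<and> (\<forall>v. {x\<in>space U. S x = v} \<in> sets U)}"

lemma simple_sections_decompose:
  "Sigma (space U) S = (\<Union>v\<in>S ` space U. {x\<in>space U. S x = v} \<times> v)"
  by auto

lemma simple_sections_sets:
  assumes "C \<in> simple_sections U V"
  shows "C \<in> sets (U \<Otimes>\<^sub>M V)"
proof -
  obtain S where S: "C = Sigma (space U) S" "finite (S ` space U)" "\<forall>x\<in>space U. S x \<in> sets V"
    "\<forall>v. {x\<in>space U. S x = v} \<in> sets U"
    using assms unfolding simple_sections_def by blast
  show ?thesis
    unfolding S(1) simple_sections_decompose
    using S by (intro sets.finite_UN) auto
qed

lemma simple_sections_algebra: "algebra (space U \<times> space V) (simple_sections U V)"
  unfolding algebra_iff_Un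
proof (intro conjI ballI)
  show "simple_sections U V \<subseteq> Pow (space U \<times> space V)"
    using simple_sections_sets[of _ U V] sets.sets_into_space[of _ "U \<Otimes>\<^sub>M V"]
    unfolding space_pair_measure by blast
  have "{} = Sigma (space U) (\<lambda>_. {})" by auto
  moreover have "finite ((\<lambda>_. {}) ` space U)" by (rule finite_subset[of _ "{{}}"]) auto
  ultimately show "{} \<in> simple_sections U V"
    unfolding simple_sections_def by (intro CollectI exI[of _ "\<lambda>_. {}"]) auto
next
  fix C assume "C \<in> simple_sections U V"
  then obtain S where S: "C = Sigma (space U) S" "finite (S ` space U)" "\<forall>x\<in>space U. S x \<in> sets V"
    "\<forall>v. {x\<in>space U. S x = v} \<in> sets U"
    unfolding simple_sections_def by blast
  have "{x\<in>space U. space V - S x = v} \<in> sets U" for v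
  proof -
    have "{x\<in>space U. space V - S x = v} = (\<Union>w\<in>{w\<in>S ` space U. space V - w = v}. {x\<in>space U. S x = w})"
      by auto
    also have "\<dots> \<in> sets U" using S by (intro sets.finite_UN) auto
    finally show ?thesis .
  qed
  moreover have "(\<lambda>x. space V - S x) ` space U = (\<lambda>v. space V - v) ` (S ` space U)" by auto
  then have "finite ((\<lambda>x. space V - S x) ` space U)" using S(2) by (metis finite_imageI)
  moreover have "space U \<times> space V - C = Sigma (space U) (\<lambda>x. space V - S x)" using S(1) by auto
  ultimately show "space U \<times> space V - C \<in> simple_sections U V"
    unfolding simple_sections_def using S(3) by (intro CollectI exI[of _ "\<lambda>x. space V - S x"]) auto
next
  fix C D assume "C \<in> simple_sections U V" "D \<in> simple_sections U V"
  then obtain S T where S: "C = Sigma (space U) S" "finite (S ` space U)" "\<forall>x\<in>space U. S x \<in> sets V"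
    "\<forall>v. {x\<in>space U. S x = v} \<in> sets U"
    and T: "D = Sigma (space U) T" "finite (T ` space U)" "\<forall>x\<in>space U. T x \<in> sets V"
    "\<forall>v. {x\<in>space U. T x = v} \<in> sets U"
    unfolding simple_sections_def by blast
  have "{x\<in>space U. S x \<union> T x = v} \<in> sets U" for v
  proof -
    have "{x\<in>space U. S x \<union> T x = v} = (\<Union>(p,q)\<in>{(p,q)\<in>S ` space U \<times> T ` space U. p \<union> q = v}.
        {x\<in>space U. S x = p} \<inter> {x\<in>space U. T x = q})"
      by auto
    also have "\<dots> \<in> sets U" using S T by (intro sets.finite_UN) (auto intro: finite_subset[of _ "S ` space U \<times> T ` space U"])
    finally show ?thesis .
  qed
  moreover have "(\<lambda>x. S x \<union> T x) ` space U \<subseteq> (\<lambda>(p,q). p \<union> q) ` (S ` space U \<times> T ` space U)" by auto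
  then have "finite ((\<lambda>x. S x \<union> T x) ` space U)" using S(2) T(2) 
    by (meson finite_SigmaI finite_imageI finite_subset)
  moreover have "C \<union> D = Sigma (space U) (\<lambda>x. S x \<union> T x)" using S(1) T(1) by auto
  ultimately show "C \<union> D \<in> simple_sections U V"
    unfolding simple_sections_def using S(3) T(3) by (intro CollectI exI[of _ "\<lambda>x. S x \<union> T x"]) auto
qed

lemma rectangle_simple_sections:
  assumes "a \<in> sets U" "b \<in> sets V"
  shows "a \<times> b \<in> simple_sections U V"
proof -
  let ?S = "\<lambda>x. if x \<in> a then b else {}"
  have sp: "a \<subseteq> space U" using assms sets.sets_into_space by auto
  have "{x\<in>space U. ?S x = v} \<in> sets U" for v
  proof -
    have "{x\<in>space U. ?S x = v} = (if v = b then a else {}) \<union> (if v = {} then space U - a else {})"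
      using sp by auto
    then show ?thesis using assms by auto
  qed
  moreover have "finite (?S ` space U)" by (rule finite_subset[of _ "{b,{}}"]) auto
  moreover have "a \<times> b = Sigma (space U) ?S" using sp by (auto split: if_splits)
  ultimately show ?thesis unfolding simple_sections_def using assms
    by (intro CollectI exI[of _ ?S]) auto
qed

lemma sigma_sets_simple_sections:
  "sets (U \<Otimes>\<^sub>M V) = sigma_sets (space U \<times> space V) (simple_sections U V)"
proof
  show "sets (U \<Otimes>\<^sub>M V) \<subseteq> sigma_sets (space U \<times> space V) (simple_sections U V)"
    unfolding sets_pair_measure
    by (intro sigma_sets_mono) (auto intro: rectangle_simple_sections sigma_sets.Basic)
  show "sigma_sets (space U \<times> space V) (simple_sections U V) \<subseteq> sets (U \<Otimes>\<^sub>M V)"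
    using simple_sections_sets by (metis space_pair_measure sets.sigma_sets_subset subsetI)
qed

text \<open>Total variation distance at most \<open>c\<close> between the joint law, carried by the
  diagonal, and the product law. The product is taken on \<open>M \<Otimes>\<^sub>M M\<close>
  because \<open>U\<close> and \<open>V\<close> serve only as sigma-algebras.\<close>

definition (in prob_space) decoupled :: "'a measure \<Rightarrow> 'a measure \<Rightarrow> real \<Rightarrow> bool" where
  "decoupled U V c \<longleftrightarrow> (\<forall>C\<in>sets (U \<Otimes>\<^sub>M V).
     \<bar>prob {\<omega>\<in>space M. (\<omega>, \<omega>) \<in> C} - measure (M \<Otimes>\<^sub>M M) C\<bar> \<le> c)"

lemma sets_pair_measure_subalgebra:
  assumes "subalgebra M U" "subalgebra M' V"
  shows "sets (U \<Otimes>\<^sub>M V) \<subseteq> sets (M \<Otimes>\<^sub>M M')"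
proof -
  have "{a \<times> b |a b. a \<in> sets U \<and> b \<in> sets V} \<subseteq> {a \<times> b |a b. a \<in> sets M \<and> b \<in> sets M'}"
    using assms unfolding subalgebra_def by (intro Collect_mono) (metis in_mono)
  then show ?thesis
    using assms unfolding sets_pair_measure subalgebra_def by (simp add: sigma_sets_mono')
qed

text \<open>On a set with finitely many distinct sections the difference splits along the level sets
  \<open>?E v\<close>. Because the hypothesis carries the factor \<open>prob A\<close>, the bounds
  \<open>c * prob (?E v)\<close> sum to \<open>c\<close> whatever the number of pieces; a bound
  without this factor would grow with that number. Approximation by such sets covers the whole
  product sigma-algebra.\<close>

lemma (in prob_space) decoupled_of_phi:
  assumes sub: "subalgebra M U" "subalgebra M V"
    and phi: "\<And>A B. A \<in> sets U \<Longrightarrow> B \<in> sets V \<Longrightarrow> \<bar>prob (A \<inter> B) - prob A * prob B\<bar> \<le> c * prob A"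
  shows "decoupled U V c"
  unfolding decoupled_def
proof
  fix C assume C: "C \<in> sets (U \<Otimes>\<^sub>M V)"
  interpret P: pair_prob_space M M ..
  have sp: "space U = space M" "space V = space M" using sub by (auto simp: subalgebra_def)
  have setsU: "sets U \<subseteq> sets M" "sets V \<subseteq> sets M" using sub by (auto simp: subalgebra_def)
  have idm: "(\<lambda>\<omega>. (\<omega>,\<omega>)) \<in> measurable M (U \<Otimes>\<^sub>M V)"
    using sub by (intro measurable_Pair) (auto intro!: measurableI simp: sp setsU[THEN subsetD])
  have idm2: "(\<lambda>x. x) \<in> measurable (M \<Otimes>\<^sub>M M) (U \<Otimes>\<^sub>M V)"
  proof (rule measurableI)
    fix A assume A: "A \<in> sets (U \<Otimes>\<^sub>M V)"
    then have "A \<subseteq> space (M \<Otimes>\<^sub>M M)" using sets.sets_into_space[OF A] by (simp add: space_pair_measure sp)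
    then show "(\<lambda>x. x) -` A \<inter> space (M \<Otimes>\<^sub>M M) \<in> sets (M \<Otimes>\<^sub>M M)"
      using A sets_pair_measure_subalgebra[OF sub] by (auto simp: Int_absorb2)
  qed (simp add: space_pair_measure sp)
  define \<mu> where "\<mu> = distr M (U \<Otimes>\<^sub>M V) (\<lambda>\<omega>. (\<omega>,\<omega>))"
  define \<nu> where "\<nu> = distr (M \<Otimes>\<^sub>M M) (U \<Otimes>\<^sub>M V) (\<lambda>x. x)"
  interpret mu: prob_space \<mu> unfolding \<mu>_def by (rule prob_space_distr[OF idm])
  interpret nu: prob_space \<nu> unfolding \<nu>_def by (rule P.prob_space_distr[OF idm2])
  have smu: "sets \<mu> = sets (U \<Otimes>\<^sub>M V)" "sets \<nu> = sets (U \<Otimes>\<^sub>M V)" by (auto simp: \<mu>_def \<nu>_def)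
  have mu_eq: "measure \<mu> D = prob {\<omega>\<in>space M. (\<omega>,\<omega>) \<in> D}" if "D \<in> sets (U \<Otimes>\<^sub>M V)" for D
    unfolding \<mu>_def using that idm by (subst measure_distr) (auto intro!: arg_cong[where f=prob])
  have nu_eq: "measure \<nu> D = measure (M \<Otimes>\<^sub>M M) D" if "D \<in> sets (U \<Otimes>\<^sub>M V)" for D
  proof -
    have "D \<subseteq> space (M \<Otimes>\<^sub>M M)" using sets.sets_into_space[OF that] by (simp add: space_pair_measure sp)
    then show ?thesis
    unfolding \<nu>_def using that idm2 by (subst measure_distr) (auto intro!: arg_cong[where f="measure _"])
  qed
  have simple: "\<bar>measure \<mu> A - measure \<nu> A\<bar> \<le> c" if A: "A \<in> simple_sections U V" for A
  proof -
    obtain S where S: "A = Sigma (space U) S" "finite (S ` space U)" "\<forall>x\<in>space U. S x \<in> sets V"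
      "\<forall>v. {x\<in>space U. S x = v} \<in> sets U"
      using A unfolding simple_sections_def by blast
    let ?I = "S ` space U"
    let ?E = "\<lambda>v. {x\<in>space U. S x = v}"
    have Ev: "?E v \<in> sets U" "?E v \<in> sets M" for v using S setsU by auto
    have Iv: "v \<in> sets V" "v \<in> sets M" if "v \<in> ?I" for v using that S setsU by auto
    have disj: "disjoint_family_on (\<lambda>v. ?E v \<times> v) ?I" by (auto simp: disjoint_family_on_def)
    have dm: "A = (\<Union>v\<in>?I. ?E v \<times> v)" using S(1) simple_sections_decompose by metis
    have rect: "?E v \<times> v \<in> sets (U \<Otimes>\<^sub>M V)" if "v \<in> ?I" for v using Ev Iv[OF that] by auto
    have 1: "measure \<mu> A = (\<Sum>v\<in>?I. prob (?E v \<inter> v))"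
    proof -
      have "measure \<mu> A = (\<Sum>v\<in>?I. measure \<mu> (?E v \<times> v))"
        unfolding dm using disj rect S(2) by (intro mu.finite_measure_finite_Union) (auto simp: smu)
      also have "\<dots> = (\<Sum>v\<in>?I. prob (?E v \<inter> v))"
        using rect by (intro sum.cong refl) (subst mu_eq, auto simp: sp intro!: arg_cong[where f=prob])
      finally show ?thesis .
    qed
    have 2: "measure \<nu> A = (\<Sum>v\<in>?I. prob (?E v) * prob v)"
    proof -
      have "measure \<nu> A = (\<Sum>v\<in>?I. measure \<nu> (?E v \<times> v))"
        unfolding dm using disj rect S(2) by (intro nu.finite_measure_finite_Union) (auto simp: smu)
      also have "\<dots> = (\<Sum>v\<in>?I. prob (?E v) * prob v)"
        using rect Ev Iv by (intro sum.cong refl) (subst nu_eq, auto simp: measure_def emeasure_pair_measure_Times enn2real_mult)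
      finally show ?thesis .
    qed
    have 3: "(\<Sum>v\<in>?I. prob (?E v)) = 1"
    proof -
      have "(\<Sum>v\<in>?I. prob (?E v)) = prob (\<Union>v\<in>?I. ?E v)"
        using Ev S(2) by (intro finite_measure_finite_Union[symmetric]) (auto simp: disjoint_family_on_def)
      also have "(\<Union>v\<in>?I. ?E v) = space M" by (auto simp: sp)
      finally show ?thesis by (simp add: prob_space)
    qed
    have "\<bar>measure \<mu> A - measure \<nu> A\<bar> = \<bar>\<Sum>v\<in>?I. prob (?E v \<inter> v) - prob (?E v) * prob v\<bar>"
      unfolding 1 2 by (simp add: sum_subtractf)
    also have "\<dots> \<le> (\<Sum>v\<in>?I. \<bar>prob (?E v \<inter> v) - prob (?E v) * prob v\<bar>)" by (rule sum_abs)
    also have "\<dots> \<le> (\<Sum>v\<in>?I. c * prob (?E v))" using Ev Iv by (intro sum_mono phi) auto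
    also have "\<dots> = c" using 3 by (simp flip: sum_distrib_left)
    finally show ?thesis .
  qed
  have "\<bar>measure \<mu> C - measure \<nu> C\<bar> \<le> c + e" if e: "e > 0" for e
  proof -
    obtain A where A: "A \<in> simple_sections U V"
      "measure \<mu> ((C - A) \<union> (A - C)) < e/2" "measure \<nu> ((C - A) \<union> (A - C)) < e/2"
      using sigma_sets_approx_by_algebra[OF simple_sections_algebra mu.finite_measure_axioms nu.finite_measure_axioms, of U V C "e/2"] C e
      by (auto simp: smu sigma_sets_simple_sections)
    have Am: "A \<in> sets (U \<Otimes>\<^sub>M V)" using A(1) by (rule simple_sections_sets)
    have d: "\<bar>measure \<kappa> C - measure \<kappa> A\<bar> \<le> measure \<kappa> ((C - A) \<union> (A - C))"
      if "finite_measure \<kappa>" "C \<in> sets \<kappa>" "A \<in> sets \<kappa>" for \<kappa>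
    proof -
      interpret k: finite_measure \<kappa> by fact
      have "measure \<kappa> C \<le> measure \<kappa> (A \<union> ((C - A) \<union> (A - C)))" "measure \<kappa> A \<le> measure \<kappa> (C \<union> ((C - A) \<union> (A - C)))"
        using that by (auto intro!: k.finite_measure_mono)
      moreover have "measure \<kappa> (A \<union> ((C - A) \<union> (A - C))) \<le> measure \<kappa> A + measure \<kappa> ((C - A) \<union> (A - C))"
        "measure \<kappa> (C \<union> ((C - A) \<union> (A - C))) \<le> measure \<kappa> C + measure \<kappa> ((C - A) \<union> (A - C))"
        using that by (auto intro!: measure_Un_le)
      ultimately show ?thesis by linarith
    qed
    show ?thesis
      using simple[OF A(1)] d[OF mu.finite_measure_axioms] d[OF nu.finite_measure_axioms] A C Am
      unfolding smu by fastforce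
  qed
  then have "\<bar>measure \<mu> C - measure \<nu> C\<bar> \<le> c" by (rule field_le_epsilon)
  then show "\<bar>prob {\<omega> \<in> space M. (\<omega>, \<omega>) \<in> C} - measure (M \<Otimes>\<^sub>M M) C\<bar> \<le> c"
    using mu_eq[OF C] nu_eq[OF C] by simp
qed

lemma (in prob_space) measure_pair_sections:
  assumes "C \<in> sets (M \<Otimes>\<^sub>M M)"
  shows "measure (M \<Otimes>\<^sub>M M) C = (\<integral>x. prob {y\<in>space M. (x, y) \<in> C} \<partial>M)"
    and "measure (M \<Otimes>\<^sub>M M) C = (\<integral>y. prob {x\<in>space M. (x, y) \<in> C} \<partial>M)"
    and "(\<lambda>x. prob {y\<in>space M. (x, y) \<in> C}) \<in> borel_measurable M"
    and "(\<lambda>y. prob {x\<in>space M. (x, y) \<in> C}) \<in> borel_measurable M"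
proof -
  interpret P: pair_prob_space M M ..
  have C: "Pair x -` C = {y\<in>space M. (x, y) \<in> C}" for x
    using sets.sets_into_space[OF assms] by (auto simp: space_pair_measure)
  have C': "(\<lambda>x. (x, y)) -` C = {x\<in>space M. (x, y) \<in> C}" for y
    using sets.sets_into_space[OF assms] by (auto simp: space_pair_measure)
  have m: "(\<lambda>x. emeasure M {y\<in>space M. (x, y) \<in> C}) \<in> borel_measurable M"
    using measurable_emeasure_Pair[OF assms] by (simp add: C)
  have m': "(\<lambda>y. emeasure M {x\<in>space M. (x, y) \<in> C}) \<in> borel_measurable M"
    using P.measurable_emeasure_Pair2[OF assms] by (simp add: C')
  show 1: "(\<lambda>x. prob {y\<in>space M. (x, y) \<in> C}) \<in> borel_measurable M"
    using m unfolding measure_def by measurable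
  show 2: "(\<lambda>y. prob {x\<in>space M. (x, y) \<in> C}) \<in> borel_measurable M"
    using m' unfolding measure_def by measurable
  show "measure (M \<Otimes>\<^sub>M M) C = (\<integral>x. prob {y\<in>space M. (x, y) \<in> C} \<partial>M)"
    using 1 emeasure_pair_measure_alt[OF assms]
    by (subst integral_eq_nn_integral) (auto simp: C measure_def[of "M \<Otimes>\<^sub>M M"] emeasure_eq_measure)
  show "measure (M \<Otimes>\<^sub>M M) C = (\<integral>y. prob {x\<in>space M. (x, y) \<in> C} \<partial>M)"
    using 2 P.emeasure_pair_measure_alt2[OF assms]
    by (subst integral_eq_nn_integral) (auto simp: C' measure_def[of "M \<Otimes>\<^sub>M M"] emeasure_eq_measure)
qed

lemma (in prob_space) abs_integral_diff_le:
  fixes u v :: "'a \<Rightarrow> real"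
  assumes "u \<in> borel_measurable M" "v \<in> borel_measurable M"
    and "\<And>x. x \<in> space M \<Longrightarrow> \<bar>u x\<bar> \<le> B" "\<And>x. x \<in> space M \<Longrightarrow> \<bar>v x\<bar> \<le> B"
    and "\<And>x. x \<in> space M \<Longrightarrow> \<bar>u x - v x\<bar> \<le> c"
  shows "\<bar>(\<integral>x. u x \<partial>M) - (\<integral>x. v x \<partial>M)\<bar> \<le> c"
proof -
  have i: "integrable M u" "integrable M v"
    using assms by (auto intro!: integrable_const_bound[of _ B])
  have "\<bar>(\<integral>x. u x - v x \<partial>M)\<bar> \<le> (\<integral>x. \<bar>u x - v x\<bar> \<partial>M)" by simp
  also have "\<dots> \<le> (\<integral>x. c \<partial>M)" using i assms(5) by (intro integral_mono) auto
  finally show ?thesis using i by (simp add: prob_space)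
qed

text \<open>A set in the \<open>\<sigma>\<close>-algebra generated by past and future is the diagonal preimage of a set of
  pairs, so that past, present and future can be separated by three one-sided decouplings.\<close>

lemma (in prob_space) decoupled_two_sided:
  assumes sub: "subalgebra M P" "subalgebra M L" "subalgebra M F" "subalgebra M PL"
    and PL: "sets P \<subseteq> sets PL" "sets L \<subseteq> sets PL"
    and Q: "space Q = space M" "sets Q \<subseteq> sigma_sets (space M) (sets P \<union> sets F)"
    and dec: "decoupled PL F c" "decoupled P L c" "decoupled P F c"
  shows "decoupled L Q (3 * c)"
  unfolding decoupled_def
proof
  fix C assume C: "C \<in> sets (L \<Otimes>\<^sub>M Q)"
  interpret P: pair_prob_space M M ..
  let ?O = "space M"
  have sp [simp]: "space P = ?O" "space L = ?O" "space F = ?O" "space PL = ?O"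
    using sub by (auto simp: subalgebra_def)
  have tops: "?O \<in> sets P" "?O \<in> sets F" "?O \<in> sets L"
    using sets.top[of P] sets.top[of F] sets.top[of L] by simp_all
  let ?T = "L \<Otimes>\<^sub>M (P \<Otimes>\<^sub>M F)"
  \<comment> \<open>Good sets principle: the pull-back along doubling of the second coordinate
    contains all rectangles of \<open>L\<close> and \<open>Q\<close>, hence all of
    \<open>L \<Otimes>\<^sub>M Q\<close>. This represents \<open>C\<close> by a set \<open>D\<close>
    of triples in which past and future occupy separate coordinates.\<close>
  define VA where "VA = vimage_algebra (?O \<times> ?O) (\<lambda>(l, q). (l, (q, q))) ?T"
  have spVA: "space VA = ?O \<times> ?O" by (simp add: VA_def)
  have VAI: "(\<lambda>(l, q). (l, (q, q))) -` D \<inter> (?O \<times> ?O) \<in> sets VA" if "D \<in> sets ?T" for D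
    unfolding VA_def using that by (rule in_vimage_algebra)
  have r1: "a \<times> ?O \<in> sets VA" if "a \<in> sets L" for a
  proof -
    have "a \<times> (space P \<times> space F) \<in> sets ?T" using that tops by (intro pair_measureI) auto
    from VAI[OF this] show ?thesis using sets.sets_into_space[OF that]
      by (auto elim!: back_subst[of "\<lambda>x. x \<in> sets VA"])
  qed
  have r2: "?O \<times> b \<in> sets VA" if "b \<in> sets P \<union> sets F" for b
  proof -
    have "b \<in> sets P \<or> b \<in> sets F" using that by simp
    then show ?thesis
    proof
      assume b: "b \<in> sets P"
      have "space L \<times> (b \<times> space F) \<in> sets ?T" using b tops by (intro pair_measureI) auto
      from VAI[OF this] show ?thesis using sets.sets_into_space[OF b]
        by (auto elim!: back_subst[of "\<lambda>x. x \<in> sets VA"])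
    next
      assume b: "b \<in> sets F"
      have "space L \<times> (space P \<times> b) \<in> sets ?T" using b tops by (intro pair_measureI) auto
      from VAI[OF this] show ?thesis using sets.sets_into_space[OF b]
        by (auto elim!: back_subst[of "\<lambda>x. x \<in> sets VA"])
    qed
  qed
  have r3: "?O \<times> b \<in> sets VA" if "b \<in> sigma_sets ?O (sets P \<union> sets F)" for b
    using that
  proof induction
    case (Compl a)
    have "?O \<times> (?O - a) = space VA - ?O \<times> a" by (auto simp: spVA)
    then show ?case using Compl by auto
  next
    case (Union a)
    have "?O \<times> (\<Union>i. a i) = (\<Union>i. ?O \<times> a i)" by auto
    then show ?case using Union by auto
  qed (use r2 in auto)
  have "sets (L \<Otimes>\<^sub>M Q) \<subseteq> sets VA"
  proof -
    have "a \<times> b \<in> sets VA" if "a \<in> sets L" "b \<in> sets Q" for a b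
    proof -
      have "a \<times> b = (a \<times> ?O) \<inter> (?O \<times> b)"
        using sets.sets_into_space[OF that(1)] sets.sets_into_space[OF that(2)] Q(1) by auto
      then show ?thesis using r1[OF that(1)] r3 that(2) Q(2) by auto
    qed
    then have "{a \<times> b |a b. a \<in> sets L \<and> b \<in> sets Q} \<subseteq> sets VA" by blast
    then show ?thesis
      unfolding sets_pair_measure Q(1) sp spVA[symmetric] by (rule sets.sigma_sets_subset)
  qed
  with C have "C \<in> sets VA" by auto
  then obtain D where D: "D \<in> sets ?T" "C = (\<lambda>(l, q). (l, (q, q))) -` D \<inter> (?O \<times> ?O)"
    unfolding VA_def using sets_vimage_algebra2[of "\<lambda>(l, q). (l, (q, q))" "?O \<times> ?O" ?T]
    by (force simp: space_pair_measure)
  have Dm: "D \<in> sets (M \<Otimes>\<^sub>M (M \<Otimes>\<^sub>M M))"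
  proof -
    have "sets (P \<Otimes>\<^sub>M F) \<subseteq> sets (M \<Otimes>\<^sub>M M)" using sets_pair_measure_subalgebra sub by blast
    then have "subalgebra (M \<Otimes>\<^sub>M M) (P \<Otimes>\<^sub>M F)" by (simp add: subalgebra_def space_pair_measure)
    then show ?thesis using sets_pair_measure_subalgebra[OF sub(2)] D(1) by blast
  qed
  have memD: "(l, p, f) \<in> D \<Longrightarrow> l \<in> ?O \<and> p \<in> ?O \<and> f \<in> ?O" for l p f
    using sets.sets_into_space[OF D(1)] by (auto simp: space_pair_measure)
  have Cm: "C \<in> sets (M \<Otimes>\<^sub>M M)"
  proof -
    have "(\<lambda>(l, q). (l, (q, q))) \<in> measurable (M \<Otimes>\<^sub>M M) (M \<Otimes>\<^sub>M (M \<Otimes>\<^sub>M M))" by measurable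
    from measurable_sets[OF this Dm] show ?thesis by (simp add: D(2) space_pair_measure)
  qed
  \<comment> \<open>Past and present are set equal but kept apart from the future, so that the pair
    decoupling of \<open>PL\<close> and \<open>F\<close> applies.\<close>
  define E where "E = {(u, f) \<in> ?O \<times> ?O. (u, (u, f)) \<in> D}"
  have E: "E \<in> sets (PL \<Otimes>\<^sub>M F)"
  proof -
    have idP: "(\<lambda>x. x) \<in> measurable PL P" "(\<lambda>x. x) \<in> measurable PL L"
    proof -
      have "(\<lambda>x. x) -` A \<inter> space PL \<in> sets PL" if "A \<in> sets PL" for A
        using that sets.sets_into_space[OF that] by (simp add: Int_absorb2)
      then show "(\<lambda>x. x) \<in> measurable PL P" "(\<lambda>x. x) \<in> measurable PL L"
        using PL by (intro measurableI; simp add: subset_iff)+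
    qed
    have "(\<lambda>(u, f). (u, (u, f))) \<in> measurable (PL \<Otimes>\<^sub>M F) ?T"
      using measurable_compose[OF measurable_fst idP(1)] measurable_compose[OF measurable_fst idP(2)]
      unfolding case_prod_beta by (intro measurable_Pair) auto
    from measurable_sets[OF this D(1)] show ?thesis
      unfolding E_def by (auto simp: space_pair_measure elim!: back_subst[of "\<lambda>x. x \<in> sets (PL \<Otimes>\<^sub>M F)"])
  qed
  have Em: "E \<in> sets (M \<Otimes>\<^sub>M M)" using E sets_pair_measure_subalgebra sub by blast
  have D1: "{(p, l) \<in> ?O \<times> ?O. (l, (p, f)) \<in> D} \<in> sets (P \<Otimes>\<^sub>M L)" if "f \<in> ?O" for f
  proof -
    have "(\<lambda>(p, l). (l, (p, f))) \<in> measurable (P \<Otimes>\<^sub>M L) ?T"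
      unfolding case_prod_beta using that by (intro measurable_Pair) auto
    from measurable_sets[OF this D(1)] show ?thesis
      by (auto simp: space_pair_measure elim!: back_subst[of "\<lambda>x. x \<in> sets (P \<Otimes>\<^sub>M L)"])
  qed
  have D2: "{(p, f) \<in> ?O \<times> ?O. (l, (p, f)) \<in> D} \<in> sets (P \<Otimes>\<^sub>M F)" if "l \<in> ?O" for l
  proof -
    have "(\<lambda>pf. (l, pf)) \<in> measurable (P \<Otimes>\<^sub>M F) ?T" using that by (intro measurable_Pair) auto
    from measurable_sets[OF this D(1)] show ?thesis
      by (auto simp: space_pair_measure elim!: back_subst[of "\<lambda>x. x \<in> sets (P \<Otimes>\<^sub>M F)"])
  qed
  have D1m: "{(p, l) \<in> ?O \<times> ?O. (l, (p, f)) \<in> D} \<in> sets (M \<Otimes>\<^sub>M M)"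
    and D2m: "{(p, f') \<in> ?O \<times> ?O. (f, (p, f')) \<in> D} \<in> sets (M \<Otimes>\<^sub>M M)" if "f \<in> ?O" for f
    using D1[OF that] D2[OF that] sets_pair_measure_subalgebra[OF sub(1,2)]
      sets_pair_measure_subalgebra[OF sub(1,3)] by auto
  \<comment> \<open>Integrating out the past leaves a function of present and future; its iterated
    integral is the value of \<open>D\<close> under three independent copies of
    \<open>M\<close>.\<close>
  define A where "A = (\<lambda>(l, f). prob {p \<in> ?O. (l, p, f) \<in> D})"
  have Am: "A \<in> borel_measurable (M \<Otimes>\<^sub>M M)"
  proof -
    have *: "(\<lambda>x. (fst (fst x), (snd x, snd (fst x)))) \<in> measurable ((M \<Otimes>\<^sub>M M) \<Otimes>\<^sub>M M) (M \<Otimes>\<^sub>M (M \<Otimes>\<^sub>M M))" by measurable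
    let ?D = "{x \<in> (?O \<times> ?O) \<times> ?O. (fst (fst x), snd x, snd (fst x)) \<in> D}"
    have "?D \<in> sets ((M \<Otimes>\<^sub>M M) \<Otimes>\<^sub>M M)"
      using measurable_sets[OF * Dm]
      by (auto simp: space_pair_measure case_prod_beta elim!: back_subst[of "\<lambda>x. x \<in> sets ((M \<Otimes>\<^sub>M M) \<Otimes>\<^sub>M M)"])
    from measurable_emeasure_Pair[OF this]
    have "(\<lambda>x. emeasure M (Pair x -` ?D)) \<in> borel_measurable (M \<Otimes>\<^sub>M M)" .
    then have "(\<lambda>x. measure M (Pair x -` ?D)) \<in> borel_measurable (M \<Otimes>\<^sub>M M)"
      unfolding measure_def by measurable
    moreover have "Pair x -` ?D = {p \<in> ?O. (fst x, p, snd x) \<in> D}" for x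
      using memD by (cases x) auto
    ultimately show ?thesis unfolding A_def case_prod_beta by simp
  qed
  have Ab: "\<bar>A x\<bar> \<le> 1" for x unfolding A_def by (simp add: case_prod_beta)
  have Ai: "integrable (M \<Otimes>\<^sub>M M) A" using Am Ab by (intro P.P.integrable_const_bound[of _ 1]) auto
  have fub: "(\<integral>f. (\<integral>l. A (l, f) \<partial>M) \<partial>M) = (\<integral>l. (\<integral>f. A (l, f) \<partial>M) \<partial>M)"
    using P.Fubini_integral[of "\<lambda>l f. A (l, f)"] Ai by simp
  have a1: "measure (M \<Otimes>\<^sub>M M) {(p, l) \<in> ?O \<times> ?O. (l, (p, f)) \<in> D} = (\<integral>l. A (l, f) \<partial>M)" if "f \<in> ?O" for f
    unfolding measure_pair_sections(2)[OF D1m[OF that]] A_def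
    by (intro Bochner_Integration.integral_cong refl) (auto intro!: arg_cong[where f=prob])
  have a2: "measure (M \<Otimes>\<^sub>M M) {(p, f) \<in> ?O \<times> ?O. (l, (p, f)) \<in> D} = (\<integral>f. A (l, f) \<partial>M)" if "l \<in> ?O" for l
    unfolding measure_pair_sections(2)[OF D2m[OF that]] A_def
    by (intro Bochner_Integration.integral_cong refl) (auto intro!: arg_cong[where f=prob])
  have Aim: "(\<lambda>f. \<integral>l. A (l, f) \<partial>M) \<in> borel_measurable M" "(\<lambda>l. \<integral>f. A (l, f) \<partial>M) \<in> borel_measurable M"
    using Am by measurable
  have Aib: "\<bar>\<integral>l. A (l, f) \<partial>M\<bar> \<le> 1" "\<bar>\<integral>l. A (f, l) \<partial>M\<bar> \<le> 1" if "f \<in> space M" for f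
    unfolding a1[OF that, symmetric] a2[OF that, symmetric] using P.prob_le_1 by auto
  \<comment> \<open>Three comparisons, each costing \<open>c\<close>: on \<open>E\<close> the future
    is detached from past and present; then, for fixed \<open>f\<close>, the past from the present;
    and on the side of \<open>C\<close>, for fixed \<open>l\<close>, the past from the future. Both
    ends meet in the iterated integral of \<open>A\<close>.\<close>
  have s1: "\<bar>prob {\<omega>\<in>?O. (\<omega>, \<omega>) \<in> E} - measure (M \<Otimes>\<^sub>M M) E\<bar> \<le> c"
    using dec(1) E unfolding decoupled_def by auto
  have "\<bar>measure (M \<Otimes>\<^sub>M M) E - (\<integral>f. (\<integral>l. A (l, f) \<partial>M) \<partial>M)\<bar> \<le> c"
    unfolding measure_pair_sections(2)[OF Em]
  proof (intro abs_integral_diff_le[where B=1] measure_pair_sections(4) Em Aim Aib)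
    fix f assume f: "f \<in> ?O"
    show "\<bar>prob {x \<in> ?O. (x, f) \<in> E} - (\<integral>l. A (l, f) \<partial>M)\<bar> \<le> c"
      using dec(2) D1[OF f] f unfolding decoupled_def a1[OF f, symmetric]
      by (auto simp: E_def dest!: bspec[OF _ D1[OF f]] cong: conj_cong)
  qed simp
  moreover have "\<bar>measure (M \<Otimes>\<^sub>M M) C - (\<integral>l. (\<integral>f. A (l, f) \<partial>M) \<partial>M)\<bar> \<le> c"
    unfolding measure_pair_sections(1)[OF Cm]
  proof (intro abs_integral_diff_le[where B=1] measure_pair_sections(3) Cm Aim Aib)
    fix l assume l: "l \<in> ?O"
    show "\<bar>prob {y \<in> ?O. (l, y) \<in> C} - (\<integral>f. A (l, f) \<partial>M)\<bar> \<le> c"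
      using dec(3) D2[OF l] l unfolding decoupled_def a2[OF l, symmetric]
      by (auto simp: D(2) dest!: bspec[OF _ D2[OF l]] cong: conj_cong)
  qed simp
  moreover have "{\<omega>\<in>?O. (\<omega>, \<omega>) \<in> E} = {\<omega>\<in>?O. (\<omega>, \<omega>) \<in> C}" by (auto simp: E_def D(2))
  ultimately show "\<bar>prob {\<omega> \<in> ?O. (\<omega>, \<omega>) \<in> C} - measure (M \<Otimes>\<^sub>M M) C\<bar> \<le> 3 * c"
    using s1 fub by simp
qed

text \<open>The sum counts the levels \<open>i * b / n\<close> strictly below \<open>x\<close>; at
  the rescaled point \<open>y\<close> this count is \<open>\<lceil>y\<rceil> - 1\<close>, cut off at
  \<open>0\<close>, and so misses \<open>y\<close> by at most one. The lemma turns bounds for events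
  into bounds for integrals, with an error that vanishes as \<open>n\<close> grows.\<close>

lemma staircase:
  fixes x b :: real
  assumes "0 \<le> x" "x \<le> b" "n > 0"
  shows "\<bar>x - b / n * (\<Sum>i=1..n. of_bool (real i * b / n < x))\<bar> \<le> b / n"
proof (cases "b = 0")
  case False
  then have b: "b > 0" using assms by auto
  define y where "y = x * n / b"
  have y: "0 \<le> y" "y \<le> n" using assms b by (auto simp: y_def field_simps)
  have "(\<Sum>i=1..n. of_bool (real i * b / n < x)) = (\<Sum>i=1..n. of_bool (real i < y) :: real)"
    using b assms by (intro sum.cong) (auto simp: y_def field_simps)
  also have "\<dots> = card {i\<in>{1..n}. real i < y}" by (simp add: of_bool_def sum.If_cases Int_def)
  also have "{i\<in>{1..n}. real i < y} = {1..nat (\<lceil>y\<rceil> - 1)}" using y by (auto; linarith)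
  finally have eq: "(\<Sum>i=1..n. of_bool (real i * b / n < x)) = real (nat (\<lceil>y\<rceil> - 1))" by simp
  have "\<bar>y - real (nat (\<lceil>y\<rceil> - 1))\<bar> \<le> 1" using y by linarith
  then have "b / n * \<bar>y - real (nat (\<lceil>y\<rceil> - 1))\<bar> \<le> b / n * 1" using b assms by (intro mult_left_mono) auto
  also have "b / n * \<bar>y - real (nat (\<lceil>y\<rceil> - 1))\<bar> = \<bar>b / n * y - b / n * real (nat (\<lceil>y\<rceil> - 1))\<bar>"
    using b assms by (simp only: right_diff_distrib[symmetric] abs_mult) simp
  also have "b / n * y = x" using b assms by (simp add: y_def)
  finally show ?thesis unfolding eq by simp
qed (use assms in auto)

lemma decoupled_measurable:
  assumes sub: "subalgebra M U" "subalgebra M V"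
    and Z: "Z \<in> measurable U N1" and W: "W \<in> measurable V N2"
    and h: "(h :: _ \<Rightarrow> real) \<in> borel_measurable (N1 \<Otimes>\<^sub>M N2)"
  shows "(\<lambda>\<omega>. h (Z \<omega>, W \<omega>)) \<in> borel_measurable M"
    and "(\<lambda>(x, y). h (Z x, W y)) \<in> borel_measurable (M \<Otimes>\<^sub>M M)"
    and "(\<lambda>(x, y). h (Z x, W y)) \<in> borel_measurable (U \<Otimes>\<^sub>M V)"
proof -
  have ZM: "Z \<in> measurable M N1" and WM: "W \<in> measurable M N2"
    using sub Z W by (auto intro: measurable_from_subalg)
  show "(\<lambda>\<omega>. h (Z \<omega>, W \<omega>)) \<in> borel_measurable M" using ZM WM h by measurable
  show "(\<lambda>(x, y). h (Z x, W y)) \<in> borel_measurable (M \<Otimes>\<^sub>M M)" using ZM WM h by measurable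
  show "(\<lambda>(x, y). h (Z x, W y)) \<in> borel_measurable (U \<Otimes>\<^sub>M V)" using Z W h by measurable
qed

text \<open>Total variation control passes to bounded integrands by layers: \<open>h + B\<close>
  takes values between \<open>0\<close> and \<open>2 * B\<close>, each of its \<open>n\<close>
  superlevel sets is an event of the product sigma-algebra, and averaging the \<open>n\<close>
  bounds gives \<open>2 * B * c\<close> up to the staircase error, which disappears in the
  limit.\<close>

lemma (in prob_space) decoupled_integral:
  assumes sub: "subalgebra M U" "subalgebra M V" and dec: "decoupled U V c"
    and Z: "Z \<in> measurable U N1" and W: "W \<in> measurable V N2"
    and h: "h \<in> borel_measurable (N1 \<Otimes>\<^sub>M N2)" and B: "\<And>z w. \<bar>h (z, w)\<bar> \<le> (B::real)"
  shows "\<bar>(\<integral>\<omega>. h (Z \<omega>, W \<omega>) \<partial>M) - (\<integral>x. (\<integral>y. h (Z x, W y) \<partial>M) \<partial>M)\<bar> \<le> 2 * B * c"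
proof -
  interpret P: pair_prob_space M M ..
  note meas = decoupled_measurable[OF sub Z W h]
  have sp: "space U = space M" "space V = space M" using sub by (auto simp: subalgebra_def)
  have B0: "0 \<le> B" using B[of undefined undefined] by linarith
  define H where "H = (\<lambda>p. h (Z (fst p), W (snd p)) + B)"
  have HU: "H \<in> borel_measurable (U \<Otimes>\<^sub>M V)" and HM: "H \<in> borel_measurable (M \<Otimes>\<^sub>M M)"
    and Hd: "(\<lambda>\<omega>. H (\<omega>, \<omega>)) \<in> borel_measurable M"
    using meas unfolding H_def by (auto simp: case_prod_beta)
  have Hb: "0 \<le> H p" "H p \<le> 2 * B" for p
    using B[of "Z (fst p)" "W (snd p)"] by (auto simp: H_def abs_le_iff)
  have H_int: "integrable (M \<Otimes>\<^sub>M M) H" "integrable M (\<lambda>\<omega>. H (\<omega>, \<omega>))"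
    using Hb HM Hd by (auto intro!: P.P.integrable_const_bound[of _ "2 * B"] integrable_const_bound[of _ "2 * B"])
  have e1: "(\<integral>\<omega>. H (\<omega>, \<omega>) \<partial>M) = (\<integral>\<omega>. h (Z \<omega>, W \<omega>) \<partial>M) + B"
  proof -
    have "integrable M (\<lambda>\<omega>. h (Z \<omega>, W \<omega>))" using meas(1) B by (auto intro!: integrable_const_bound[of _ B])
    then show ?thesis by (simp add: H_def prob_space)
  qed
  have e2: "(\<integral>p. H p \<partial>(M \<Otimes>\<^sub>M M)) = (\<integral>x. (\<integral>y. h (Z x, W y) \<partial>M) \<partial>M) + B"
  proof -
    have i: "integrable (M \<Otimes>\<^sub>M M) (\<lambda>(x, y). h (Z x, W y))"
      using meas(2) B by (auto intro!: P.P.integrable_const_bound[of _ B])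
    have "(\<integral>p. H p \<partial>(M \<Otimes>\<^sub>M M)) = (\<integral>p. h (Z (fst p), W (snd p)) \<partial>(M \<Otimes>\<^sub>M M)) + B"
      using i[unfolded case_prod_beta] P.P.prob_space unfolding H_def
      by (subst Bochner_Integration.integral_add) auto
    then show ?thesis using P.integral_fst[OF i] by (simp add: case_prod_beta')
  qed
  have key: "\<bar>(\<integral>\<omega>. H (\<omega>, \<omega>) \<partial>M) - (\<integral>p. H p \<partial>(M \<Otimes>\<^sub>M M))\<bar> \<le> 2 * B * c + 4 * B / n" if n: "n > 0" for n :: nat
  proof -
    let ?b = "2 * B"
    define C where "C i = {p \<in> space (U \<Otimes>\<^sub>M V). real i * ?b / n < H p}" for i
    have C: "C i \<in> sets (U \<Otimes>\<^sub>M V)" for i unfolding C_def using HU by measurable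
    have CM: "C i \<in> sets (M \<Otimes>\<^sub>M M)" for i using C sets_pair_measure_subalgebra[OF sub] by blast
    have Cd: "{\<omega>\<in>space M. (\<omega>, \<omega>) \<in> C i} \<in> sets M" for i
      unfolding C_def space_pair_measure sp using Hd by measurable
    have b1: "\<bar>(\<integral>\<omega>. H (\<omega>, \<omega>) \<partial>M) - ?b / n * (\<Sum>i=1..n. prob {\<omega>\<in>space M. (\<omega>, \<omega>) \<in> C i})\<bar> \<le> ?b / n"
    proof -
      have "\<bar>(\<integral>\<omega>. H (\<omega>, \<omega>) \<partial>M) - (\<integral>\<omega>. ?b / n * (\<Sum>i=1..n. indicator {\<omega>\<in>space M. (\<omega>, \<omega>) \<in> C i} \<omega>) \<partial>M)\<bar> \<le> ?b / n"
      proof (rule abs_integral_diff_le[where B="?b + ?b"])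
        fix x assume x: "x \<in> space M"
        have *: "(\<Sum>i=1..n. indicator {\<omega>\<in>space M. (\<omega>, \<omega>) \<in> C i} x) = (\<Sum>i=1..n. of_bool (real i * ?b / n < H (x, x)) :: real)"
          using x by (intro sum.cong) (auto simp: C_def space_pair_measure sp)
        show 1: "\<bar>H (x, x) - ?b / n * (\<Sum>i=1..n. indicator {\<omega>\<in>space M. (\<omega>, \<omega>) \<in> C i} x)\<bar> \<le> ?b / n"
          unfolding * by (rule staircase[OF Hb n])
        have "?b / n \<le> ?b" using n B0 by (simp add: divide_le_eq mult_le_cancel_left1)
        then show "\<bar>?b / n * (\<Sum>i=1..n. indicator {\<omega>\<in>space M. (\<omega>, \<omega>) \<in> C i} x)\<bar> \<le> ?b + ?b"
          using 1 Hb[of "(x,x)"] by linarith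
        show "\<bar>H (x, x)\<bar> \<le> ?b + ?b" using Hb[of "(x,x)"] by linarith
      qed (use Hd Cd in measurable)
      also have "(\<integral>\<omega>. ?b / n * (\<Sum>i=1..n. indicator {\<omega>\<in>space M. (\<omega>, \<omega>) \<in> C i} \<omega>) \<partial>M)
        = ?b / n * (\<Sum>i=1..n. prob {\<omega>\<in>space M. (\<omega>, \<omega>) \<in> C i})"
      proof -
        have "(\<integral>\<omega>. (\<Sum>i=1..n. indicator {\<omega>\<in>space M. (\<omega>, \<omega>) \<in> C i} \<omega> :: real) \<partial>M) = 
          (\<Sum>i=1..n. (\<integral>\<omega>. indicator {\<omega>\<in>space M. (\<omega>, \<omega>) \<in> C i} \<omega> \<partial>M))"
          by (intro Bochner_Integration.integral_sum integrable_real_indicator Cd) (simp add: emeasure_eq_measure)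
        also have "\<dots> = (\<Sum>i=1..n. prob {\<omega>\<in>space M. (\<omega>, \<omega>) \<in> C i})"
          by (intro sum.cong refl) (simp add: Int_absorb2 Collect_restrict)
        finally show ?thesis by simp
      qed
      finally show ?thesis .
    qed
    have b2: "\<bar>(\<integral>p. H p \<partial>(M \<Otimes>\<^sub>M M)) - ?b / n * (\<Sum>i=1..n. measure (M \<Otimes>\<^sub>M M) (C i))\<bar> \<le> ?b / n"
    proof -
      have "\<bar>(\<integral>p. H p \<partial>(M \<Otimes>\<^sub>M M)) - (\<integral>p. ?b / n * (\<Sum>i=1..n. indicator (C i) p) \<partial>(M \<Otimes>\<^sub>M M))\<bar> \<le> ?b / n"
      proof (rule P.P.abs_integral_diff_le[where B="?b + ?b"])
        fix x assume x: "x \<in> space (M \<Otimes>\<^sub>M M)"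
        have *: "(\<Sum>i=1..n. indicator (C i) x) = (\<Sum>i=1..n. of_bool (real i * ?b / n < H x) :: real)"
          using x by (intro sum.cong) (auto simp: C_def space_pair_measure sp)
        show 1: "\<bar>H x - ?b / n * (\<Sum>i=1..n. indicator (C i) x)\<bar> \<le> ?b / n"
          unfolding * by (rule staircase[OF Hb n])
        have "?b / n \<le> ?b" using n B0 by (simp add: divide_le_eq mult_le_cancel_left1)
        then show "\<bar>?b / n * (\<Sum>i=1..n. indicator (C i) x)\<bar> \<le> ?b + ?b"
          using 1 Hb[of x] by linarith
        show "\<bar>H x\<bar> \<le> ?b + ?b" using Hb[of x] by linarith
      qed (use HM CM in measurable)
      also have "(\<integral>p. ?b / n * (\<Sum>i=1..n. indicator (C i) p) \<partial>(M \<Otimes>\<^sub>M M))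
        = ?b / n * (\<Sum>i=1..n. measure (M \<Otimes>\<^sub>M M) (C i))"
      proof -
        have "(\<integral>p. (\<Sum>i=1..n. indicator (C i) p :: real) \<partial>(M \<Otimes>\<^sub>M M)) = (\<Sum>i=1..n. (\<integral>p. indicator (C i) p \<partial>(M \<Otimes>\<^sub>M M)))"
          using CM by (intro Bochner_Integration.integral_sum) (simp add: P.emeasure_eq_measure)
        also have "\<dots> = (\<Sum>i=1..n. measure (M \<Otimes>\<^sub>M M) (C i))"
          using sets.sets_into_space[OF CM] by (intro sum.cong refl) (simp add: Int_absorb2)
        finally show ?thesis by simp
      qed
      finally show ?thesis .
    qed
    have "\<bar>(\<Sum>i=1..n. prob {\<omega>\<in>space M. (\<omega>, \<omega>) \<in> C i}) - (\<Sum>i=1..n. measure (M \<Otimes>\<^sub>M M) (C i))\<bar>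
       \<le> (\<Sum>i=1..n. \<bar>prob {\<omega>\<in>space M. (\<omega>, \<omega>) \<in> C i} - measure (M \<Otimes>\<^sub>M M) (C i)\<bar>)"
      by (simp only: sum_subtractf[symmetric]) (rule sum_abs)
    also have "\<dots> \<le> (\<Sum>i=1..n. c)" using dec C by (intro sum_mono) (auto simp: decoupled_def)
    finally have "?b / n * \<bar>(\<Sum>i=1..n. prob {\<omega>\<in>space M. (\<omega>, \<omega>) \<in> C i}) - (\<Sum>i=1..n. measure (M \<Otimes>\<^sub>M M) (C i))\<bar>
       \<le> ?b / n * (n * c)" using B0 by (intro mult_left_mono) auto
    also have "\<dots> = ?b * c" using n by simp
    finally have "\<bar>?b / n * (\<Sum>i=1..n. prob {\<omega>\<in>space M. (\<omega>, \<omega>) \<in> C i}) - ?b / n * (\<Sum>i=1..n. measure (M \<Otimes>\<^sub>M M) (C i))\<bar> \<le> ?b * c"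
      using B0 by (simp only: right_diff_distrib[symmetric] abs_mult) simp
    with b1 b2 show ?thesis by (simp add: abs_le_iff)
  qed
  have "(\<lambda>n. 2 * B * c + 4 * B / real n) \<longlonglongrightarrow> 2 * B * c + 0"
    by (intro tendsto_intros lim_const_over_n)
  then have "\<bar>(\<integral>\<omega>. H (\<omega>, \<omega>) \<partial>M) - (\<integral>p. H p \<partial>(M \<Otimes>\<^sub>M M))\<bar> \<le> 2 * B * c + 0"
    using key by (intro LIMSEQ_le_const) (auto intro!: exI[of _ 1])
  then show ?thesis using e1 e2 by simp
qed

text \<open>The truncation level \<open>t\<close> trades the mixing error against the tail of the local majorant \<open>G\<close>.\<close>

lemma (in prob_space) decoupled_integral_truncated:
  assumes sub: "subalgebra M U" "subalgebra M V" and dec: "decoupled U V c"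
    and Z: "Z \<in> measurable U N1" and W: "W \<in> measurable V N2"
    and h: "h \<in> borel_measurable (N1 \<Otimes>\<^sub>M N2)"
    and G: "G \<in> borel_measurable N1" "integrable M (\<lambda>\<omega>. G (Z \<omega>))"
    and hG: "\<And>z w. \<bar>h (z, w)\<bar> \<le> (G z :: real)" and t: "t \<ge> 0"
  shows "\<bar>(\<integral>\<omega>. h (Z \<omega>, W \<omega>) \<partial>M) - (\<integral>x. (\<integral>y. h (Z x, W y) \<partial>M) \<partial>M)\<bar>
     \<le> 2 * t * c + 2 * (\<integral>\<omega>. G (Z \<omega>) * of_bool (t < G (Z \<omega>)) \<partial>M)"
proof -
  interpret P: pair_prob_space M M ..
  have G0: "0 \<le> G z" for z using hG[of z undefined] by linarith
  note meas = decoupled_measurable[OF sub Z W h]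
  \<comment> \<open>The truncation is decided by \<open>Z\<close> alone, so it acts in the same way
    on the diagonal integral and on the iterated one. Each of them loses at most the same tail of
    \<open>G\<close>, hence the factor \<open>2\<close> in front of it.\<close>
  define h1 where "h1 = (\<lambda>p. h p * of_bool (G (fst p) \<le> t))"
  have h1: "h1 \<in> borel_measurable (N1 \<Otimes>\<^sub>M N2)" unfolding h1_def using h G(1) by measurable
  note meas1 = decoupled_measurable[OF sub Z W h1]
  have b1: "\<bar>h1 (z, w)\<bar> \<le> t" for z w using hG[of z w] t by (auto simp: h1_def)
  have ZM: "Z \<in> measurable M N1" using measurable_from_subalg[OF sub(1) Z] .
  have Gm: "(\<lambda>\<omega>. G (Z \<omega>)) \<in> borel_measurable M" using ZM G by measurable
  let ?T = "\<lambda>\<omega>. G (Z \<omega>) * of_bool (t < G (Z \<omega>))"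
  have Ti: "integrable M ?T"
    using G(2) Gm G0 by (intro Bochner_Integration.integrable_bound[OF G(2)]) auto
  have hi: "integrable M (\<lambda>\<omega>. h (Z \<omega>, W \<omega>))"
    using G0 hG meas(1) by (intro Bochner_Integration.integrable_bound[OF G(2)]) (auto intro!: AE_I2)
  have h1i: "integrable M (\<lambda>\<omega>. h1 (Z \<omega>, W \<omega>))" 
    using meas1(1) b1 by (auto intro!: integrable_const_bound[of _ t])
  have diff: "\<bar>h (z, w) - h1 (z, w)\<bar> \<le> G z * of_bool (t < G z)" for z w
    using hG[of z w] by (auto simp: h1_def)
  have 1: "\<bar>(\<integral>\<omega>. h (Z \<omega>, W \<omega>) \<partial>M) - (\<integral>\<omega>. h1 (Z \<omega>, W \<omega>) \<partial>M)\<bar> \<le> (\<integral>\<omega>. ?T \<omega> \<partial>M)"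
  proof -
    have "\<bar>(\<integral>\<omega>. h (Z \<omega>, W \<omega>) - h1 (Z \<omega>, W \<omega>) \<partial>M)\<bar> \<le> (\<integral>\<omega>. \<bar>h (Z \<omega>, W \<omega>) - h1 (Z \<omega>, W \<omega>)\<bar> \<partial>M)" by simp
    also have "\<dots> \<le> (\<integral>\<omega>. ?T \<omega> \<partial>M)" using hi h1i Ti diff by (intro integral_mono) auto
    finally show ?thesis using hi h1i by simp
  qed
  have ii: "integrable M (\<lambda>y. h (Z x, W y))" "integrable M (\<lambda>y. h1 (Z x, W y))" if "x \<in> space M" for x
  proof -
    have "(\<lambda>y. h (Z x, W y)) \<in> borel_measurable M" "(\<lambda>y. h1 (Z x, W y)) \<in> borel_measurable M"
      using measurable_compose[OF measurable_Pair1'[OF that] meas(2)] 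
        measurable_compose[OF measurable_Pair1'[OF that] meas1(2)] by simp_all
    then show "integrable M (\<lambda>y. h (Z x, W y))" "integrable M (\<lambda>y. h1 (Z x, W y))"
      by (intro integrable_const_bound[of _ "G (Z x)"] integrable_const_bound[of _ t];
          simp add: hG b1)+
  qed
  have im: "(\<lambda>x. \<integral>y. h (Z x, W y) \<partial>M) \<in> borel_measurable M" "(\<lambda>x. \<integral>y. h1 (Z x, W y) \<partial>M) \<in> borel_measurable M"
    using meas(2) meas1(2) by measurable
  have bnd: "\<bar>\<integral>y. h (Z x, W y) \<partial>M\<bar> \<le> G (Z x)" if "x \<in> space M" for x
  proof -
    have "\<bar>\<integral>y. h (Z x, W y) \<partial>M\<bar> \<le> (\<integral>y. \<bar>h (Z x, W y)\<bar> \<partial>M)" by simp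
    also have "\<dots> \<le> (\<integral>y. G (Z x) \<partial>M)" using hG ii[OF that] by (intro integral_mono) auto
    finally show ?thesis by (simp add: prob_space)
  qed
  have d2: "\<bar>(\<integral>y. h (Z x, W y) \<partial>M) - (\<integral>y. h1 (Z x, W y) \<partial>M)\<bar> \<le> ?T x" if "x \<in> space M" for x
  proof -
    have "\<bar>(\<integral>y. h (Z x, W y) - h1 (Z x, W y) \<partial>M)\<bar> \<le> (\<integral>y. \<bar>h (Z x, W y) - h1 (Z x, W y)\<bar> \<partial>M)" by simp
    also have "\<dots> \<le> (\<integral>y. ?T x \<partial>M)" using diff ii[OF that] by (intro integral_mono) auto
    finally show ?thesis using ii[OF that] by (simp add: prob_space)
  qed
  have I: "integrable M (\<lambda>x. \<integral>y. h (Z x, W y) \<partial>M)"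
    using im bnd G0 by (intro Bochner_Integration.integrable_bound[OF G(2)]) auto
  have I1: "integrable M (\<lambda>x. \<integral>y. h1 (Z x, W y) \<partial>M)"
  proof (rule Bochner_Integration.integrable_bound[OF Bochner_Integration.integrable_add[OF integrable_abs[OF I] Ti]])
    show "AE x in M. norm (\<integral>y. h1 (Z x, W y) \<partial>M) \<le> norm (\<bar>\<integral>y. h (Z x, W y) \<partial>M\<bar> + ?T x)"
      using d2 G0 by (intro AE_I2) (smt (verit, best) real_norm_def)
  qed (use im in auto)
  have 2: "\<bar>(\<integral>x. (\<integral>y. h (Z x, W y) \<partial>M) \<partial>M) - (\<integral>x. (\<integral>y. h1 (Z x, W y) \<partial>M) \<partial>M)\<bar> \<le> (\<integral>\<omega>. ?T \<omega> \<partial>M)"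
  proof -
    have "\<bar>(\<integral>x. (\<integral>y. h (Z x, W y) \<partial>M) - (\<integral>y. h1 (Z x, W y) \<partial>M) \<partial>M)\<bar>
      \<le> (\<integral>x. \<bar>(\<integral>y. h (Z x, W y) \<partial>M) - (\<integral>y. h1 (Z x, W y) \<partial>M)\<bar> \<partial>M)" by simp
    also have "\<dots> \<le> (\<integral>\<omega>. ?T \<omega> \<partial>M)" using I I1 Ti d2 by (intro integral_mono) auto
    finally show ?thesis using I I1 by simp
  qed
  have "\<bar>(\<integral>\<omega>. h1 (Z \<omega>, W \<omega>) \<partial>M) - (\<integral>x. (\<integral>y. h1 (Z x, W y) \<partial>M) \<partial>M)\<bar> \<le> 2 * t * c"
    by (rule decoupled_integral[OF sub dec Z W h1 b1])
  with 1 2 show ?thesis by linarith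
qed

section \<open>Test functions\<close>

abbreviation (input) "\<Phi> \<equiv> std_normal_cdf"
abbreviation (input) "\<phi> \<equiv> std_normal_density"

lemma std_normal_cdf_bounds: "0 \<le> \<Phi> x" "\<Phi> x \<le> 1"
proof -
  interpret real_distribution std_normal_distribution by (rule real_dist_normal_dist)
  show "0 \<le> \<Phi> x" "\<Phi> x \<le> 1"
    unfolding std_normal_cdf_def using cdf_nonneg cdf_bounded_prob by auto
qed

lemma std_normal_cdf_lim: "(\<Phi> \<longlongrightarrow> 1) at_top" "(\<Phi> \<longlongrightarrow> 0) at_bot"
proof -
  interpret real_distribution std_normal_distribution by (rule real_dist_normal_dist)
  show "(\<Phi> \<longlongrightarrow> 1) at_top" "(\<Phi> \<longlongrightarrow> 0) at_bot"
    unfolding std_normal_cdf_def using cdf_lim_at_top_prob cdf_lim_at_bot by auto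
qed

lemma std_normal_cdf_diff:
  assumes "a \<le> x"
  shows "\<Phi> x = \<Phi> a + integral {a..x} \<phi>"
proof -
  interpret real_distribution std_normal_distribution by (rule real_dist_normal_dist)
  have cont: "continuous_on {a..x} \<phi>"
    unfolding normal_density_def by (intro continuous_intros) auto
  have "\<Phi> x - \<Phi> a = measure std_normal_distribution {a<..x}"
    unfolding std_normal_cdf_def using assms
    by (cases "a = x") (auto simp: cdf_diff_eq)
  also have "\<dots> = measure std_normal_distribution {a..x}"
  proof -
    have "emeasure std_normal_distribution {a<..x} = emeasure std_normal_distribution {a..x}"
    proof (subst (1 2) emeasure_density; simp?)
      show "(\<integral>\<^sup>+t. ennreal (\<phi> t) * indicator {a<..x} t \<partial>lborel) = (\<integral>\<^sup>+t. ennreal (\<phi> t) * indicator {a..x} t \<partial>lborel)"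
        using AE_lborel_singleton[of a]
        by (intro nn_integral_cong_AE) (auto elim!: eventually_mono simp: indicator_def)
    qed
    then show ?thesis by (simp add: measure_def)
  qed
  also have "\<dots> = (\<integral>t. \<phi> t * indicator {a..x} t \<partial>lborel)"
    by (subst integral_eq_nn_integral) (auto simp: measure_def emeasure_density ennreal_mult' ennreal_indicator
        intro!: arg_cong[where f=enn2real] nn_integral_cong)
  also have "\<dots> = integral {a..x} \<phi>"
  proof -
    have "set_integrable lborel {a..x} \<phi>"
      by (rule borel_integrable_atLeastAtMost'[OF cont])
    from set_borel_integral_eq_integral(2)[OF this] show ?thesis
      by (simp add: set_lebesgue_integral_def mult.commute)
  qed
  finally show ?thesis by simp
qed

lemma std_normal_cdf_deriv: "(\<Phi> has_real_derivative \<phi> x) (at x)"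
proof -
  have cont: "continuous_on {x - 1..x + 1} \<phi>"
    unfolding normal_density_def by (intro continuous_intros) auto
  have "((\<lambda>y. integral {x - 1..y} \<phi>) has_real_derivative \<phi> x) (at x within {x - 1..x + 1})"
    by (rule integral_has_real_derivative[OF cont]) auto
  then have "((\<lambda>y. \<Phi> (x - 1) + integral {x - 1..y} \<phi>) has_real_derivative \<phi> x) (at x within {x - 1..x + 1})"
    by (auto intro!: derivative_eq_intros)
  then have "(\<Phi> has_real_derivative \<phi> x) (at x within {x - 1..x + 1})"
  proof (rule has_field_derivative_transform_within[of _ _ _ _ 1])
    show "\<Phi> (x - 1) + integral {x - 1..y} \<phi> = \<Phi> y" if "y \<in> {x - 1..x + 1}" for y
      using std_normal_cdf_diff[of "x - 1" y] that by simp
  qed auto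
  then show ?thesis by (simp add: at_within_Icc_at)
qed

lemmas std_normal_cdf_deriv' [derivative_intros] = std_normal_cdf_deriv[THEN DERIV_chain2]

lemma std_normal_density_deriv: "(\<phi> has_real_derivative - x * \<phi> x) (at x)"
  unfolding std_normal_density_def by (auto intro!: derivative_eq_intros simp: field_simps)

lemma std_normal_density_pos: "\<phi> x > 0" by (simp add: normal_density_pos)

lemma std_normal_density_lim: "(\<phi> \<longlongrightarrow> 0) at_top"
  unfolding std_normal_density_def by real_asymp

lemma std_normal_density_uminus: "\<phi> (- x) = \<phi> x" by (simp add: std_normal_density_def)

text \<open>\<open>\<Phi> x + \<Phi> (- x)\<close> has derivative \<open>0\<close>, and its limit at
  infinity is \<open>1\<close>.\<close>

lemma std_normal_cdf_uminus: "\<Phi> (- x) = 1 - \<Phi> x"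
proof -
  define h where "h = (\<lambda>x. \<Phi> x + \<Phi> (- x))"
  have "(h has_real_derivative 0) (at x)" for x
    unfolding h_def by (auto intro!: derivative_eq_intros simp: std_normal_density_uminus)
  then have "h x = h y" for x y using DERIV_isconst_all by blast
  then have h: "h = (\<lambda>_. h 0)" by auto
  have "(h \<longlongrightarrow> 1 + 0) at_top"
    unfolding h_def using std_normal_cdf_lim
    by (intro tendsto_add) (auto intro: filterlim_compose[OF _ filterlim_uminus_at_bot_at_top])
  then have "h 0 = 1" using h tendsto_const tendsto_unique
    by (metis add.right_neutral trivial_limit_at_top_linorder)
  then show ?thesis using h by (metis add_diff_cancel_left' h_def)
qed

section \<open>Tail of the normal law and the Mills ratio\<close>

lemma nonneg_of_deriv_nonpos_limit:
  fixes u :: "real \<Rightarrow> real"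
  assumes "\<And>t. t \<ge> x \<Longrightarrow> (u has_real_derivative u' t) (at t)" "\<And>t. t \<ge> x \<Longrightarrow> u' t \<le> 0"
    and "(u \<longlongrightarrow> 0) at_top"
  shows "u x \<ge> 0"
proof -
  have "u t \<le> u x" if "t \<ge> x" for t
    using that assms(1,2) by (intro DERIV_nonpos_imp_nonincreasing[OF that]) auto
  then have "\<forall>\<^sub>F t in at_top. u t \<le> u x" unfolding eventually_at_top_linorder by blast
  then show ?thesis by (intro tendsto_upperbound[OF assms(3)]) auto
qed

lemma mills_upper:
  assumes "x > 0" shows "x * (1 - \<Phi> x) \<le> \<phi> x"
proof -
  have "\<phi> x / x - (1 - \<Phi> x) \<ge> 0"
  proof (rule nonneg_of_deriv_nonpos_limit[where u="\<lambda>x. \<phi> x / x - (1 - \<Phi> x)" and u'="\<lambda>t. - \<phi> t / t^2"])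
    show "((\<lambda>x. \<phi> x / x - (1 - \<Phi> x)) has_real_derivative - \<phi> t / t\<^sup>2) (at t)" if "t \<ge> x" for t
      using that assms by (auto intro!: derivative_eq_intros std_normal_density_deriv simp: field_simps power2_eq_square)
    show "((\<lambda>x. \<phi> x / x - (1 - \<Phi> x)) \<longlongrightarrow> 0) at_top"
    proof -
      have "((\<lambda>x::real. inverse x) \<longlongrightarrow> 0) at_top" by real_asymp
      then have "((\<lambda>x. \<phi> x * inverse x - (1 - \<Phi> x)) \<longlongrightarrow> 0 * 0 - (1 - 1)) at_top"
        by (intro tendsto_intros std_normal_density_lim std_normal_cdf_lim)
      then show ?thesis by (simp add: divide_inverse)
    qed
  qed (auto simp: std_normal_density_pos less_imp_le)
  then show ?thesis using assms by (simp add: field_simps)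
qed

text \<open>For positive \<open>x\<close> the difference
  \<open>(1 - \<Phi> x) - x / (1 + x\<^sup>2) * \<phi> x\<close> has derivative
  \<open>- 2 * \<phi> x / (1 + x\<^sup>2)\<^sup>2\<close> and tends to \<open>0\<close>; otherwise
  the signs decide. This lower bound is what makes \<open>x * mills x\<close> increasing.\<close>

lemma mills_lower: "x * \<phi> x \<le> (1 + x\<^sup>2) * (1 - \<Phi> x)"
proof (cases "x > 0")
  case False
  then show ?thesis using std_normal_density_pos[of x] std_normal_cdf_bounds[of x]
    by (smt (verit, best) mult_nonneg_nonneg mult_nonpos_nonneg zero_le_power2)
next
  case True
  have pos: "1 + t\<^sup>2 > (0::real)" for t by (smt (verit) zero_le_power2)
  have "(1 - \<Phi> x) - x / (1 + x\<^sup>2) * \<phi> x \<ge> 0"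
  proof (rule nonneg_of_deriv_nonpos_limit[where u="\<lambda>x. (1 - \<Phi> x) - x / (1 + x\<^sup>2) * \<phi> x" and u'="\<lambda>t. - 2 * \<phi> t / (1 + t^2)^2"])
    fix t
    have "((\<lambda>x. (1 - \<Phi> x) - x / (1 + x\<^sup>2) * \<phi> x) has_real_derivative 
       - \<phi> t - (((1 + t\<^sup>2) - t * (2 * t)) / (1 + t\<^sup>2)^2 * \<phi> t + t / (1 + t\<^sup>2) * (- t * \<phi> t))) (at t)"
    proof -
      have nz: "1 + t\<^sup>2 \<noteq> 0" using pos[of t] by simp
      have "((\<lambda>x. x / (1 + x\<^sup>2)) has_real_derivative ((1 + t\<^sup>2) - t * (2 * t)) / (1 + t\<^sup>2)^2) (at t)"
        using nz by (auto intro!: derivative_eq_intros simp: power2_eq_square)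
      from DERIV_diff[OF DERIV_diff[OF DERIV_const std_normal_cdf_deriv] DERIV_mult[OF this std_normal_density_deriv], of 1]
      show ?thesis by (simp add: algebra_simps)
    qed
    also have "- \<phi> t - (((1 + t\<^sup>2) - t * (2 * t)) / (1 + t\<^sup>2)^2 * \<phi> t + t / (1 + t\<^sup>2) * (- t * \<phi> t))
      = - 2 * \<phi> t / (1 + t^2)^2"
      using pos[of t] by (simp add: divide_simps) (simp add: algebra_simps power2_eq_square)
    finally show "((\<lambda>x. (1 - \<Phi> x) - x / (1 + x\<^sup>2) * \<phi> x) has_real_derivative - 2 * \<phi> t / (1 + t^2)^2) (at t)" .
    show "- 2 * \<phi> t / (1 + t\<^sup>2)\<^sup>2 \<le> 0" using std_normal_density_pos[of t] by (simp add: divide_nonpos_nonneg)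
  next
    have "((\<lambda>x::real. x / (1 + x^2)) \<longlongrightarrow> 0) at_top" by real_asymp
    then have "((\<lambda>x. (1 - \<Phi> x) - x / (1 + x\<^sup>2) * \<phi> x) \<longlongrightarrow> (1 - 1) - 0 * 0) at_top"
      by (intro tendsto_intros std_normal_density_lim std_normal_cdf_lim)
    then show "((\<lambda>x. (1 - \<Phi> x) - x / (1 + x\<^sup>2) * \<phi> x) \<longlongrightarrow> 0) at_top" by simp
  qed
  then show ?thesis using pos[of x] by (simp add: field_simps)
qed

text \<open>The Mills ratio. It solves \<open>m' = x * m - 1\<close> and so yields both branches of
  the Stein solution, \<open>mills (- x)\<close> being \<open>\<Phi> x / \<phi> x\<close>.\<close>

definition mills :: "real \<Rightarrow> real" where "mills x = (1 - \<Phi> x) / \<phi> x"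

lemma mills_nonneg: "mills x \<ge> 0"
  using std_normal_cdf_bounds[of x] std_normal_density_pos[of x] by (simp add: mills_def)

lemma mills_deriv: "(mills has_real_derivative (x * mills x - 1)) (at x)"
  unfolding mills_def using std_normal_density_pos[of x]
  by (auto intro!: derivative_eq_intros std_normal_density_deriv simp: field_simps power2_eq_square)

text \<open>The derivative is \<open>(1 + x\<^sup>2) * mills x - x\<close>, which is nonnegative by
  \<open>mills_lower\<close>.\<close>

lemma mills_mult_mono: "mono (\<lambda>x. x * mills x)"
proof (rule monoI)
  fix x y :: real assume "x \<le> y"
  then show "x * mills x \<le> y * mills y"
  proof (rule DERIV_nonneg_imp_nondecreasing)
    fix t
    have "((\<lambda>x. x * mills x) has_real_derivative (1 + t\<^sup>2) * mills t - t) (at t)"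
      by (auto intro!: derivative_eq_intros mills_deriv simp: algebra_simps power2_eq_square)
    moreover have "(1 + t\<^sup>2) * mills t - t \<ge> 0"
      using mills_lower[of t] std_normal_density_pos[of t] by (simp add: mills_def field_simps)
    ultimately show "\<exists>D. ((\<lambda>x. x * mills x) has_real_derivative D) (at t) \<and> 0 \<le> D" by blast
  qed
qed

lemma mills_mult_le: "x * mills x \<le> 1"
proof (cases "x > 0")
  case True
  then show ?thesis using mills_upper[OF True] std_normal_density_pos[of x]
    by (simp add: mills_def field_simps)
next
  case False
  then show ?thesis using mills_nonneg[of x] by (smt (verit) mult_nonpos_nonneg)
qed

section \<open>The bounded solution of Stein's equation for a half-line\<close>

definition stein_sol :: "real \<Rightarrow> real \<Rightarrow> real" where
  "stein_sol z x = (if x < z then (1 - \<Phi> z) * mills (- x) else \<Phi> z * mills x)"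

text \<open>Defined by Stein's equation rather than as a derivative, so that
  \<open>f' x - x * f x = of_bool (x < z) - \<Phi> z\<close> holds at every \<open>x\<close>, also
  at the kink \<open>z\<close>, and no null set has to be excluded for \<open>T\<close>. The strict
  inequality matches the event in the theorem.\<close>

definition stein_deriv :: "real \<Rightarrow> real \<Rightarrow> real" where
  "stein_deriv z x = x * stein_sol z x + of_bool (x < z) - \<Phi> z"

lemma stein_sol_at: "(1 - \<Phi> z) * mills (- z) = \<Phi> z * mills z"
  by (simp add: mills_def std_normal_cdf_uminus std_normal_density_uminus)

lemma stein_sol_cont: "continuous_on UNIV (stein_sol z)"
proof -
  have c: "isCont mills x" for x using mills_deriv DERIV_isCont by blast
  then have cm: "continuous_on S mills" for S by (simp add: continuous_at_imp_continuous_on)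
  have "continuous_on ({..z} \<union> {z..}) (\<lambda>x. if x \<in> {..z} then (1 - \<Phi> z) * mills (- x) else \<Phi> z * mills x)"
  proof (rule continuous_on_cases)
    show "continuous_on {..z} (\<lambda>x. (1 - \<Phi> z) * mills (- x))"
      by (intro continuous_intros continuous_on_compose2[OF cm[of UNIV]]) auto
    show "continuous_on {z..} (\<lambda>x. \<Phi> z * mills x)"
      by (intro continuous_intros cm)
  qed (auto simp: stein_sol_at)
  moreover have "(\<lambda>x. if x \<in> {..z} then (1 - \<Phi> z) * mills (- x) else \<Phi> z * mills x) = stein_sol z"
    by (auto simp: stein_sol_def stein_sol_at)
  moreover have "{..z} \<union> {z..} = UNIV" by auto
  ultimately show ?thesis by (simp only:)
qed

lemma stein_sol_deriv:
  assumes "x \<noteq> z" shows "(stein_sol z has_real_derivative stein_deriv z x) (at x)"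
proof (cases "x < z")
  case True
  have d: "((\<lambda>x. mills (- x)) has_real_derivative - (- x * mills (- x) - 1)) (at x)"
    using DERIV_chain2[OF mills_deriv, of "uminus" "-1" x UNIV] by (simp add: DERIV_minus[OF DERIV_ident])
  have "((\<lambda>x. (1 - \<Phi> z) * mills (- x)) has_real_derivative stein_deriv z x) (at x)"
    using True by (auto intro!: derivative_eq_intros d simp: stein_deriv_def stein_sol_def algebra_simps)
  then show ?thesis
    by (rule has_field_derivative_transform_within_open[of _ _ _ "{..<z}"]) (use True in \<open>auto simp: stein_sol_def\<close>)
next
  case False
  then have "x > z" using assms by auto
  have "((\<lambda>x. \<Phi> z * mills x) has_real_derivative stein_deriv z x) (at x)"
    using \<open>x > z\<close> by (auto intro!: derivative_eq_intros mills_deriv simp: stein_deriv_def stein_sol_def algebra_simps)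
  then show ?thesis
    by (rule has_field_derivative_transform_within_open[of _ _ _ "{z<..}"]) (use \<open>x > z\<close> in \<open>auto simp: stein_sol_def\<close>)
qed

text \<open>On either side of \<open>z\<close> the function is a nonnegative multiple of
  \<open>x * mills x\<close> or of its point reflection, both increasing; the branches agree at
  \<open>z\<close> by \<open>stein_sol_at\<close>. Monotonicity reduces the variation of this part
  of \<open>f'\<close> over an interval to its end values.\<close>

lemma stein_mult_mono: "mono (\<lambda>x. x * stein_sol z x)"
proof -
  let ?g = "\<lambda>x. x * stein_sol z x"
  have l: "?g x \<le> ?g y" if "x \<le> y" "y \<le> z" for x y
  proof -
    have g: "?g t = - ((1 - \<Phi> z) * (- t * mills (- t)))" if "t \<le> z" for t
      using that stein_sol_at[of z] by (cases "t = z") (auto simp: stein_sol_def)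
    have "- y * mills (- y) \<le> - x * mills (- x)" using monoD[OF mills_mult_mono, of "- y" "- x"] that by auto
    then have "(1 - \<Phi> z) * (- y * mills (- y)) \<le> (1 - \<Phi> z) * (- x * mills (- x))"
      using std_normal_cdf_bounds[of z] by (intro mult_left_mono) auto
    then show ?thesis using g[of x] g[of y] that by linarith
  qed
  have r: "?g x \<le> ?g y" if "x \<le> y" "z \<le> x" for x y
  proof -
    have g: "?g t = \<Phi> z * (t * mills t)" if "t \<ge> z" for t using that by (auto simp: stein_sol_def)
    have "\<Phi> z * (x * mills x) \<le> \<Phi> z * (y * mills y)"
      using monoD[OF mills_mult_mono that(1)] std_normal_cdf_bounds[of z] by (intro mult_left_mono) auto
    then show ?thesis unfolding g[OF that(2)] using g[of y] that by linarith
  qed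
  show ?thesis
  proof (rule monoI)
    fix x y :: real assume "x \<le> y"
    then show "?g x \<le> ?g y" using l[of x y] r[of x y] l[of x z] r[of z y] by linarith
  qed
qed

text \<open>Each branch gives only one of the two bounds directly, the lower one left of
  \<open>z\<close> and the upper one right of it; monotonicity carries them across.\<close>

lemma stein_mult_bound: "\<bar>x * stein_sol z x\<bar> \<le> 1"
proof -
  have lo: "- 1 \<le> t * stein_sol z t" if "t < z" for t
  proof -
    have "t * stein_sol z t = - ((1 - \<Phi> z) * (- t * mills (- t)))" using that by (simp add: stein_sol_def)
    moreover have "(1 - \<Phi> z) * (- t * mills (- t)) \<le> 1"
      using std_normal_cdf_bounds[of z] mills_mult_le[of "- t"] mult_left_mono[of "- t * mills (- t)" 1 "1 - \<Phi> z"] by simp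
    ultimately show ?thesis by linarith
  qed
  have hi: "t * stein_sol z t \<le> 1" if "t \<ge> z" for t
  proof -
    have "t * stein_sol z t = \<Phi> z * (t * mills t)" using that by (simp add: stein_sol_def)
    moreover have "\<Phi> z * (t * mills t) \<le> 1"
      using std_normal_cdf_bounds[of z] mills_mult_le[of t] mult_left_mono[of "t * mills t" 1 "\<Phi> z"] by linarith
    ultimately show ?thesis by linarith
  qed
  have m: "s * stein_sol z s \<le> t * stein_sol z t" if "s \<le> t" for s t
    using monoD[OF stein_mult_mono that] .
  show ?thesis
    using lo[of x] hi[of x] lo[of "min x (z - 1)"] hi[of "max x z"] m[of "min x (z-1)" x] m[of x "max x z"]
    by (cases "x < z") auto
qed

lemma stein_deriv_bound: "\<bar>stein_deriv z x\<bar> \<le> 2"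
proof -
  have "\<bar>of_bool (x < z) - \<Phi> z\<bar> \<le> 1" using std_normal_cdf_bounds[of z] by auto
  then show ?thesis using stein_mult_bound[of x z] unfolding stein_deriv_def by linarith
qed

text \<open>The mean value theorem is applied on the two sides of the only possible kink
  \<open>z\<close>, and the two estimates are added.\<close>

lemma secant_bound:
  fixes F :: "real \<Rightarrow> real"
  assumes cont: "continuous_on UNIV F"
    and der: "\<And>t. t \<noteq> z \<Longrightarrow> (F has_real_derivative F' t) (at t)"
    and xy: "y \<le> x" and K: "\<And>t. y \<le> t \<Longrightarrow> t \<le> x \<Longrightarrow> \<bar>F' t - c\<bar> \<le> K"
  shows "\<bar>F x - F y - (x - y) * c\<bar> \<le> (x - y) * K"
proof -
  have step: "\<bar>F v - F u - (v - u) * c\<bar> \<le> (v - u) * K" if "u \<le> v" "z \<notin> {u<..<v}" "y \<le> u" "v \<le> x" for u v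
  proof (cases "u = v")
    case False
    then have "u < v" using that by auto
    have "F differentiable (at t)" if "u < t" "t < v" for t
      using der[of t] that \<open>z \<notin> {u<..<v}\<close> by (auto simp: real_differentiable_def)
    then obtain l t where t: "u < t" "t < v" "(F has_real_derivative l) (at t)" "F v - F u = (v - u) * l"
      using MVT[OF \<open>u < v\<close> continuous_on_subset[OF cont]] by auto
    moreover have "l = F' t" using DERIV_unique[OF t(3) der[of t]] t(1,2) that(2) by auto
    ultimately have t: "u < t" "t < v" "F v - F u = (v - u) * F' t" by auto
    then have "\<bar>F v - F u - (v - u) * c\<bar> = (v - u) * \<bar>F' t - c\<bar>"
      using that by (simp add: abs_mult right_diff_distrib[symmetric])
    also have "\<dots> \<le> (v - u) * K" using K[of t] t that by (intro mult_left_mono) auto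
    finally show ?thesis .
  qed auto
  show ?thesis
  proof (cases "z \<in> {y<..<x}")
    case True
    have "\<bar>F z - F y - (z - y) * c\<bar> \<le> (z - y) * K" "\<bar>F x - F z - (x - z) * c\<bar> \<le> (x - z) * K"
      using True by (auto intro!: step)
    then have "\<bar>(F z - F y - (z - y) * c) + (F x - F z - (x - z) * c)\<bar> \<le> (z - y) * K + (x - z) * K"
      by linarith
    then show ?thesis by (simp add: algebra_simps)
  qed (use step xy in auto)
qed

text \<open>\<open>f'\<close> plays the role of the derivative of \<open>f\<close>, and \<open>osc v r\<close> bounds its oscillation on the
  interval \<open>{v - r..v + r}\<close>. Stated through secants, so that \<open>f\<close> may have a kink.\<close>

definition test_function :: "(real \<Rightarrow> real) \<Rightarrow> (real \<Rightarrow> real) \<Rightarrow> (real \<Rightarrow> real \<Rightarrow> real) \<Rightarrow> bool" where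
  "test_function f f' osc \<longleftrightarrow>
     (\<forall>x. \<bar>f x\<bar> \<le> 3) \<and> (\<forall>x. \<bar>f' x\<bar> \<le> 2) \<and> (\<forall>x y. \<bar>f x - f y\<bar> \<le> 2 * \<bar>x - y\<bar>) \<and>
     f' \<in> borel_measurable borel \<and> (\<lambda>(v, r). osc v r) \<in> borel_measurable (borel \<Otimes>\<^sub>M borel) \<and>
     (\<forall>v r. r \<ge> 0 \<longrightarrow> 0 \<le> osc v r) \<and> (\<forall>v r. \<bar>osc v r\<bar> \<le> 4) \<and>
     (\<forall>v r x y w. \<bar>x - v\<bar> \<le> r \<longrightarrow> \<bar>y - v\<bar> \<le> r \<longrightarrow> \<bar>w - v\<bar> \<le> r \<longrightarrow>
        \<bar>f x - f y - (x - y) * f' w\<bar> \<le> \<bar>x - y\<bar> * osc v r)"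

lemma test_function_secantI:
  assumes cont: "continuous_on UNIV F"
    and der: "\<And>t. t \<noteq> z \<Longrightarrow> (F has_real_derivative F' t) (at t)"
    and osc: "\<And>v r s t. \<bar>s - v\<bar> \<le> r \<Longrightarrow> \<bar>t - v\<bar> \<le> r \<Longrightarrow> \<bar>F' s - F' t\<bar> \<le> osc v r"
    and "\<bar>x - v\<bar> \<le> r" "\<bar>y - v\<bar> \<le> r" "\<bar>w - v\<bar> \<le> r"
  shows "\<bar>F x - F y - (x - y) * F' w\<bar> \<le> \<bar>x - y\<bar> * osc v (r::real)"
proof -
  have "\<bar>F t - F s - (t - s) * F' w\<bar> \<le> (t - s) * osc v r" if "s \<le> t" "\<bar>s - v\<bar> \<le> r" "\<bar>t - v\<bar> \<le> r" for s t
    using that assms(6) by (intro secant_bound[OF cont der]) (auto intro!: osc)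
  from this[of x y] this[of y x] assms(4,5) show ?thesis
    by (smt (verit, best) minus_diff_eq minus_mult_left mult_minus_left abs_minus_commute)
qed

text \<open>The increasing part \<open>x * f x\<close> of \<open>f'\<close> varies by the difference
  of its end values, the jump part by at most one if \<open>z\<close> is met. The exact difference
  is kept because the slope of \<open>x * f x\<close> near \<open>z\<close> grows with
  \<open>\<bar>z\<bar>\<close>, so that no Lipschitz constant would serve all
  \<open>z\<close>.\<close>

definition stein_osc :: "real \<Rightarrow> real \<Rightarrow> real \<Rightarrow> real" where
  "stein_osc z v r = (if r < 0 then 0 else
     (v + r) * stein_sol z (v + r) - (v - r) * stein_sol z (v - r) + of_bool (\<bar>v - z\<bar> \<le> r))"

lemma stein_test_function: "test_function (stein_sol z) (stein_deriv z) (stein_osc z)"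
proof -
  have fm: "stein_sol z \<in> borel_measurable borel"
    using stein_sol_cont by (rule borel_measurable_continuous_onI)
  have m: "s * stein_sol z s \<le> t * stein_sol z t" if "s \<le> t" for s t
    using monoD[OF stein_mult_mono that] .
  have lip: "\<bar>stein_sol z x - stein_sol z y\<bar> \<le> 2 * \<bar>x - y\<bar>" for x y
  proof -
    have "\<bar>stein_sol z t - stein_sol z s\<bar> \<le> (t - s) * 2" if "s \<le> t" for s t
      using secant_bound[OF stein_sol_cont[of z] stein_sol_deriv that, where c=0 and K=2] stein_deriv_bound[of z] by auto
    from this[of x y] this[of y x] show ?thesis by (smt (verit))
  qed
  \<comment> \<open>Where \<open>\<bar>x\<bar> \<ge> 1\<close> the bound on \<open>x * f x\<close>
    gives \<open>1\<close>. Any other point is within distance \<open>1\<close> of \<open>1\<close>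
    or \<open>-1\<close>, which by the Lipschitz constant adds at most \<open>2\<close>.\<close>
  have "\<bar>stein_sol z x\<bar> \<le> 3" for x
  proof -
    have big: "\<bar>stein_sol z t\<bar> \<le> 1" if "\<bar>t\<bar> \<ge> 1" for t
    proof -
      have "\<bar>stein_sol z t\<bar> \<le> \<bar>t\<bar> * \<bar>stein_sol z t\<bar>" using that by (simp add: mult_le_cancel_right1)
      then show ?thesis using stein_mult_bound[of t z] by (simp add: abs_mult)
    qed
    show ?thesis
    proof (cases "\<bar>x\<bar> \<ge> 1")
      case True then show ?thesis using big[of x] by simp
    next
      case False
      then show ?thesis using lip[of x 1] lip[of x "-1"] big[of 1] big[of "-1"] by (cases "x \<ge> 0") auto
    qed
  qed
  moreover have "\<bar>stein_deriv z s - stein_deriv z t\<bar> \<le> stein_osc z v r" if "\<bar>s - v\<bar> \<le> r" "\<bar>t - v\<bar> \<le> r" for s t v r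
  proof -
    have "\<bar>s * stein_sol z s - t * stein_sol z t\<bar> \<le> (v + r) * stein_sol z (v + r) - (v - r) * stein_sol z (v - r)"
      using m[of s "v+r"] m[of t "v+r"] m[of "v-r" s] m[of "v-r" t] that by linarith
    moreover have "\<bar>of_bool (s < z) - of_bool (t < z)\<bar> \<le> (of_bool (\<bar>v - z\<bar> \<le> r) :: real)" using that by auto
    moreover have "\<not> r < 0" using that by linarith
    ultimately show ?thesis unfolding stein_deriv_def stein_osc_def by (simp only: if_False)
  qed
  then have "\<bar>stein_sol z x - stein_sol z y - (x - y) * stein_deriv z w\<bar> \<le> \<bar>x - y\<bar> * stein_osc z v r"
    if "\<bar>x - v\<bar> \<le> r" "\<bar>y - v\<bar> \<le> r" "\<bar>w - v\<bar> \<le> r" for x y w v r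
    using that by (intro test_function_secantI[OF stein_sol_cont stein_sol_deriv, where z=z and osc="stein_osc z"]) auto
  moreover have "stein_deriv z \<in> borel_measurable borel"
    unfolding stein_deriv_def using fm by measurable
  moreover have "(\<lambda>(v, r). stein_osc z v r) \<in> borel_measurable (borel \<Otimes>\<^sub>M borel)"
    unfolding stein_osc_def using fm by measurable
  moreover have "0 \<le> stein_osc z v r" for v r
    using m[of "v-r" "v+r"] by (auto simp: stein_osc_def)
  moreover have "\<bar>stein_osc z v r\<bar> \<le> 4" for v r
    using stein_mult_bound[of "v+r" z] stein_mult_bound[of "v-r" z] by (auto simp: stein_osc_def)
  ultimately show ?thesis using lip stein_deriv_bound unfolding test_function_def by blast
qed

section \<open>A trapezoid as smoothed indicator of an interval\<close>

definition "ramp2 x = (max 0 x)\<^sup>2 / (2::real)"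

lemma ramp2_deriv: "(ramp2 has_real_derivative max 0 x) (at x)"
proof -
  consider "x < 0" | "x = 0" | "x > 0" by linarith
  then show ?thesis
  proof cases
    case 1
    have "((\<lambda>_. 0) has_real_derivative max 0 x) (at x)" using 1 by (auto intro!: derivative_eq_intros)
    then show ?thesis
      by (rule has_field_derivative_transform_within_open[of _ _ _ "{..<0}"]) (use 1 in \<open>auto simp: ramp2_def\<close>)
  next
    case 3
    have "((\<lambda>x. x\<^sup>2 / 2) has_real_derivative max 0 x) (at x)" using 3 by (auto intro!: derivative_eq_intros)
    then show ?thesis
      by (rule has_field_derivative_transform_within_open[of _ _ _ "{0<..}"]) (use 3 in \<open>auto simp: ramp2_def\<close>)
  next
    case 2
    have "((\<lambda>h. (ramp2 (0 + h) - ramp2 0) / h) \<longlongrightarrow> 0) (at 0)"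
    proof (rule Lim_null_comparison[where g="\<lambda>h. \<bar>h\<bar>"])
      show "\<forall>\<^sub>F h in at 0. norm ((ramp2 (0 + h) - ramp2 0) / h) \<le> \<bar>h\<bar>"
        by (intro always_eventually allI) (auto simp: ramp2_def max_def power2_eq_square)
    qed (auto intro!: tendsto_eq_intros)
    then show ?thesis using 2 by (simp add: DERIV_def)
  qed
qed

text \<open>Written as a combination of ramps so that the primitive \<open>trapezoid_int\<close> is
  the same combination of half squared ramps; \<open>trapezoid_eq\<close> shows the usual
  shape.\<close>

definition "trapezoid t = max 0 (t + 2) - max 0 (t + 1) - max 0 (t - 1) + max 0 (t - 2 :: real)"
definition "trapezoid_int t = ramp2 (t + 2) - ramp2 (t + 1) - ramp2 (t - 1) + ramp2 (t - 2)"

lemma trapezoid_int_deriv: "(trapezoid_int has_real_derivative trapezoid t) (at t)"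
  unfolding trapezoid_int_def[abs_def] trapezoid_def
  by (auto intro!: derivative_eq_intros DERIV_chain2[OF ramp2_deriv])

lemma trapezoid_eq: "trapezoid t = max 0 (min 1 (2 - \<bar>t\<bar>))"
proof -
  consider "t \<le> -2" | "-2 < t" "t \<le> -1" | "-1 < t" "t \<le> 1" | "1 < t" "t \<le> 2" | "2 < t" by linarith
  then show ?thesis by cases (auto simp: trapezoid_def)
qed

lemma trapezoid_bounds: "0 \<le> trapezoid t" "trapezoid t \<le> 1" "\<bar>t\<bar> \<le> 1 \<Longrightarrow> trapezoid t = 1"
  "\<bar>t\<bar> \<ge> 2 \<Longrightarrow> trapezoid t = 0"
  unfolding trapezoid_eq by auto

lemma trapezoid_lipschitz: "\<bar>trapezoid s - trapezoid t\<bar> \<le> \<bar>s - t\<bar>"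
proof -
  have 1: "\<bar>(2 - \<bar>s\<bar>) - (2 - \<bar>t\<bar>)\<bar> \<le> \<bar>s - t\<bar>" by linarith
  have 2: "\<bar>min 1 a - min 1 b\<bar> \<le> \<bar>a - b\<bar>" for a b :: real by linarith
  have 3: "\<bar>max 0 a - max 0 b\<bar> \<le> \<bar>a - b\<bar>" for a b :: real by linarith
  show ?thesis
    unfolding trapezoid_eq using 1 2[of "2 - \<bar>s\<bar>" "2 - \<bar>t\<bar>"] 3[of "min 1 (2 - \<bar>s\<bar>)" "min 1 (2 - \<bar>t\<bar>)"]
    by (meson order_trans)
qed

lemma trapezoid_int_bounds: "0 \<le> trapezoid_int t" "trapezoid_int t \<le> 3"
proof -
  have mono: "trapezoid_int s \<le> trapezoid_int t" if "s \<le> t" for s t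
    using that by (rule DERIV_nonneg_imp_nondecreasing) (use trapezoid_int_deriv trapezoid_bounds(1) in blast)
  have "trapezoid_int s = 0" if "s \<le> -2" for s using that by (simp add: trapezoid_int_def ramp2_def max_def)
  moreover have "trapezoid_int s = 3" if "s \<ge> 2" for s
    using that by (simp add: trapezoid_int_def ramp2_def max_def power2_eq_square field_simps)
  ultimately show "0 \<le> trapezoid_int t" "trapezoid_int t \<le> 3"
    using mono[of "min t (-2)" t] mono[of t "max t 2"] by auto
qed

text \<open>The rescaled trapezoid has slope at most \<open>1 / l\<close> and is supported within
  \<open>2 * l\<close> of \<open>m\<close>, so an interval that misses this support sees no
  variation. Keeping the indicator is what makes the expected oscillation proportional to a
  concentration probability.\<close>

definition trapezoid_osc :: "real \<Rightarrow> real \<Rightarrow> real \<Rightarrow> real \<Rightarrow> real" where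
  "trapezoid_osc m l v r = (if r < 0 then 0 else min 1 (2 * r / l) * of_bool (\<bar>v - m\<bar> \<le> 2 * l + r))"

lemma trapezoid_test_function:
  assumes "0 < l" "l \<le> 1"
  shows "test_function (\<lambda>x. l * trapezoid_int ((x - m) / l)) (\<lambda>x. trapezoid ((x - m) / l)) (trapezoid_osc m l)"
proof -
  let ?f = "\<lambda>x. l * trapezoid_int ((x - m) / l)"
  let ?f' = "\<lambda>x. trapezoid ((x - m) / l)"
  have der: "(?f has_real_derivative ?f' x) (at x)" for x
    using assms by (auto intro!: derivative_eq_intros DERIV_chain2[OF trapezoid_int_deriv])
  then have cont: "continuous_on UNIV ?f" by (intro DERIV_continuous_on[OF has_field_derivative_at_within])
  have lip: "\<bar>?f x - ?f y\<bar> \<le> 2 * \<bar>x - y\<bar>" for x y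
  proof -
    have b: "\<bar>?f' t - 0\<bar> \<le> 2" for t using trapezoid_bounds(1,2)[of "(t - m) / l"] by auto
    have "\<bar>?f t - ?f s\<bar> \<le> (t - s) * 2" if "s \<le> t" for s t
      using secant_bound[OF cont der that, where c=0 and K=2] b by simp
    from this[of x y] this[of y x] show ?thesis by (smt (verit))
  qed
  have "\<bar>?f x\<bar> \<le> 3" for x
  proof -
    have "l * trapezoid_int ((x - m) / l) \<le> 1 * 3"
      using assms trapezoid_int_bounds by (intro mult_mono) auto
    then show ?thesis using assms trapezoid_int_bounds(1) by simp
  qed
  moreover have "\<bar>?f' s - ?f' t\<bar> \<le> trapezoid_osc m l v r" if "\<bar>s - v\<bar> \<le> r" "\<bar>t - v\<bar> \<le> r" for s t v r
  proof -
    have r: "r \<ge> 0" using that by linarith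
    have 1: "\<bar>?f' s - ?f' t\<bar> \<le> 1"
      using trapezoid_bounds(1,2)[of "(s - m) / l"] trapezoid_bounds(1,2)[of "(t - m) / l"] by linarith
    have "\<bar>?f' s - ?f' t\<bar> \<le> \<bar>(s - m) / l - (t - m) / l\<bar>" by (rule trapezoid_lipschitz)
    also have "\<dots> = \<bar>s - t\<bar> / l" using assms by (simp add: diff_divide_distrib[symmetric])
    also have "\<dots> \<le> 2 * r / l" using that assms by (intro divide_right_mono) auto
    finally have 2: "\<bar>?f' s - ?f' t\<bar> \<le> 2 * r / l" .
    show ?thesis
    proof (cases "\<bar>v - m\<bar> \<le> 2 * l + r")
      case False
      have "\<bar>(x - m) / l\<bar> \<ge> 2" if "\<bar>x - v\<bar> \<le> r" for x
      proof -
        have "\<bar>x - m\<bar> \<ge> 2 * l" using False that by linarith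
        then show ?thesis using assms by (simp add: le_divide_eq)
      qed
      then show ?thesis using trapezoid_bounds(4) that r False by (simp add: trapezoid_osc_def)
    qed (use 1 2 r in \<open>simp add: trapezoid_osc_def\<close>)
  qed
  then have "\<bar>?f x - ?f y - (x - y) * ?f' w\<bar> \<le> \<bar>x - y\<bar> * trapezoid_osc m l v r"
    if "\<bar>x - v\<bar> \<le> r" "\<bar>y - v\<bar> \<le> r" "\<bar>w - v\<bar> \<le> r" for x y w v r
    using that by (intro test_function_secantI[OF cont der, where osc="trapezoid_osc m l"]) auto
  moreover have "?f' \<in> borel_measurable borel" unfolding trapezoid_def by measurable
  moreover have "(\<lambda>(v, r). trapezoid_osc m l v r) \<in> borel_measurable (borel \<Otimes>\<^sub>M borel)"
    unfolding trapezoid_osc_def by measurable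
  moreover have "0 \<le> trapezoid_osc m l v r" "\<bar>trapezoid_osc m l v r\<bar> \<le> 4" for v r
    using assms by (auto simp: trapezoid_osc_def)
  moreover have "\<bar>?f' x\<bar> \<le> 2" for x using trapezoid_bounds(1,2)[of "(x - m) / l"] by auto
  ultimately show ?thesis using lip unfolding test_function_def by blast
qed

section \<open>Stein's identity for an array with local structure\<close>

lemma amgm3: "0 \<le> x \<Longrightarrow> 0 \<le> y \<Longrightarrow> 0 \<le> z \<Longrightarrow> 3 * (x * y * z) \<le> x ^ 3 + y ^ 3 + (z::real) ^ 3"
proof -
  assume "0 \<le> x" "0 \<le> y" "0 \<le> z"
  then have "0 \<le> (x + y + z) * ((x - y)\<^sup>2 + (y - z)\<^sup>2 + (z - x)\<^sup>2)" by simp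
  also have "\<dots> = 2 * (x ^ 3 + y ^ 3 + z ^ 3 - 3 * (x * y * z))"
    by (simp add: power2_eq_square power3_eq_cube algebra_simps)
  finally show ?thesis by simp
qed

text \<open>If the product exceeds \<open>1\<close>, so does one of the factors, whence
  \<open>x + y \<ge> 1\<close>. A tail of second order is thereby paid for with a moment of third
  order, the highest one available.\<close>

lemma tail_product_le: "0 \<le> x \<Longrightarrow> 0 \<le> y \<Longrightarrow> x * y * of_bool (1 < x * y) \<le> x * y * (x + (y::real))"
proof (cases "1 < x * y")
  case True
  assume "0 \<le> x" "0 \<le> y"
  have "1 \<le> x + y"
  proof (rule ccontr)
    assume "\<not> 1 \<le> x + y"
    then have "x * y \<le> 1 * 1" using \<open>0 \<le> x\<close> \<open>0 \<le> y\<close> by (intro mult_mono) auto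
    then show False using True by simp
  qed
  then show ?thesis using True mult_left_mono[of 1 "x + y" "x * y"] by simp
qed simp

lemma test_functionD:
  assumes "test_function f f' osc"
  shows "f \<in> borel_measurable borel" "f' \<in> borel_measurable borel" "\<bar>f x\<bar> \<le> 3" "\<bar>f' x\<bar> \<le> 2"
    "\<bar>f x - f y\<bar> \<le> 2 * \<bar>x - y\<bar>" "\<bar>osc v r\<bar> \<le> 4" "r \<ge> 0 \<Longrightarrow> 0 \<le> osc v r"
    "(\<lambda>(v, r). osc v r) \<in> borel_measurable (borel \<Otimes>\<^sub>M borel)"
    "\<bar>x - v\<bar> \<le> r \<Longrightarrow> \<bar>y - v\<bar> \<le> r \<Longrightarrow> \<bar>w - v\<bar> \<le> r \<Longrightarrow> \<bar>f x - f y - (x - y) * f' w\<bar> \<le> \<bar>x - y\<bar> * osc v r"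
proof -
  have lip: "\<bar>f x - f y\<bar> \<le> 2 * \<bar>x - y\<bar>" for x y using assms by (auto simp: test_function_def)
  have "continuous_on UNIV f"
  proof (rule continuous_onI)
    fix x e :: real assume "0 < e"
    then show "\<exists>d>0. \<forall>x'\<in>UNIV. dist x' x < d \<longrightarrow> dist (f x') (f x) \<le> e"
      using lip by (intro exI[of _ "e / 2"]) (auto simp: dist_real_def intro: order_trans[OF lip])
  qed
  then show "f \<in> borel_measurable borel" by (rule borel_measurable_continuous_onI)
qed (use assms in \<open>auto simp: test_function_def\<close>)

lemma (in prob_space) dominated:
  assumes "g \<in> borel_measurable M" "integrable M h" "\<And>\<omega>. \<omega> \<in> space M \<Longrightarrow> \<bar>g \<omega>\<bar> \<le> (h \<omega> :: real)"
  shows "integrable M g" "\<bar>expectation g\<bar> \<le> expectation h" "expectation (\<lambda>\<omega>. \<bar>g \<omega>\<bar>) \<le> expectation h"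
proof -
  show g: "integrable M g"
    using assms(3) by (intro Bochner_Integration.integrable_bound[OF assms(2) assms(1)] AE_I2) force
  show 1: "expectation (\<lambda>\<omega>. \<bar>g \<omega>\<bar>) \<le> expectation h"
    using g assms by (intro integral_mono) auto
  have "\<bar>expectation g\<bar> \<le> expectation (\<lambda>\<omega>. \<bar>g \<omega>\<bar>)" by simp
  with 1 show "\<bar>expectation g\<bar> \<le> expectation h" by linarith
qed

lemma (in prob_space) expectation_majorant:
  assumes "integrable M A" "\<And>i. i \<in> I \<Longrightarrow> integrable M (B i)" "integrable M C"
  shows "expectation (\<lambda>\<omega>. 4 * A \<omega> + (\<Sum>i\<in>I. 2 * B i \<omega>) + 4 * C \<omega>)
    = 4 * expectation A + (\<Sum>i\<in>I. 2 * expectation (B i)) + 4 * (expectation C :: real)"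
proof -
  have "expectation (\<lambda>\<omega>. \<Sum>i\<in>I. 2 * B i \<omega>) = (\<Sum>i\<in>I. expectation (\<lambda>\<omega>. 2 * B i \<omega>))"
    using assms by (intro Bochner_Integration.integral_sum) auto
  moreover have "integrable M (\<lambda>\<omega>. \<Sum>i\<in>I. 2 * B i \<omega>)" using assms by auto
  ultimately show ?thesis using assms by simp
qed

text \<open>The structure that remains once mixing has been exploited. Level \<open>i\<close> has
  the window \<open>win i j\<close> of radius \<open>i * gap\<close>, and \<open>L\<close> bounds
  the size of the largest one, at level \<open>k + 1\<close>; \<open>\<Delta>loc j\<close> ignores
  that largest window and therefore all smaller ones. \<open>\<beta>\<close> bounds the third-moment
  norm of a summand, and \<open>1 \<le> 2 ^ k * \<beta>\<close> says that \<open>k\<close> doublings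
  lead from \<open>\<beta>\<close> past \<open>1\<close>. \<open>d\<close> measures the localisation
  of the remainder, \<open>c\<close> the decoupling across one gap.\<close>

locale stein_array = prob_space M for M :: "'w measure" +
  fixes N gap k :: nat and \<S> :: "nat set \<Rightarrow> 'w measure" and \<xi> :: "nat \<Rightarrow> 'w \<Rightarrow> real"
    and \<Delta> :: "'w \<Rightarrow> real" and \<Delta>loc :: "nat \<Rightarrow> 'w \<Rightarrow> real" and \<beta> d c :: real
    and win :: "nat \<Rightarrow> nat \<Rightarrow> nat set" and L :: real
  defines "win i j \<equiv> {j - i * gap..j + i * gap} \<inter> {1..N}"
    and "L \<equiv> 2 * (real k + 1) * real gap + 1"
  assumes \<S>_subalgebra: "subalgebra M (\<S> I)"
    and \<S>_mono: "I \<subseteq> I' \<Longrightarrow> sets (\<S> I) \<subseteq> sets (\<S> I')"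
    and \<xi>_measurable: "j \<in> {1..N} \<Longrightarrow> \<xi> j \<in> borel_measurable (\<S> {j})"
    and \<xi>_integrable: "j \<in> {1..N} \<Longrightarrow> integrable M (\<lambda>\<omega>. \<bar>\<xi> j \<omega>\<bar> ^ 3)"
    and \<xi>_third: "j \<in> {1..N} \<Longrightarrow> expectation (\<lambda>\<omega>. \<bar>\<xi> j \<omega>\<bar> ^ 3) \<le> \<beta> ^ 3"
    and \<xi>_centered: "j \<in> {1..N} \<Longrightarrow> expectation (\<xi> j) = 0"
    and \<beta>: "0 < \<beta>" "\<beta> \<le> 1" "1 \<le> 2 ^ k * \<beta>"
    and c_d_nonneg: "0 \<le> c" "0 \<le> d"
    and k_gap: "1 \<le> k" "1 \<le> gap"
    and decoupled_win: "j \<in> {1..N} \<Longrightarrow> i \<le> k \<Longrightarrow> decoupled (\<S> (win i j)) (\<S> ({1..N} - win (Suc i) j)) c"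
    and \<Delta>_measurable: "\<Delta> \<in> borel_measurable M"
    and \<Delta>loc_measurable: "j \<in> {1..N} \<Longrightarrow> \<Delta>loc j \<in> borel_measurable (\<S> ({1..N} - win (Suc k) j))"
    and \<Delta>loc_weighted: "i \<in> {1..N} \<Longrightarrow> j \<in> {1..N} \<Longrightarrow> integrable M (\<lambda>\<omega>. \<bar>\<xi> j \<omega>\<bar> * \<bar>\<Delta> \<omega> - \<Delta>loc i \<omega>\<bar>)"
      "i \<in> {1..N} \<Longrightarrow> j \<in> {1..N} \<Longrightarrow> expectation (\<lambda>\<omega>. \<bar>\<xi> j \<omega>\<bar> * \<bar>\<Delta> \<omega> - \<Delta>loc i \<omega>\<bar>) \<le> \<beta> * d"
    and \<Delta>loc_diff: "i \<in> {1..N} \<Longrightarrow> integrable M (\<lambda>\<omega>. \<bar>\<Delta> \<omega> - \<Delta>loc i \<omega>\<bar>)"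
      "i \<in> {1..N} \<Longrightarrow> expectation (\<lambda>\<omega>. \<bar>\<Delta> \<omega> - \<Delta>loc i \<omega>\<bar>) \<le> d"
begin

text \<open>Concentration is required for sums with any of these, because \<open>U\<close> carries
  \<open>\<Delta>loc j\<close> while the statistic itself carries \<open>\<Delta>\<close>.\<close>

definition remainders :: "('w \<Rightarrow> real) set" where
  "remainders = insert \<Delta> (\<Delta>loc ` {1..N})"

definition W :: "nat set \<Rightarrow> 'w \<Rightarrow> real" where
  "W J \<omega> = (\<Sum>i\<in>J. \<xi> i \<omega>)"

text \<open>Up to level \<open>k + 1\<close> this is measurable outside \<open>win i j\<close>: the
  window is deleted from the sum, and \<open>\<Delta>loc j\<close> ignores one at least as large. It
  serves as a centre that is nearly independent of what happens inside a smaller window.\<close>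

definition U :: "nat set \<Rightarrow> nat \<Rightarrow> nat \<Rightarrow> 'w \<Rightarrow> real" where
  "U J j i \<omega> = W (J - win i j) \<omega> + \<Delta>loc j \<omega>"

text \<open>The summand \<open>\<beta>\<close> is the floor from which the doubling argument starts;
  \<open>\<bar>s\<bar>\<close> makes room for the shifted argument of \<open>f\<close>.\<close>

definition Y :: "nat \<Rightarrow> real \<Rightarrow> nat \<Rightarrow> 'w \<Rightarrow> real" where
  "Y j s i \<omega> = \<beta> + \<bar>s\<bar> + (\<Sum>b\<in>win i j. \<bar>\<xi> b \<omega>\<bar>)"

definition S :: "nat \<Rightarrow> 'w \<Rightarrow> real" where
  "S j \<omega> = (\<Sum>b\<in>win (Suc k) j. \<bar>\<xi> b \<omega>\<bar>)"

section \<open>Windows, measurability and moments\<close>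

lemma win_mono: "i \<le> i' \<Longrightarrow> win i j \<subseteq> win i' j"
proof -
  assume "i \<le> i'"
  then have "i * gap \<le> i' * gap" by simp
  moreover have "a \<le> b \<Longrightarrow> {j - a..j + a} \<subseteq> {j - b..j + b}" for a b by auto
  ultimately show ?thesis unfolding win_def by blast
qed

lemma win_sub: "win i j \<subseteq> {1..N}" and win_finite [simp, intro]: "finite (win i j)"
  by (auto simp: win_def)

lemma win_self: "j \<in> {1..N} \<Longrightarrow> j \<in> win i j"
  by (auto simp: win_def)

lemma card_win: "i \<le> Suc k \<Longrightarrow> real (card (win i j)) \<le> L"
proof -
  assume "i \<le> Suc k"
  have "card (win i j) \<le> card (win (Suc k) j)" using win_mono[OF \<open>i \<le> Suc k\<close>] by (auto intro: card_mono)
  also have "\<dots> \<le> card {j - Suc k * gap..j + Suc k * gap}" unfolding win_def by (intro card_mono) auto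
  also have "\<dots> \<le> 2 * (Suc k * gap) + 1" by simp
  finally have "real (card (win i j)) \<le> real (2 * (Suc k * gap) + 1)" by (simp only: of_nat_le_iff)
  then show ?thesis by (simp add: L_def algebra_simps)
qed

lemma L: "1 \<le> L" "real k \<le> L"
proof -
  show "1 \<le> L" by (simp add: L_def)
  have "real k * 1 \<le> real k * real gap" using k_gap by (intro mult_left_mono) auto
  then show "real k \<le> L" by (simp add: L_def algebra_simps)
qed

lemma \<S>_meas_mono: "g \<in> borel_measurable (\<S> I) \<Longrightarrow> I \<subseteq> I' \<Longrightarrow> g \<in> borel_measurable (\<S> I')"
  using \<S>_subalgebra[of I] \<S>_subalgebra[of I'] \<S>_mono[of I I']
  by (intro measurable_from_subalg[of "\<S> I'" "\<S> I"]) (auto simp: subalgebra_def)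

lemma \<S>_meas: "g \<in> borel_measurable (\<S> I) \<Longrightarrow> g \<in> borel_measurable M"
  using \<S>_subalgebra by (rule measurable_from_subalg)

lemma \<xi>_meas: "j \<in> I \<Longrightarrow> j \<in> {1..N} \<Longrightarrow> \<xi> j \<in> borel_measurable (\<S> I)"
  using \<xi>_measurable \<S>_meas_mono by blast

lemma \<xi>_measM [measurable (raw)]: "j \<in> {1..N} \<Longrightarrow> \<xi> j \<in> borel_measurable M"
  using \<xi>_measurable \<S>_meas by blast

lemma W_meas: "J \<subseteq> I \<Longrightarrow> J \<subseteq> {1..N} \<Longrightarrow> W J \<in> borel_measurable (\<S> I)"
  unfolding W_def by (intro borel_measurable_sum \<xi>_meas) auto

lemma W_measM: "J \<subseteq> {1..N} \<Longrightarrow> W J \<in> borel_measurable M"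
  unfolding W_def by (intro borel_measurable_sum \<xi>_measM) auto

lemma remainders_meas: "D \<in> remainders \<Longrightarrow> D \<in> borel_measurable M"
  using \<Delta>_measurable \<Delta>loc_measurable[THEN \<S>_meas] by (auto simp: remainders_def)

lemma U_meas:
  assumes "J \<subseteq> {1..N}" "j \<in> {1..N}" "i \<le> Suc k"
  shows "U J j i \<in> borel_measurable (\<S> ({1..N} - win i j))"
proof -
  have "\<Delta>loc j \<in> borel_measurable (\<S> ({1..N} - win i j))"
    using \<Delta>loc_measurable[OF assms(2)] win_mono[OF assms(3)] by (auto intro: \<S>_meas_mono)
  moreover have "W (J - win i j) \<in> borel_measurable (\<S> ({1..N} - win i j))"
    using assms(1) by (intro W_meas) auto
  ultimately show ?thesis unfolding U_def[abs_def] by measurable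
qed

lemma U_measM: "J \<subseteq> {1..N} \<Longrightarrow> j \<in> {1..N} \<Longrightarrow> i \<le> Suc k \<Longrightarrow> U J j i \<in> borel_measurable M"
  using U_meas \<S>_meas by blast

lemma moment3:
  assumes "a \<in> {1..N}" "b \<in> {1..N}" "e \<in> {1..N}"
  shows "integrable M (\<lambda>\<omega>. \<bar>\<xi> a \<omega>\<bar> * \<bar>\<xi> b \<omega>\<bar> * \<bar>\<xi> e \<omega>\<bar>)"
    and "expectation (\<lambda>\<omega>. \<bar>\<xi> a \<omega>\<bar> * \<bar>\<xi> b \<omega>\<bar> * \<bar>\<xi> e \<omega>\<bar>) \<le> \<beta> ^ 3"
proof -
  let ?h = "\<lambda>\<omega>. (\<bar>\<xi> a \<omega>\<bar> ^ 3 + \<bar>\<xi> b \<omega>\<bar> ^ 3 + \<bar>\<xi> e \<omega>\<bar> ^ 3) / 3"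
  have h: "integrable M ?h" using assms \<xi>_integrable by auto
  have m: "(\<lambda>\<omega>. \<bar>\<xi> a \<omega>\<bar> * \<bar>\<xi> b \<omega>\<bar> * \<bar>\<xi> e \<omega>\<bar>) \<in> borel_measurable M"
    using assms[THEN \<xi>_measM] by measurable
  have le: "\<bar>\<bar>\<xi> a \<omega>\<bar> * \<bar>\<xi> b \<omega>\<bar> * \<bar>\<xi> e \<omega>\<bar>\<bar> \<le> ?h \<omega>" for \<omega>
    using amgm3[of "\<bar>\<xi> a \<omega>\<bar>" "\<bar>\<xi> b \<omega>\<bar>" "\<bar>\<xi> e \<omega>\<bar>"] by (simp add: abs_mult)
  have "expectation ?h \<le> \<beta> ^ 3"
    using assms[THEN \<xi>_third] assms[THEN \<xi>_integrable] by simp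
  then show "integrable M (\<lambda>\<omega>. \<bar>\<xi> a \<omega>\<bar> * \<bar>\<xi> b \<omega>\<bar> * \<bar>\<xi> e \<omega>\<bar>)"
    "expectation (\<lambda>\<omega>. \<bar>\<xi> a \<omega>\<bar> * \<bar>\<xi> b \<omega>\<bar> * \<bar>\<xi> e \<omega>\<bar>) \<le> \<beta> ^ 3"
    using dominated[OF m h le] by auto
qed

text \<open>Inserting the constant \<open>\<beta>\<close> for a missing factor in
  \<open>amgm3\<close> and dividing by it turns third moments into second ones;
  \<open>moment1\<close> inserts it twice.\<close>

lemma moment2:
  assumes "a \<in> {1..N}" "b \<in> {1..N}"
  shows "integrable M (\<lambda>\<omega>. \<bar>\<xi> a \<omega>\<bar> * \<bar>\<xi> b \<omega>\<bar>)"
    and "expectation (\<lambda>\<omega>. \<bar>\<xi> a \<omega>\<bar> * \<bar>\<xi> b \<omega>\<bar>) \<le> \<beta>\<^sup>2"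
proof -
  let ?h = "\<lambda>\<omega>. (\<bar>\<xi> a \<omega>\<bar> ^ 3 + \<bar>\<xi> b \<omega>\<bar> ^ 3 + \<beta> ^ 3) / (3 * \<beta>)"
  have h: "integrable M ?h" using assms \<xi>_integrable by auto
  have m: "(\<lambda>\<omega>. \<bar>\<xi> a \<omega>\<bar> * \<bar>\<xi> b \<omega>\<bar>) \<in> borel_measurable M"
    using assms[THEN \<xi>_measM] by measurable
  have le: "\<bar>\<bar>\<xi> a \<omega>\<bar> * \<bar>\<xi> b \<omega>\<bar>\<bar> \<le> ?h \<omega>" for \<omega>
    using amgm3[of "\<bar>\<xi> a \<omega>\<bar>" "\<bar>\<xi> b \<omega>\<bar>" \<beta>] \<beta> by (simp add: abs_mult le_divide_eq mult_ac)
  have "expectation ?h = (expectation (\<lambda>\<omega>. \<bar>\<xi> a \<omega>\<bar> ^ 3) + expectation (\<lambda>\<omega>. \<bar>\<xi> b \<omega>\<bar> ^ 3) + \<beta> ^ 3) / (3 * \<beta>)"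
    using assms[THEN \<xi>_integrable] by (simp add: prob_space)
  also have "\<dots> \<le> (3 * \<beta> ^ 3) / (3 * \<beta>)"
    using assms[THEN \<xi>_third] \<beta> by (intro divide_right_mono) auto
  also have "\<dots> = \<beta>\<^sup>2" using \<beta> by (simp add: power3_eq_cube power2_eq_square)
  finally show "integrable M (\<lambda>\<omega>. \<bar>\<xi> a \<omega>\<bar> * \<bar>\<xi> b \<omega>\<bar>)"
    "expectation (\<lambda>\<omega>. \<bar>\<xi> a \<omega>\<bar> * \<bar>\<xi> b \<omega>\<bar>) \<le> \<beta>\<^sup>2"
    using dominated[OF m h le] by auto
qed

lemma moment1:
  assumes "a \<in> {1..N}"
  shows "integrable M (\<xi> a)" and "expectation (\<lambda>\<omega>. \<bar>\<xi> a \<omega>\<bar>) \<le> \<beta>"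
proof -
  let ?h = "\<lambda>\<omega>. (\<bar>\<xi> a \<omega>\<bar> ^ 3 + 2 * \<beta> ^ 3) / (3 * \<beta>\<^sup>2)"
  have h: "integrable M ?h" using assms \<xi>_integrable by auto
  have m: "\<xi> a \<in> borel_measurable M" using assms[THEN \<xi>_measM] by measurable
  have le: "\<bar>\<xi> a \<omega>\<bar> \<le> ?h \<omega>" for \<omega>
    using amgm3[of "\<bar>\<xi> a \<omega>\<bar>" \<beta> \<beta>] \<beta> by (simp add: abs_mult le_divide_eq mult_ac power2_eq_square)
  have "expectation ?h = (expectation (\<lambda>\<omega>. \<bar>\<xi> a \<omega>\<bar> ^ 3) + 2 * \<beta> ^ 3) / (3 * \<beta>\<^sup>2)"
    using assms[THEN \<xi>_integrable] by (simp add: prob_space)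
  also have "\<dots> \<le> (3 * \<beta> ^ 3) / (3 * \<beta>\<^sup>2)"
    using assms[THEN \<xi>_third] \<beta> by (intro divide_right_mono) auto
  also have "\<dots> = \<beta>" using \<beta> by (simp add: power3_eq_cube power2_eq_square)
  finally show "integrable M (\<xi> a)" "expectation (\<lambda>\<omega>. \<bar>\<xi> a \<omega>\<bar>) \<le> \<beta>"
    using dominated[OF m h le] by auto
qed

lemma S_nonneg: "0 \<le> S j \<omega>" unfolding S_def by (simp add: sum_nonneg)

lemma S_measM: "S j \<in> borel_measurable M"
  unfolding S_def using win_sub by (intro borel_measurable_sum borel_measurable_abs \<xi>_measM) blast

lemma moment_S: "integrable M (S j)" "expectation (S j) \<le> L * \<beta>"
proof -
  have w: "b \<in> {1..N}" if "b \<in> win (Suc k) j" for b using that win_sub by blast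
  show "integrable M (S j)" unfolding S_def using moment1(1)[OF w] by auto
  have "expectation (S j) = (\<Sum>b\<in>win (Suc k) j. expectation (\<lambda>\<omega>. \<bar>\<xi> b \<omega>\<bar>))"
    unfolding S_def using moment1(1)[OF w] by (intro Bochner_Integration.integral_sum) auto
  also have "\<dots> \<le> (\<Sum>b\<in>win (Suc k) j. \<beta>)" using moment1(2)[OF w] by (intro sum_mono)
  also have "\<dots> \<le> L * \<beta>" using card_win[of "Suc k" j] \<beta> by (simp add: mult_right_mono)
  finally show "expectation (S j) \<le> L * \<beta>" .
qed

lemma moment_\<xi>S:
  assumes "j \<in> {1..N}"
  shows "integrable M (\<lambda>\<omega>. \<bar>\<xi> j \<omega>\<bar> * S j \<omega>)" "expectation (\<lambda>\<omega>. \<bar>\<xi> j \<omega>\<bar> * S j \<omega>) \<le> L * \<beta>\<^sup>2"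
proof -
  have w: "b \<in> {1..N}" if "b \<in> win (Suc k) j" for b using that win_sub by blast
  show "integrable M (\<lambda>\<omega>. \<bar>\<xi> j \<omega>\<bar> * S j \<omega>)"
    unfolding S_def sum_distrib_left by (intro Bochner_Integration.integrable_sum moment2 assms w)
  have "expectation (\<lambda>\<omega>. \<bar>\<xi> j \<omega>\<bar> * S j \<omega>) = (\<Sum>b\<in>win (Suc k) j. expectation (\<lambda>\<omega>. \<bar>\<xi> j \<omega>\<bar> * \<bar>\<xi> b \<omega>\<bar>))"
    unfolding S_def sum_distrib_left by (intro Bochner_Integration.integral_sum moment2 assms w)
  also have "\<dots> \<le> (\<Sum>b\<in>win (Suc k) j. \<beta>\<^sup>2)" by (intro sum_mono moment2 assms w)
  also have "\<dots> \<le> L * \<beta>\<^sup>2" using card_win[of "Suc k" j] by (simp add: mult_right_mono)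
  finally show "expectation (\<lambda>\<omega>. \<bar>\<xi> j \<omega>\<bar> * S j \<omega>) \<le> L * \<beta>\<^sup>2" .
qed

lemma moment_\<xi>SS:
  assumes "j \<in> {1..N}"
  shows "integrable M (\<lambda>\<omega>. \<bar>\<xi> j \<omega>\<bar> * S j \<omega> * S j \<omega>)"
    "expectation (\<lambda>\<omega>. \<bar>\<xi> j \<omega>\<bar> * S j \<omega> * S j \<omega>) \<le> L\<^sup>2 * \<beta> ^ 3"
proof -
  have w: "b \<in> {1..N}" if "b \<in> win (Suc k) j" for b using that win_sub by blast
  have eq: "\<bar>\<xi> j \<omega>\<bar> * S j \<omega> * S j \<omega> = (\<Sum>a\<in>win (Suc k) j. \<Sum>b\<in>win (Suc k) j. \<bar>\<xi> j \<omega>\<bar> * \<bar>\<xi> a \<omega>\<bar> * \<bar>\<xi> b \<omega>\<bar>)" for \<omega>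
    unfolding S_def by (simp add: sum_distrib_left sum_distrib_right mult_ac)
  show "integrable M (\<lambda>\<omega>. \<bar>\<xi> j \<omega>\<bar> * S j \<omega> * S j \<omega>)"
    unfolding eq by (intro Bochner_Integration.integrable_sum moment3 assms w)
  have "expectation (\<lambda>\<omega>. \<bar>\<xi> j \<omega>\<bar> * S j \<omega> * S j \<omega>) =
    (\<Sum>a\<in>win (Suc k) j. \<Sum>b\<in>win (Suc k) j. expectation (\<lambda>\<omega>. \<bar>\<xi> j \<omega>\<bar> * \<bar>\<xi> a \<omega>\<bar> * \<bar>\<xi> b \<omega>\<bar>))"
  proof -
    have "expectation (\<lambda>\<omega>. \<Sum>b\<in>win (Suc k) j. \<bar>\<xi> j \<omega>\<bar> * \<bar>\<xi> a \<omega>\<bar> * \<bar>\<xi> b \<omega>\<bar>)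
      = (\<Sum>b\<in>win (Suc k) j. expectation (\<lambda>\<omega>. \<bar>\<xi> j \<omega>\<bar> * \<bar>\<xi> a \<omega>\<bar> * \<bar>\<xi> b \<omega>\<bar>))" if "a \<in> win (Suc k) j" for a
      by (intro Bochner_Integration.integral_sum moment3 assms w that)
    moreover have "expectation (\<lambda>\<omega>. \<Sum>a\<in>win (Suc k) j. \<Sum>b\<in>win (Suc k) j. \<bar>\<xi> j \<omega>\<bar> * \<bar>\<xi> a \<omega>\<bar> * \<bar>\<xi> b \<omega>\<bar>)
      = (\<Sum>a\<in>win (Suc k) j. expectation (\<lambda>\<omega>. \<Sum>b\<in>win (Suc k) j. \<bar>\<xi> j \<omega>\<bar> * \<bar>\<xi> a \<omega>\<bar> * \<bar>\<xi> b \<omega>\<bar>))"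
      by (intro Bochner_Integration.integral_sum Bochner_Integration.integrable_sum moment3 assms w)
    ultimately show ?thesis unfolding eq by simp
  qed
  also have "\<dots> \<le> (\<Sum>a\<in>win (Suc k) j. \<Sum>b\<in>win (Suc k) j. \<beta> ^ 3)" by (intro sum_mono moment3 assms w)
  also have "\<dots> = (real (card (win (Suc k) j)))\<^sup>2 * \<beta> ^ 3" by (simp add: power2_eq_square)
  also have "\<dots> \<le> L\<^sup>2 * \<beta> ^ 3"
    using card_win[of "Suc k" j] \<beta> by (intro mult_right_mono power_mono) auto
  finally show "expectation (\<lambda>\<omega>. \<bar>\<xi> j \<omega>\<bar> * S j \<omega> * S j \<omega>) \<le> L\<^sup>2 * \<beta> ^ 3" .
qed

text \<open>Two local remainders are compared through \<open>\<Delta>\<close>, which explains the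
  factor \<open>2\<close>.\<close>

lemma remainder_weighted:
  assumes "D \<in> remainders" "i \<in> {1..N}" "j \<in> {1..N}"
  shows "integrable M (\<lambda>\<omega>. \<bar>\<xi> j \<omega>\<bar> * \<bar>D \<omega> - \<Delta>loc i \<omega>\<bar>)"
    "expectation (\<lambda>\<omega>. \<bar>\<xi> j \<omega>\<bar> * \<bar>D \<omega> - \<Delta>loc i \<omega>\<bar>) \<le> 2 * (\<beta> * d)"
proof -
  have m: "(\<lambda>\<omega>. \<bar>\<xi> j \<omega>\<bar> * \<bar>D \<omega> - \<Delta>loc i \<omega>\<bar>) \<in> borel_measurable M"
    using \<xi>_measM[OF assms(3)] remainders_meas[OF assms(1)] \<Delta>loc_measurable[OF assms(2), THEN \<S>_meas] by measurable
  have bd: "0 \<le> \<beta> * d" using \<beta> c_d_nonneg by simp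
  consider "D = \<Delta>" | e where "e \<in> {1..N}" "D = \<Delta>loc e" using assms(1) by (auto simp: remainders_def)
  then have "integrable M (\<lambda>\<omega>. \<bar>\<xi> j \<omega>\<bar> * \<bar>D \<omega> - \<Delta>loc i \<omega>\<bar>) \<and>
    expectation (\<lambda>\<omega>. \<bar>\<xi> j \<omega>\<bar> * \<bar>D \<omega> - \<Delta>loc i \<omega>\<bar>) \<le> 2 * (\<beta> * d)"
  proof cases
    case 1
    then show ?thesis using \<Delta>loc_weighted[OF assms(2,3)] bd by auto
  next
    case 2
    let ?h = "\<lambda>\<omega>. \<bar>\<xi> j \<omega>\<bar> * \<bar>\<Delta> \<omega> - \<Delta>loc i \<omega>\<bar> + \<bar>\<xi> j \<omega>\<bar> * \<bar>\<Delta> \<omega> - \<Delta>loc e \<omega>\<bar>"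
    have h: "integrable M ?h" "expectation ?h \<le> 2 * (\<beta> * d)"
      using \<Delta>loc_weighted[OF assms(2,3)] \<Delta>loc_weighted[OF 2(1) assms(3)] by auto
    have "\<bar>\<bar>\<xi> j \<omega>\<bar> * \<bar>D \<omega> - \<Delta>loc i \<omega>\<bar>\<bar> \<le> ?h \<omega>" for \<omega>
    proof -
      have "\<bar>\<xi> j \<omega>\<bar> * \<bar>D \<omega> - \<Delta>loc i \<omega>\<bar> \<le> \<bar>\<xi> j \<omega>\<bar> * (\<bar>\<Delta> \<omega> - \<Delta>loc i \<omega>\<bar> + \<bar>\<Delta> \<omega> - \<Delta>loc e \<omega>\<bar>)"
        using 2 by (intro mult_left_mono) auto
      then show ?thesis by (simp add: algebra_simps)
    qed
    from dominated(1,3)[OF m h(1) this] h(2) show ?thesis by simp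
  qed
  then show "integrable M (\<lambda>\<omega>. \<bar>\<xi> j \<omega>\<bar> * \<bar>D \<omega> - \<Delta>loc i \<omega>\<bar>)"
    "expectation (\<lambda>\<omega>. \<bar>\<xi> j \<omega>\<bar> * \<bar>D \<omega> - \<Delta>loc i \<omega>\<bar>) \<le> 2 * (\<beta> * d)" by auto
qed

lemma remainder_diff:
  assumes "D \<in> remainders" "i \<in> {1..N}"
  shows "integrable M (\<lambda>\<omega>. \<bar>D \<omega> - \<Delta>loc i \<omega>\<bar>)"
    "expectation (\<lambda>\<omega>. \<bar>D \<omega> - \<Delta>loc i \<omega>\<bar>) \<le> 2 * d"
proof -
  have m: "(\<lambda>\<omega>. \<bar>D \<omega> - \<Delta>loc i \<omega>\<bar>) \<in> borel_measurable M"
    using remainders_meas[OF assms(1)] \<Delta>loc_measurable[OF assms(2), THEN \<S>_meas] by measurable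
  consider "D = \<Delta>" | e where "e \<in> {1..N}" "D = \<Delta>loc e" using assms(1) by (auto simp: remainders_def)
  then have "integrable M (\<lambda>\<omega>. \<bar>D \<omega> - \<Delta>loc i \<omega>\<bar>) \<and> expectation (\<lambda>\<omega>. \<bar>D \<omega> - \<Delta>loc i \<omega>\<bar>) \<le> 2 * d"
  proof cases
    case 1
    then show ?thesis using \<Delta>loc_diff[OF assms(2)] c_d_nonneg by auto
  next
    case 2
    let ?h = "\<lambda>\<omega>. \<bar>\<Delta> \<omega> - \<Delta>loc i \<omega>\<bar> + \<bar>\<Delta> \<omega> - \<Delta>loc e \<omega>\<bar>"
    have h: "integrable M ?h" "expectation ?h \<le> 2 * d"
      using \<Delta>loc_diff[OF assms(2)] \<Delta>loc_diff[OF 2(1)] by auto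
    have "\<bar>\<bar>D \<omega> - \<Delta>loc i \<omega>\<bar>\<bar> \<le> ?h \<omega>" for \<omega> using 2 by auto
    from dominated(1,3)[OF m h(1) this] h(2) show ?thesis by simp
  qed
  then show "integrable M (\<lambda>\<omega>. \<bar>D \<omega> - \<Delta>loc i \<omega>\<bar>)" "expectation (\<lambda>\<omega>. \<bar>D \<omega> - \<Delta>loc i \<omega>\<bar>) \<le> 2 * d" by auto
qed

lemma W_diff: "finite J \<Longrightarrow> W J \<omega> = W (J - A) \<omega> + W (J \<inter> A) \<omega>"
  unfolding W_def by (metis sum.Int_Diff add.commute)

lemma W_abs_le: "finite A \<Longrightarrow> I \<subseteq> A \<Longrightarrow> \<bar>W I \<omega>\<bar> \<le> (\<Sum>b\<in>A. \<bar>\<xi> b \<omega>\<bar>)"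
  unfolding W_def by (intro order_trans[OF sum_abs sum_mono2]) auto

text \<open>If the local size \<open>Y\<close> at most doubles from level \<open>i\<close> to \<open>i + 1\<close>, all arguments of \<open>f\<close> lie
  within \<open>3 Y\<^sub>i\<close> of \<open>U\<^sub>i\<^sub>+\<^sub>1\<close>, while \<open>Y\<^sub>i\<close> and \<open>U\<^sub>i\<^sub>+\<^sub>1\<close> are separated by a gap. If it doubles at every
  level, then the last \<open>Y\<close> exceeds \<open>1\<close>.\<close>

lemma increment_compare:
  assumes tf: "test_function f f' osc" and J: "J \<subseteq> {1..N}" and j: "j \<in> {1..N}"
  shows "\<bar>(f (W J \<omega> + D) - f (W J \<omega> + D - s)) - (f (U J j 2 \<omega>) - f (U J j 2 \<omega> - s))\<bar>
    \<le> 4 * \<bar>D - \<Delta>loc j \<omega>\<bar> + (\<Sum>i=1..k. 2 * (\<bar>s\<bar> * osc (U J j (Suc i) \<omega>) (3 * Y j s i \<omega>)))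
      + 4 * (\<bar>s\<bar> * Y j s (Suc k) \<omega>)"
proof -
  have lip: "\<bar>f x - f y\<bar> \<le> 2 * \<bar>x - y\<bar>" for x y using tf by (auto simp: test_function_def)
  have sec: "\<bar>f x - f y - (x - y) * f' w\<bar> \<le> \<bar>x - y\<bar> * osc v r"
    if "\<bar>x - v\<bar> \<le> r" "\<bar>y - v\<bar> \<le> r" "\<bar>w - v\<bar> \<le> r" for x y v r w
    using tf that by (auto simp: test_function_def)
  have osc0: "0 \<le> osc v r" if "r \<ge> 0" for v r using tf that by (auto simp: test_function_def)
  define Ts where "Ts = W J \<omega> + \<Delta>loc j \<omega>"
  let ?\<Theta> = "\<lambda>x. f x - f (x - s)"
  have Y0: "0 \<le> Y j s i \<omega>" "\<beta> \<le> Y j s i \<omega>" "\<bar>s\<bar> \<le> Y j s i \<omega>" for i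
  proof -
    have "0 \<le> (\<Sum>b\<in>win i j. \<bar>\<xi> b \<omega>\<bar>)" by (simp add: sum_nonneg)
    then show "0 \<le> Y j s i \<omega>" "\<beta> \<le> Y j s i \<omega>" "\<bar>s\<bar> \<le> Y j s i \<omega>" using \<beta> unfolding Y_def by linarith+
  qed
  have fin: "finite J" using J finite_subset by blast
  have sum0: "0 \<le> 2 * (\<bar>s\<bar> * osc (U J j (Suc i) \<omega>) (3 * Y j s i \<omega>))" for i
    using osc0 Y0(1)[of i] by simp
  have "\<bar>?\<Theta> Ts - ?\<Theta> (U J j 2 \<omega>)\<bar> \<le> (\<Sum>i=1..k. 2 * (\<bar>s\<bar> * osc (U J j (Suc i) \<omega>) (3 * Y j s i \<omega>)))
      + 4 * (\<bar>s\<bar> * Y j s (Suc k) \<omega>)"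
  proof (cases "\<exists>i\<in>{1..k}. Y j s (Suc i) \<omega> \<le> 2 * Y j s i \<omega>")
    case True
    then obtain i where i: "i \<in> {1..k}" "Y j s (Suc i) \<omega> \<le> 2 * Y j s i \<omega>" by blast
    let ?U = "U J j (Suc i) \<omega>" and ?Y = "Y j s i \<omega>"
    have near: "\<bar>x - ?U\<bar> \<le> 2 * ?Y" if "x = Ts \<or> x = U J j 2 \<omega>" for x
    proof -
      have "\<exists>I\<subseteq>win (Suc i) j. x - ?U = W I \<omega>"
      proof -
        have "Ts - ?U = W (J \<inter> win (Suc i) j) \<omega>"
          using W_diff[OF fin, of \<omega> "win (Suc i) j"] by (simp add: Ts_def U_def)
        moreover have "U J j 2 \<omega> - ?U = W ((J - win 2 j) \<inter> win (Suc i) j) \<omega>"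
        proof -
          have "J - win 2 j - win (Suc i) j = J - win (Suc i) j"
            using win_mono[of 2 "Suc i" j] i(1) by auto
          then show ?thesis using W_diff[of "J - win 2 j" \<omega> "win (Suc i) j"] fin by (simp add: U_def)
        qed
        ultimately show ?thesis using that by (metis inf_le2)
      qed
      then obtain I where I: "I \<subseteq> win (Suc i) j" "x - ?U = W I \<omega>" by blast
      have "\<bar>x - ?U\<bar> \<le> (\<Sum>b\<in>win (Suc i) j. \<bar>\<xi> b \<omega>\<bar>)" using W_abs_le[OF _ I(1)] I(2) by simp
      also have "\<dots> \<le> Y j s (Suc i) \<omega>" using \<beta> by (simp add: Y_def)
      finally show ?thesis using i(2) by simp
    qed
    \<comment> \<open>The increments at \<open>Ts\<close> and at \<open>U J j 2\<close> are both
      compared with the same product \<open>s * f' ?U\<close>. Their arguments are within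
      \<open>2 * ?Y\<close> of the centre, and the shift adds at most
      \<open>\<bar>s\<bar> \<le> ?Y\<close>.\<close>
    have b: "\<bar>?\<Theta> x - s * f' ?U\<bar> \<le> \<bar>s\<bar> * osc ?U (3 * ?Y)" if "x = Ts \<or> x = U J j 2 \<omega>" for x
      using sec[of x ?U "3 * ?Y" "x - s" ?U] near[OF that] Y0[of i] by simp
    have "\<bar>?\<Theta> Ts - ?\<Theta> (U J j 2 \<omega>)\<bar> \<le> 2 * (\<bar>s\<bar> * osc ?U (3 * ?Y))"
      using b[of Ts] b[of "U J j 2 \<omega>"] by simp
    also have "\<dots> \<le> (\<Sum>i=1..k. 2 * (\<bar>s\<bar> * osc (U J j (Suc i) \<omega>) (3 * Y j s i \<omega>)))"
      using i(1) sum0 by (intro member_le_sum[where f="\<lambda>i. 2 * (\<bar>s\<bar> * osc (U J j (Suc i) \<omega>) (3 * Y j s i \<omega>))"]) auto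
    finally show ?thesis using Y0(1)[of "Suc k"] by (simp add: add_increasing2)
  next
    case False
    have "2 ^ i * \<beta> \<le> Y j s (Suc i) \<omega>" if "i \<le> k" for i
      using that
    proof (induction i)
      case 0
      then show ?case using Y0 by simp
    next
      case (Suc i)
      then have "2 * Y j s (Suc i) \<omega> < Y j s (Suc (Suc i)) \<omega>" using False by force
      then show ?case using Suc by simp
    qed
    \<comment> \<open>At this size the plain Lipschitz bound \<open>4 * \<bar>s\<bar>\<close> is
      affordable, since it is at most \<open>4 * (\<bar>s\<bar> * Y)\<close>.\<close>
    then have "1 \<le> Y j s (Suc k) \<omega>" using \<beta>(3) by (meson order_refl order_trans)
    then have "\<bar>s\<bar> * 1 \<le> \<bar>s\<bar> * Y j s (Suc k) \<omega>" by (intro mult_left_mono) auto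
    moreover have "\<bar>?\<Theta> Ts - ?\<Theta> (U J j 2 \<omega>)\<bar> \<le> 4 * \<bar>s\<bar>"
      using lip[of Ts "Ts - s"] lip[of "U J j 2 \<omega>" "U J j 2 \<omega> - s"] by simp
    moreover have "0 \<le> (\<Sum>i=1..k. 2 * (\<bar>s\<bar> * osc (U J j (Suc i) \<omega>) (3 * Y j s i \<omega>)))"
      using sum0 by (rule sum_nonneg)
    ultimately show ?thesis by linarith
  qed
  moreover have "\<bar>?\<Theta> (W J \<omega> + D) - ?\<Theta> Ts\<bar> \<le> 4 * \<bar>D - \<Delta>loc j \<omega>\<bar>"
    using lip[of "W J \<omega> + D" Ts] lip[of "W J \<omega> + D - s" "Ts - s"] by (simp add: Ts_def)
  ultimately show ?thesis by linarith
qed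


section \<open>From increments of \<open>f\<close> to the derivative, for one summand\<close>

lemma Y_bounds:
  assumes "i \<le> Suc k"
  shows "0 \<le> Y j s i \<omega>" "Y j s i \<omega> \<le> \<beta> + \<bar>s\<bar> + S j \<omega>"
proof -
  show "0 \<le> Y j s i \<omega>" using \<beta> by (simp add: Y_def sum_nonneg add_nonneg_nonneg)
  have "(\<Sum>b\<in>win i j. \<bar>\<xi> b \<omega>\<bar>) \<le> S j \<omega>"
    unfolding S_def using win_mono[OF assms] by (intro sum_mono2) auto
  then show "Y j s i \<omega> \<le> \<beta> + \<bar>s\<bar> + S j \<omega>" by (simp add: Y_def)
qed

lemma Y_meas:
  assumes "s \<in> borel_measurable (\<S> (win i j))"
  shows "(\<lambda>\<omega>. Y j (s \<omega>) i \<omega>) \<in> borel_measurable (\<S> (win i j))"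
proof -
  have "(\<lambda>\<omega>. \<Sum>b\<in>win i j. \<bar>\<xi> b \<omega>\<bar>) \<in> borel_measurable (\<S> (win i j))"
    using win_sub by (intro borel_measurable_sum borel_measurable_abs \<xi>_meas) blast+
  then show ?thesis unfolding Y_def using assms by measurable
qed

text \<open>\<open>a\<close> and \<open>y\<close> see only \<open>win i j\<close>, the centre only
  the complement of the next window. Decoupling freezes the random radius, and for a constant radius
  \<open>H\<close> applies; as \<open>H\<close> is affine in \<open>r\<close>, integrating over the
  radius brings in no more than the expectation of \<open>a * y\<close>. The last bracket is the
  price for an unbounded \<open>a\<close>, whose majorant \<open>4 * a\<close> is truncated at
  \<open>t\<close>.\<close>

lemma expectation_osc:
  assumes tf: "test_function f f' osc" and J: "J \<subseteq> {1..N}" and j: "j \<in> {1..N}" and i: "i \<le> k"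
    and a: "a \<in> borel_measurable (\<S> (win i j))" "\<And>\<omega>. 0 \<le> a \<omega>"
    and y: "y \<in> borel_measurable (\<S> (win i j))" "\<And>\<omega>. 0 \<le> y \<omega>"
    and int: "integrable M a" "integrable M (\<lambda>\<omega>. a \<omega> * y \<omega>)"
    and H: "\<And>r. 0 \<le> r \<Longrightarrow> expectation (\<lambda>\<omega>. osc (U J j (Suc i) \<omega>) r) \<le> c0 + c1 * r"
    and t: "t \<ge> 0"
  shows "integrable M (\<lambda>\<omega>. a \<omega> * osc (U J j (Suc i) \<omega>) (3 * y \<omega>))"
    and "expectation (\<lambda>\<omega>. a \<omega> * osc (U J j (Suc i) \<omega>) (3 * y \<omega>))
      \<le> c0 * expectation a + 3 * c1 * expectation (\<lambda>\<omega>. a \<omega> * y \<omega>)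
        + (2 * t * c + 8 * expectation (\<lambda>\<omega>. a \<omega> * of_bool (t < 4 * a \<omega>)))"
proof -
  note tfD = test_functionD[OF tf]
  define h where "h = (\<lambda>(z :: real \<times> real, u). fst z * osc u (3 * snd z))"
  define Z where "Z = (\<lambda>\<omega>. (a \<omega>, y \<omega>))"
  have subs: "subalgebra M (\<S> (win i j))" "subalgebra M (\<S> ({1..N} - win (Suc i) j))"
    using \<S>_subalgebra by auto
  have Z: "Z \<in> measurable (\<S> (win i j)) (borel \<Otimes>\<^sub>M borel)" unfolding Z_def using a y by measurable
  have Um: "U J j (Suc i) \<in> borel_measurable (\<S> ({1..N} - win (Suc i) j))"
    using i by (intro U_meas J j) auto
  have h: "h \<in> borel_measurable ((borel \<Otimes>\<^sub>M borel) \<Otimes>\<^sub>M borel)"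
  proof -
    have "(\<lambda>x :: (real \<times> real) \<times> real. (\<lambda>(v, r). osc v r) (snd x, 3 * snd (fst x))) \<in> borel_measurable ((borel \<Otimes>\<^sub>M borel) \<Otimes>\<^sub>M borel)"
      by (rule measurable_compose[OF _ tfD(8)]) measurable
    then show ?thesis unfolding h_def case_prod_beta by (intro borel_measurable_times) auto
  qed
  have hG: "\<bar>h (z, u)\<bar> \<le> 4 * \<bar>fst z\<bar>" for z u
    using mult_left_mono[OF tfD(6)[of u "3 * snd z"], of "\<bar>fst z\<bar>"] by (simp add: h_def abs_mult mult.commute)
  note meas = decoupled_measurable[OF subs Z Um h]
  have eqh: "h (Z \<omega>, U J j (Suc i) \<omega>') = a \<omega> * osc (U J j (Suc i) \<omega>') (3 * y \<omega>)" for \<omega> \<omega>'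
    by (simp add: h_def Z_def)
  have osc_bd: "a \<omega> * osc v r \<le> 4 * a \<omega>" for \<omega> v r
    using mult_left_mono[OF tfD(6)[of v r] a(2)[of \<omega>]] a(2)[of \<omega>] mult_left_mono[OF abs_ge_self[of "osc v r"] a(2)[of \<omega>]] by linarith
  have osc_0: "0 \<le> a \<omega> * osc v (3 * y \<omega>)" for \<omega> v using tfD(7) a(2) y(2) by simp
  have m1: "(\<lambda>\<omega>. a \<omega> * osc (U J j (Suc i) \<omega>) (3 * y \<omega>)) \<in> borel_measurable M"
    using meas(1) unfolding eqh .
  show "integrable M (\<lambda>\<omega>. a \<omega> * osc (U J j (Suc i) \<omega>) (3 * y \<omega>))"
    by (rule dominated(1)[OF m1, of "\<lambda>\<omega>. 4 * a \<omega>"]) (use int osc_bd osc_0 in auto)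
  have "\<bar>(\<integral>\<omega>. h (Z \<omega>, U J j (Suc i) \<omega>) \<partial>M) - (\<integral>x. (\<integral>y. h (Z x, U J j (Suc i) y) \<partial>M) \<partial>M)\<bar>
     \<le> 2 * t * c + 2 * (\<integral>\<omega>. 4 * \<bar>fst (Z \<omega>)\<bar> * of_bool (t < 4 * \<bar>fst (Z \<omega>)\<bar>) \<partial>M)"
  proof (rule decoupled_integral_truncated[OF subs decoupled_win[OF j i] Z Um h, where G="\<lambda>z. 4 * \<bar>fst z\<bar>"])
    show "(\<lambda>z :: real \<times> real. 4 * \<bar>fst z\<bar>) \<in> borel_measurable (borel \<Otimes>\<^sub>M borel)" by measurable
    show "integrable M (\<lambda>\<omega>. 4 * \<bar>fst (Z \<omega>)\<bar>)" using int by (simp add: Z_def)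
  qed (use hG t in auto)
  also have "(\<integral>\<omega>. 4 * \<bar>fst (Z \<omega>)\<bar> * of_bool (t < 4 * \<bar>fst (Z \<omega>)\<bar>) \<partial>M)
    = 4 * expectation (\<lambda>\<omega>. a \<omega> * of_bool (t < 4 * a \<omega>))"
    using a(2) by (simp add: Z_def mult.assoc)
  finally have 1: "\<bar>expectation (\<lambda>\<omega>. a \<omega> * osc (U J j (Suc i) \<omega>) (3 * y \<omega>))
      - (\<integral>x. (\<integral>\<omega>. a x * osc (U J j (Suc i) \<omega>) (3 * y x) \<partial>M) \<partial>M)\<bar>
      \<le> 2 * t * c + 8 * expectation (\<lambda>\<omega>. a \<omega> * of_bool (t < 4 * a \<omega>))"
    unfolding eqh by simp
  have m2: "(\<lambda>x. \<integral>\<omega>. a x * osc (U J j (Suc i) \<omega>) (3 * y x) \<partial>M) \<in> borel_measurable M"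
    using meas(2) unfolding eqh by measurable
  have bd: "0 \<le> (\<integral>\<omega>. a x * osc (U J j (Suc i) \<omega>) (3 * y x) \<partial>M)"
    "(\<integral>\<omega>. a x * osc (U J j (Suc i) \<omega>) (3 * y x) \<partial>M) \<le> c0 * a x + 3 * c1 * (a x * y x)" for x
  proof -
    show "0 \<le> (\<integral>\<omega>. a x * osc (U J j (Suc i) \<omega>) (3 * y x) \<partial>M)" by (intro Bochner_Integration.integral_nonneg osc_0)
    have "a x * expectation (\<lambda>\<omega>. osc (U J j (Suc i) \<omega>) (3 * y x)) \<le> a x * (c0 + c1 * (3 * y x))"
      using a(2) y(2) by (intro mult_left_mono H) auto
    then show "(\<integral>\<omega>. a x * osc (U J j (Suc i) \<omega>) (3 * y x) \<partial>M) \<le> c0 * a x + 3 * c1 * (a x * y x)"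
      by (simp add: algebra_simps)
  qed
  have int2: "integrable M (\<lambda>x. c0 * a x + 3 * c1 * (a x * y x))" using int by auto
  have "\<bar>\<integral>x. (\<integral>\<omega>. a x * osc (U J j (Suc i) \<omega>) (3 * y x) \<partial>M) \<partial>M\<bar> \<le> expectation (\<lambda>x. c0 * a x + 3 * c1 * (a x * y x))"
    by (rule dominated(2)[OF m2 int2]) (use bd in auto)
  also have "\<dots> = c0 * expectation a + 3 * c1 * expectation (\<lambda>\<omega>. a \<omega> * y \<omega>)" using int by simp
  finally show "expectation (\<lambda>\<omega>. a \<omega> * osc (U J j (Suc i) \<omega>) (3 * y \<omega>))
      \<le> c0 * expectation a + 3 * c1 * expectation (\<lambda>\<omega>. a \<omega> * y \<omega>)
        + (2 * t * c + 8 * expectation (\<lambda>\<omega>. a \<omega> * of_bool (t < 4 * a \<omega>)))"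
    using 1 by linarith
qed

text \<open>For a constant shift the increment at \<open>U J j 2\<close> is carried back to the full
  sum, where the secant is taken at the argument of \<open>f'\<close> itself. The factor in front of
  \<open>s\<close> thereby becomes the same for all \<open>j\<close>, so that the covariances can be
  summed.\<close>

lemma const_increment:
  assumes tf: "test_function f f' osc" and J: "J \<subseteq> {1..N}" and j: "j \<in> {1..N}" and D: "D \<in> remainders"
    and H: "\<And>i r. i \<in> {2..Suc k} \<Longrightarrow> 0 \<le> r \<Longrightarrow> expectation (\<lambda>\<omega>. osc (U J j i \<omega>) r) \<le> c0 + c1 * r"
    and HT: "\<And>r. 0 \<le> r \<Longrightarrow> expectation (\<lambda>\<omega>. osc (W J \<omega> + D \<omega>) r) \<le> c0 + c1 * r"
    and c01: "0 \<le> c0" "0 \<le> c1"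
  shows "\<bar>expectation (\<lambda>\<omega>. f (U J j 2 \<omega>) - f (U J j 2 \<omega> - s)) - s * expectation (\<lambda>\<omega>. f' (W J \<omega> + D \<omega>))\<bar>
    \<le> 8 * d + 2 * (L * (\<bar>s\<bar> * (c0 + 3 * c1 * (\<bar>s\<bar> + 2 * L * \<beta>) + 8 * c))) + 4 * (\<bar>s\<bar> * (\<bar>s\<bar> + 2 * L * \<beta>))
      + \<bar>s\<bar> * (c0 + c1 * \<bar>s\<bar>)"
proof -
  note tfD = test_functionD[OF tf]
  let ?T = "\<lambda>\<omega>. W J \<omega> + D \<omega>" and ?U = "U J j 2"
  let ?A = "\<lambda>\<omega>. f (?T \<omega>) - f (?T \<omega> - s)" and ?B = "\<lambda>\<omega>. f (?U \<omega>) - f (?U \<omega> - s)"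
  have Tm: "?T \<in> borel_measurable M" using W_measM[OF J] remainders_meas[OF D] by measurable
  have Um: "?U \<in> borel_measurable M" using U_measM[OF J j] k_gap by auto
  have ABm: "?A \<in> borel_measurable M" "?B \<in> borel_measurable M"
    using Tm Um tfD(1) by measurable
  have f'm: "(\<lambda>\<omega>. f' (?T \<omega>)) \<in> borel_measurable M" using Tm tfD(2) by measurable
  have b6: "\<bar>f x - f y\<bar> \<le> 6" for x y using tfD(3)[of x] tfD(3)[of y] by linarith
  have ABi: "integrable M ?A" "integrable M ?B" "integrable M (\<lambda>\<omega>. f' (?T \<omega>))"
    using ABm f'm b6 tfD(4) by (auto intro!: integrable_const_bound[of ?A 6] integrable_const_bound[of ?B 6]
        integrable_const_bound[of "\<lambda>\<omega>. f' (?T \<omega>)" 2])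
  have EY: "integrable M (\<lambda>\<omega>. Y j s i \<omega>)" "expectation (\<lambda>\<omega>. Y j s i \<omega>) \<le> \<bar>s\<bar> + 2 * L * \<beta>" if "i \<le> Suc k" for i
  proof -
    have m: "(\<lambda>\<omega>. Y j s i \<omega>) \<in> borel_measurable M"
      using Y_meas[of "\<lambda>_. s" i j] \<S>_meas by simp
    have h: "integrable M (\<lambda>\<omega>. \<beta> + \<bar>s\<bar> + S j \<omega>)" using moment_S(1) by auto
    have b: "\<bar>Y j s i \<omega>\<bar> \<le> \<beta> + \<bar>s\<bar> + S j \<omega>" for \<omega> using Y_bounds[OF that, of j s \<omega>] by simp
    show "integrable M (\<lambda>\<omega>. Y j s i \<omega>)" by (rule dominated(1)[OF m h b])
    have "\<bar>expectation (\<lambda>\<omega>. Y j s i \<omega>)\<bar> \<le> expectation (\<lambda>\<omega>. \<beta> + \<bar>s\<bar> + S j \<omega>)" by (rule dominated(2)[OF m h b])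
    also have "\<dots> \<le> \<beta> + \<bar>s\<bar> + L * \<beta>" using moment_S[of j] by (simp add: prob_space)
    also have "\<dots> \<le> \<bar>s\<bar> + 2 * L * \<beta>" using mult_right_mono[OF L(1), of \<beta>] \<beta> by simp
    finally show "expectation (\<lambda>\<omega>. Y j s i \<omega>) \<le> \<bar>s\<bar> + 2 * L * \<beta>" by simp
  qed
  have osc_i: "integrable M (\<lambda>\<omega>. \<bar>s\<bar> * osc (U J j (Suc i) \<omega>) (3 * Y j s i \<omega>))"
    "expectation (\<lambda>\<omega>. \<bar>s\<bar> * osc (U J j (Suc i) \<omega>) (3 * Y j s i \<omega>)) \<le> \<bar>s\<bar> * (c0 + 3 * c1 * (\<bar>s\<bar> + 2 * L * \<beta>) + 8 * c)"
    if "i \<in> {1..k}" for i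
  proof -
    have ik: "i \<le> k" "Suc i \<in> {2..Suc k}" "i \<le> Suc k" using that by auto
    \<comment> \<open>With the constant weight \<open>\<bar>s\<bar>\<close> the level
      \<open>t = 4 * \<bar>s\<bar>\<close> is never exceeded strictly, so the tail term
      vanishes.\<close>
    note eo = expectation_osc[OF tf J j ik(1), of "\<lambda>_. \<bar>s\<bar>" "\<lambda>\<omega>. Y j s i \<omega>" c0 c1 "4 * \<bar>s\<bar>"]
    have ym: "(\<lambda>\<omega>. Y j s i \<omega>) \<in> borel_measurable (\<S> (win i j))" using Y_meas[of "\<lambda>_. s"] by simp
    show "integrable M (\<lambda>\<omega>. \<bar>s\<bar> * osc (U J j (Suc i) \<omega>) (3 * Y j s i \<omega>))"
      using EY[OF ik(3)] H[OF ik(2)] Y_bounds(1)[OF ik(3)] ym by (intro eo(1)) auto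
    have "expectation (\<lambda>\<omega>. \<bar>s\<bar> * osc (U J j (Suc i) \<omega>) (3 * Y j s i \<omega>)) \<le>
      c0 * expectation (\<lambda>_. \<bar>s\<bar>) + 3 * c1 * expectation (\<lambda>\<omega>. \<bar>s\<bar> * Y j s i \<omega>)
      + (2 * (4 * \<bar>s\<bar>) * c + 8 * expectation (\<lambda>\<omega>. \<bar>s\<bar> * of_bool (4 * \<bar>s\<bar> < 4 * \<bar>s\<bar>)))"
      using EY[OF ik(3)] H[OF ik(2)] Y_bounds(1)[OF ik(3)] ym by (intro eo(2)) auto
    also have "\<dots> = c0 * \<bar>s\<bar> + 3 * c1 * (\<bar>s\<bar> * expectation (\<lambda>\<omega>. Y j s i \<omega>)) + 8 * \<bar>s\<bar> * c" by (simp add: prob_space)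
    also have "\<dots> \<le> c0 * \<bar>s\<bar> + 3 * c1 * (\<bar>s\<bar> * (\<bar>s\<bar> + 2 * L * \<beta>)) + 8 * \<bar>s\<bar> * c"
      using EY(2)[OF ik(3)] c01 by (intro add_mono mult_left_mono) auto
    finally show "expectation (\<lambda>\<omega>. \<bar>s\<bar> * osc (U J j (Suc i) \<omega>) (3 * Y j s i \<omega>)) \<le> \<bar>s\<bar> * (c0 + 3 * c1 * (\<bar>s\<bar> + 2 * L * \<beta>) + 8 * c)"
      by (simp add: algebra_simps del: abs_mult_self_eq)
  qed
  have s1: "\<bar>expectation ?A - expectation ?B\<bar> \<le> 8 * d + 2 * (L * (\<bar>s\<bar> * (c0 + 3 * c1 * (\<bar>s\<bar> + 2 * L * \<beta>) + 8 * c))) + 4 * (\<bar>s\<bar> * (\<bar>s\<bar> + 2 * L * \<beta>))"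
  proof -
    let ?h = "\<lambda>\<omega>. 4 * \<bar>D \<omega> - \<Delta>loc j \<omega>\<bar> + (\<Sum>i=1..k. 2 * (\<bar>s\<bar> * osc (U J j (Suc i) \<omega>) (3 * Y j s i \<omega>)))
      + 4 * (\<bar>s\<bar> * Y j s (Suc k) \<omega>)"
    have hi: "integrable M ?h" using osc_i(1) EY(1)[of "Suc k"] remainder_diff(1)[OF D j] 
      by (intro Bochner_Integration.integrable_add Bochner_Integration.integrable_sum integrable_mult_right) auto
    have "\<bar>expectation (\<lambda>\<omega>. ?A \<omega> - ?B \<omega>)\<bar> \<le> expectation ?h"
      by (rule dominated(2)[OF _ hi]) (use ABm increment_compare[OF tf J j] in auto)
    also have "expectation ?h = 4 * expectation (\<lambda>\<omega>. \<bar>D \<omega> - \<Delta>loc j \<omega>\<bar>)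
      + (\<Sum>i=1..k. 2 * expectation (\<lambda>\<omega>. \<bar>s\<bar> * osc (U J j (Suc i) \<omega>) (3 * Y j s i \<omega>))) + 4 * (\<bar>s\<bar> * expectation (\<lambda>\<omega>. Y j s (Suc k) \<omega>))"
      using osc_i(1) EY(1)[of "Suc k"] remainder_diff(1)[OF D j]
      by (subst expectation_majorant) auto
    also have "\<dots> \<le> 4 * (2 * d) + (\<Sum>i=1..k. 2 * (\<bar>s\<bar> * (c0 + 3 * c1 * (\<bar>s\<bar> + 2 * L * \<beta>) + 8 * c))) + 4 * (\<bar>s\<bar> * (\<bar>s\<bar> + 2 * L * \<beta>))"
      using remainder_diff(2)[OF D j] osc_i(2) EY(2)[of "Suc k"] by (intro add_mono sum_mono mult_left_mono) auto
    also have "(\<Sum>i=1..k. 2 * (\<bar>s\<bar> * (c0 + 3 * c1 * (\<bar>s\<bar> + 2 * L * \<beta>) + 8 * c)))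
      = 2 * (real k * (\<bar>s\<bar> * (c0 + 3 * c1 * (\<bar>s\<bar> + 2 * L * \<beta>) + 8 * c)))" by simp
    also have "\<dots> \<le> 2 * (L * (\<bar>s\<bar> * (c0 + 3 * c1 * (\<bar>s\<bar> + 2 * L * \<beta>) + 8 * c)))"
      using L c01 c_d_nonneg \<beta> by (intro mult_left_mono mult_right_mono mult_nonneg_nonneg add_nonneg_nonneg) auto
    finally show ?thesis using ABi by simp
  qed
  have s2: "\<bar>expectation ?A - s * expectation (\<lambda>\<omega>. f' (?T \<omega>))\<bar> \<le> \<bar>s\<bar> * (c0 + c1 * \<bar>s\<bar>)"
  proof -
    have om: "(\<lambda>\<omega>. \<bar>s\<bar> * osc (?T \<omega>) \<bar>s\<bar>) \<in> borel_measurable M"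
      using measurable_compose[OF measurable_Pair[OF Tm measurable_const[of "\<bar>s\<bar>"]] tfD(8)] by simp
    have oi: "integrable M (\<lambda>\<omega>. \<bar>s\<bar> * osc (?T \<omega>) \<bar>s\<bar>)"
      by (rule dominated(1)[OF om, of "\<lambda>_. \<bar>s\<bar> * 4"]) (use tfD(6) in \<open>auto simp: abs_mult intro!: mult_left_mono\<close>)
    have "\<bar>expectation (\<lambda>\<omega>. ?A \<omega> - s * f' (?T \<omega>))\<bar> \<le> expectation (\<lambda>\<omega>. \<bar>s\<bar> * osc (?T \<omega>) \<bar>s\<bar>)"
    proof (rule dominated(2)[OF _ oi])
      show "\<bar>?A \<omega> - s * f' (?T \<omega>)\<bar> \<le> \<bar>s\<bar> * osc (?T \<omega>) \<bar>s\<bar>" for \<omega>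
        using tfD(9)[of "?T \<omega>" "?T \<omega>" "\<bar>s\<bar>" "?T \<omega> - s" "?T \<omega>"] by simp
    qed (use ABm f'm in measurable)
    also have "\<dots> \<le> \<bar>s\<bar> * (c0 + c1 * \<bar>s\<bar>)" using HT[of "\<bar>s\<bar>"] by (simp add: mult_left_mono)
    finally show ?thesis using ABi by simp
  qed
  show ?thesis using s1 s2 by linarith
qed


text \<open>The sources in this order: localisation of the remainder, constant part and linear part
  of the oscillation bound \<open>c0 + c1 * r\<close>, third moments, decoupling.\<close>

definition term_error :: "real \<Rightarrow> real \<Rightarrow> real" where
  "term_error c0 c1 = \<beta> * d + L\<^sup>2 * c0 * \<beta>\<^sup>2 + L ^ 3 * c1 * \<beta> ^ 3 + L ^ 3 * \<beta> ^ 3 + L\<^sup>2 * c"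

text \<open>Lower powers of \<open>L\<close> are raised to those in \<open>term_error\<close>. The
  largest coefficient is then collected by \<open>L ^ 3 * \<beta> ^ 3\<close>, namely
  \<open>6 + 32 + 12 + 8 + 12 = 70\<close>.\<close>

lemma term_error_assemble:
  assumes "0 \<le> c0" "0 \<le> c1"
  shows "4 * (\<beta> * d) + (6 * c + 6 * \<beta> ^ 3)
     + (8 * (\<beta> * d) + 2 * (L * (c0 * (L * \<beta>\<^sup>2) + 3 * c1 * (3 * (L\<^sup>2 * \<beta> ^ 3)) + (8 * c + 16 * (L\<^sup>2 * \<beta> ^ 3)))) + 12 * (L\<^sup>2 * \<beta> ^ 3))
     + (4 * c + 8 * (L\<^sup>2 * \<beta> ^ 3))
     + (8 * (\<beta> * d) + 2 * (L * (c0 * (L * \<beta>\<^sup>2) + 9 * c1 * (L\<^sup>2 * \<beta> ^ 3) + 8 * c * (L * \<beta>\<^sup>2))) + 12 * (L\<^sup>2 * \<beta> ^ 3)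
        + (c0 * (L * \<beta>\<^sup>2) + c1 * (L\<^sup>2 * \<beta> ^ 3)))
    \<le> 70 * term_error c0 c1"
proof -
  have L2: "L \<le> L\<^sup>2" "1 \<le> L\<^sup>2" "L\<^sup>2 \<le> L ^ 3" "1 \<le> L ^ 3"
    using L(1) by (auto simp: power_increasing self_le_power one_le_power)
  have b3: "0 \<le> \<beta> ^ 3" "0 \<le> \<beta>\<^sup>2" "\<beta>\<^sup>2 \<le> 1" using \<beta> by (auto simp: power_le_one)
  have e: "6 * c \<le> 6 * (L\<^sup>2 * c)" "4 * c \<le> 4 * (L\<^sup>2 * c)" "16 * (L * c) \<le> 16 * (L\<^sup>2 * c)"
    using L2 c_d_nonneg by (auto intro!: mult_right_mono simp: mult_le_cancel_right1)
  have e2: "L\<^sup>2 * c * \<beta>\<^sup>2 \<le> L\<^sup>2 * c" using b3 c_d_nonneg L by (intro mult_left_le) auto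
  have e3: "\<beta> ^ 3 \<le> L ^ 3 * \<beta> ^ 3" "L\<^sup>2 * \<beta> ^ 3 \<le> L ^ 3 * \<beta> ^ 3"
    using b3 L2 by (auto intro!: mult_right_mono simp: mult_le_cancel_right1)
  have e4: "c0 * (L * \<beta>\<^sup>2) \<le> L\<^sup>2 * c0 * \<beta>\<^sup>2"
  proof -
    have "L * (c0 * \<beta>\<^sup>2) \<le> L\<^sup>2 * (c0 * \<beta>\<^sup>2)" using L2 b3 assms by (intro mult_right_mono) auto
    then show ?thesis by (simp add: mult_ac)
  qed
  have e5: "c1 * (L\<^sup>2 * \<beta> ^ 3) \<le> L ^ 3 * c1 * \<beta> ^ 3"
  proof -
    have "L\<^sup>2 * (c1 * \<beta> ^ 3) \<le> L ^ 3 * (c1 * \<beta> ^ 3)" using L2 b3 assms by (intro mult_right_mono) auto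
    then show ?thesis by (simp add: mult_ac)
  qed
  have nn: "0 \<le> \<beta> * d" "0 \<le> L\<^sup>2 * c0 * \<beta>\<^sup>2" "0 \<le> L ^ 3 * c1 * \<beta> ^ 3" "0 \<le> L ^ 3 * \<beta> ^ 3" "0 \<le> L\<^sup>2 * c"
    using assms b3 L \<beta> c_d_nonneg by auto
  have x1: "L * (c0 * (L * \<beta>\<^sup>2) + 3 * c1 * (3 * (L\<^sup>2 * \<beta> ^ 3)) + (8 * c + 16 * (L\<^sup>2 * \<beta> ^ 3)))
     = L\<^sup>2 * c0 * \<beta>\<^sup>2 + 9 * (L ^ 3 * c1 * \<beta> ^ 3) + 8 * (L * c) + 16 * (L ^ 3 * \<beta> ^ 3)"
    by (simp add: power2_eq_square power3_eq_cube algebra_simps)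
  have x2: "L * (c0 * (L * \<beta>\<^sup>2) + 9 * c1 * (L\<^sup>2 * \<beta> ^ 3) + 8 * c * (L * \<beta>\<^sup>2))
     = L\<^sup>2 * c0 * \<beta>\<^sup>2 + 9 * (L ^ 3 * c1 * \<beta> ^ 3) + 8 * (L\<^sup>2 * c * \<beta>\<^sup>2)"
    by (simp add: power2_eq_square power3_eq_cube algebra_simps)
  show ?thesis unfolding term_error_def x1 x2 using e e2 e3 e4 e5 nn by argo
qed

text \<open>With \<open>s\<close> the part of the sum inside \<open>win 1 j\<close>,
  \<open>f T\<close> is \<open>f (T - s)\<close> plus an increment. The former nearly ignores
  \<open>\<xi> j\<close> and drops out because \<open>\<xi> j\<close> is centred. The increment is
  moved to the separated centre \<open>U J j 2\<close>, the pair of \<open>\<xi> j\<close> and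
  \<open>s\<close> is decoupled from that centre, and the resulting function \<open>F\<close> of a
  constant shift is nearly linear with slope the expectation of \<open>f' T\<close>.\<close>

lemma one_term:
  assumes tf: "test_function f f' osc" and J: "J \<subseteq> {1..N}" and j: "j \<in> {1..N}" and D: "D \<in> remainders"
    and H: "\<And>i r. i \<in> {2..Suc k} \<Longrightarrow> 0 \<le> r \<Longrightarrow> expectation (\<lambda>\<omega>. osc (U J j i \<omega>) r) \<le> c0 + c1 * r"
    and HT: "\<And>r. 0 \<le> r \<Longrightarrow> expectation (\<lambda>\<omega>. osc (W J \<omega> + D \<omega>) r) \<le> c0 + c1 * r"
    and c01: "0 \<le> c0" "0 \<le> c1"
  shows "\<bar>expectation (\<lambda>\<omega>. \<xi> j \<omega> * f (W J \<omega> + D \<omega>))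
     - expectation (\<lambda>\<omega>. \<xi> j \<omega> * W (J \<inter> win 1 j) \<omega>) * expectation (\<lambda>\<omega>. f' (W J \<omega> + D \<omega>))\<bar> \<le> 70 * term_error c0 c1"
proof -
  note tfD = test_functionD[OF tf]
  let ?T = "\<lambda>\<omega>. W J \<omega> + D \<omega>" and ?U = "U J j 2"
  define s where "s = W (J \<inter> win 1 j)"
  define X where "X = (\<lambda>\<omega>. \<bar>\<xi> j \<omega>\<bar>)"
  have fin: "finite J" using J finite_subset by blast
  have \<xi>m: "\<xi> j \<in> borel_measurable M" and Xm: "X \<in> borel_measurable M" using \<xi>_measM[OF j] by (auto simp: X_def)
  have \<xi>S: "\<xi> j \<in> borel_measurable (\<S> (win i j))" for i
    by (rule \<S>_meas_mono[OF \<xi>_measurable[OF j]]) (use win_self[OF j] in auto)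
  have XS: "X \<in> borel_measurable (\<S> (win i j))" for i using \<xi>S[of i] unfolding X_def by measurable
  have s1: "s \<in> borel_measurable (\<S> (win 1 j))" unfolding s_def using J by (intro W_meas) auto
  have sS: "s \<in> borel_measurable (\<S> (win i j))" if "1 \<le> i" for i
    by (rule \<S>_meas_mono[OF s1 win_mono[OF that]])
  have sm: "s \<in> borel_measurable M" using s1 by (rule \<S>_meas)
  have Tm: "?T \<in> borel_measurable M" using W_measM[OF J] remainders_meas[OF D] by measurable
  have Um: "?U \<in> borel_measurable M" using U_measM[OF J j] k_gap by auto
  have X0: "0 \<le> X \<omega>" for \<omega> by (simp add: X_def)
  have XleS: "X \<omega> \<le> S j \<omega>" for \<omega>
    unfolding X_def S_def using win_self[OF j] by (intro member_le_sum[where f="\<lambda>b. \<bar>\<xi> b \<omega>\<bar>"]) auto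
  have sleS: "\<bar>s \<omega>\<bar> \<le> S j \<omega>" for \<omega>
    unfolding s_def S_def using win_mono[of 1 "Suc k" j] by (intro W_abs_le) auto
  have b6: "\<bar>f x - f y\<bar> \<le> 6" for x y using tfD(3)[of x] tfD(3)[of y] by linarith
  have Xi: "integrable M X" "expectation X \<le> \<beta>" using moment1[OF j] by (auto simp: X_def)
  have XSi: "integrable M (\<lambda>\<omega>. X \<omega> * S j \<omega>)" "expectation (\<lambda>\<omega>. X \<omega> * S j \<omega>) \<le> L * \<beta>\<^sup>2"
    using moment_\<xi>S[OF j] by (auto simp: X_def)
  have XSSi: "integrable M (\<lambda>\<omega>. X \<omega> * S j \<omega> * S j \<omega>)" "expectation (\<lambda>\<omega>. X \<omega> * S j \<omega> * S j \<omega>) \<le> L\<^sup>2 * \<beta> ^ 3"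
    using moment_\<xi>SS[OF j] by (auto simp: X_def)
  define a where "a = (\<lambda>\<omega>. X \<omega> * \<bar>s \<omega>\<bar>)"
  have am: "a \<in> borel_measurable M" using Xm sm unfolding a_def by measurable
  have a0: "0 \<le> a \<omega>" for \<omega> using X0 by (simp add: a_def)
  have ale: "a \<omega> \<le> X \<omega> * S j \<omega>" for \<omega> unfolding a_def using sleS X0 by (intro mult_left_mono)
  have ai: "integrable M a" "expectation a \<le> L * \<beta>\<^sup>2"
    using dominated[OF am XSi(1)] ale a0 XSi(2) by fastforce+
  have aS: "integrable M (\<lambda>\<omega>. a \<omega> * S j \<omega>)" "expectation (\<lambda>\<omega>. a \<omega> * S j \<omega>) \<le> L\<^sup>2 * \<beta> ^ 3"
  proof -
    have m: "(\<lambda>\<omega>. a \<omega> * S j \<omega>) \<in> borel_measurable M" using am S_measM by measurable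
    have b: "\<bar>a \<omega> * S j \<omega>\<bar> \<le> X \<omega> * S j \<omega> * S j \<omega>" for \<omega>
      using ale[of \<omega>] a0[of \<omega>] S_nonneg[of j \<omega>] by (simp add: abs_mult mult_right_mono)
    show "integrable M (\<lambda>\<omega>. a \<omega> * S j \<omega>)" "expectation (\<lambda>\<omega>. a \<omega> * S j \<omega>) \<le> L\<^sup>2 * \<beta> ^ 3"
      using dominated[OF m XSSi(1) b] XSSi(2) by auto
  qed
  have aY: "integrable M (\<lambda>\<omega>. a \<omega> * Y j (s \<omega>) i \<omega>)" "expectation (\<lambda>\<omega>. a \<omega> * Y j (s \<omega>) i \<omega>) \<le> 3 * (L\<^sup>2 * \<beta> ^ 3)"
    if "1 \<le> i" "i \<le> Suc k" for i
  proof -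
    have m: "(\<lambda>\<omega>. a \<omega> * Y j (s \<omega>) i \<omega>) \<in> borel_measurable M"
      using am Y_meas[OF sS[OF that(1)], THEN \<S>_meas] by measurable
    have hi: "integrable M (\<lambda>\<omega>. \<beta> * a \<omega> + 2 * (a \<omega> * S j \<omega>))" using ai aS by auto
    have b: "\<bar>a \<omega> * Y j (s \<omega>) i \<omega>\<bar> \<le> \<beta> * a \<omega> + 2 * (a \<omega> * S j \<omega>)" for \<omega>
    proof -
      have "Y j (s \<omega>) i \<omega> \<le> \<beta> + 2 * S j \<omega>" using Y_bounds(2)[OF that(2), of j "s \<omega>" \<omega>] sleS[of \<omega>] by linarith
      then have "a \<omega> * Y j (s \<omega>) i \<omega> \<le> a \<omega> * (\<beta> + 2 * S j \<omega>)" using a0 by (intro mult_left_mono)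
      then show ?thesis using a0[of \<omega>] Y_bounds(1)[OF that(2), of j "s \<omega>" \<omega>] by (simp add: abs_mult algebra_simps)
    qed
    have "expectation (\<lambda>\<omega>. \<beta> * a \<omega> + 2 * (a \<omega> * S j \<omega>)) = \<beta> * expectation a + 2 * expectation (\<lambda>\<omega>. a \<omega> * S j \<omega>)"
      using ai aS by simp
    also have "\<dots> \<le> \<beta> * (L * \<beta>\<^sup>2) + 2 * (L\<^sup>2 * \<beta> ^ 3)" using ai aS \<beta> by (intro add_mono mult_left_mono) auto
    also have "\<beta> * (L * \<beta>\<^sup>2) = L * \<beta> ^ 3" by (simp add: power2_eq_square power3_eq_cube)
    also have "L * \<beta> ^ 3 \<le> L\<^sup>2 * \<beta> ^ 3" using L \<beta> by (intro mult_right_mono) (auto simp: self_le_power)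
    finally have "expectation (\<lambda>\<omega>. \<beta> * a \<omega> + 2 * (a \<omega> * S j \<omega>)) \<le> 3 * (L\<^sup>2 * \<beta> ^ 3)" by simp
    then show "integrable M (\<lambda>\<omega>. a \<omega> * Y j (s \<omega>) i \<omega>)" "expectation (\<lambda>\<omega>. a \<omega> * Y j (s \<omega>) i \<omega>) \<le> 3 * (L\<^sup>2 * \<beta> ^ 3)"
      using dominated[OF m hi b] by auto
  qed
  have atail: "expectation (\<lambda>\<omega>. a \<omega> * of_bool (1 < a \<omega>)) \<le> 2 * (L\<^sup>2 * \<beta> ^ 3)"
  proof -
    have m: "(\<lambda>\<omega>. a \<omega> * of_bool (1 < a \<omega>)) \<in> borel_measurable M" using am by measurable
    have hi: "integrable M (\<lambda>\<omega>. 2 * (a \<omega> * S j \<omega>))" using aS by auto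
    have b: "\<bar>a \<omega> * of_bool (1 < a \<omega>)\<bar> \<le> 2 * (a \<omega> * S j \<omega>)" for \<omega>
    proof -
      have "a \<omega> * of_bool (1 < a \<omega>) \<le> a \<omega> * (X \<omega> + \<bar>s \<omega>\<bar>)"
        unfolding a_def using X0 by (intro tail_product_le) auto
      also have "\<dots> \<le> a \<omega> * (2 * S j \<omega>)" using XleS[of \<omega>] sleS[of \<omega>] a0 by (intro mult_left_mono) auto
      finally show ?thesis using a0[of \<omega>] by simp
    qed
    show ?thesis using dominated(2)[OF m hi b] aS by simp
  qed
  let ?A = "\<lambda>\<omega>. f (?T \<omega>) - f (?T \<omega> - s \<omega>)" and ?B = "\<lambda>\<omega>. f (?U \<omega>) - f (?U \<omega> - s \<omega>)"
  have ABm: "?A \<in> borel_measurable M" "?B \<in> borel_measurable M" "(\<lambda>\<omega>. f (?T \<omega> - s \<omega>)) \<in> borel_measurable M"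
    "(\<lambda>\<omega>. f (?T \<omega>)) \<in> borel_measurable M"
    using Tm Um sm tfD(1) by measurable
  have bi: "integrable M (\<lambda>\<omega>. \<xi> j \<omega> * g \<omega>)" if "g \<in> borel_measurable M" "\<And>\<omega>. \<bar>g \<omega>\<bar> \<le> 6" for g
  proof (rule dominated(1)[of _ "\<lambda>\<omega>. 6 * X \<omega>"])
    show "\<bar>\<xi> j \<omega> * g \<omega>\<bar> \<le> 6 * X \<omega>" for \<omega>
      using mult_left_mono[OF that(2)[of \<omega>], of "\<bar>\<xi> j \<omega>\<bar>"] by (simp add: abs_mult X_def mult.commute)
  qed (use \<xi>m Xi that in auto)
  have b3: "\<bar>f x\<bar> \<le> 6" for x using tfD(3)[of x] by linarith
  have i1: "integrable M (\<lambda>\<omega>. \<xi> j \<omega> * f (?T \<omega>))" and i2: "integrable M (\<lambda>\<omega>. \<xi> j \<omega> * f (?T \<omega> - s \<omega>))"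
    and i3: "integrable M (\<lambda>\<omega>. \<xi> j \<omega> * ?A \<omega>)" and i4: "integrable M (\<lambda>\<omega>. \<xi> j \<omega> * ?B \<omega>)"
    using ABm b3 b6 by (auto intro!: bi)

  have step1: "\<bar>expectation (\<lambda>\<omega>. \<xi> j \<omega> * f (?T \<omega> - s \<omega>))\<bar> \<le> 4 * (\<beta> * d) + (6 * c + 6 * \<beta> ^ 3)"
  proof -
    let ?V = "U J j 1"
    have Vm: "?V \<in> borel_measurable (\<S> ({1..N} - win (Suc 0) j))" using U_meas[OF J j, of 1] by simp
    have VM: "?V \<in> borel_measurable M" using Vm by (rule \<S>_meas)
    have fV: "(\<lambda>\<omega>. f (?V \<omega>)) \<in> borel_measurable M" using VM tfD(1) by measurable
    have iV: "integrable M (\<lambda>\<omega>. \<xi> j \<omega> * f (?V \<omega>))" using fV b3 by (intro bi) auto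
    have "\<bar>expectation (\<lambda>\<omega>. \<xi> j \<omega> * f (?T \<omega> - s \<omega>) - \<xi> j \<omega> * f (?V \<omega>))\<bar> \<le> expectation (\<lambda>\<omega>. 2 * (\<bar>\<xi> j \<omega>\<bar> * \<bar>D \<omega> - \<Delta>loc j \<omega>\<bar>))"
    proof (rule dominated(2))
      show "\<bar>\<xi> j \<omega> * f (?T \<omega> - s \<omega>) - \<xi> j \<omega> * f (?V \<omega>)\<bar> \<le> 2 * (\<bar>\<xi> j \<omega>\<bar> * \<bar>D \<omega> - \<Delta>loc j \<omega>\<bar>)" for \<omega>
      proof -
        have eq: "?T \<omega> - s \<omega> - ?V \<omega> = D \<omega> - \<Delta>loc j \<omega>"
          using W_diff[OF fin, of \<omega> "win 1 j"] by (simp add: s_def U_def)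
        have "\<bar>f (?T \<omega> - s \<omega>) - f (?V \<omega>)\<bar> \<le> 2 * \<bar>D \<omega> - \<Delta>loc j \<omega>\<bar>"
          using tfD(5)[of "?T \<omega> - s \<omega>" "?V \<omega>"] unfolding eq .
        then have "\<bar>\<xi> j \<omega>\<bar> * \<bar>f (?T \<omega> - s \<omega>) - f (?V \<omega>)\<bar> \<le> \<bar>\<xi> j \<omega>\<bar> * (2 * \<bar>D \<omega> - \<Delta>loc j \<omega>\<bar>)"
          by (intro mult_left_mono) auto
        then show ?thesis by (simp add: right_diff_distrib[symmetric] abs_mult mult_ac)
      qed
    qed (use \<xi>m ABm fV remainder_weighted(1)[OF D j j] in auto)
    also have "\<dots> \<le> 4 * (\<beta> * d)" using remainder_weighted(2)[OF D j j] by simp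
    finally have p1: "\<bar>expectation (\<lambda>\<omega>. \<xi> j \<omega> * f (?T \<omega> - s \<omega>)) - expectation (\<lambda>\<omega>. \<xi> j \<omega> * f (?V \<omega>))\<bar> \<le> 4 * (\<beta> * d)"
      using i2 iV by simp
    define h where "h = (\<lambda>(z::real, u). z * f u)"
    have h: "h \<in> borel_measurable (borel \<Otimes>\<^sub>M borel)" unfolding h_def using tfD(1) by measurable
    have subs: "subalgebra M (\<S> (win 0 j))" "subalgebra M (\<S> ({1..N} - win (Suc 0) j))" using \<S>_subalgebra by auto
    \<comment> \<open>Truncating the majorant \<open>3 * \<bar>\<xi> j\<bar>\<close> at
      \<open>3\<close> means truncating \<open>\<bar>\<xi> j\<bar>\<close> at \<open>1\<close>, and
      beyond \<open>1\<close> it is dominated by its third power.\<close>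
    have "\<bar>(\<integral>\<omega>. h (\<xi> j \<omega>, ?V \<omega>) \<partial>M) - (\<integral>x. (\<integral>y. h (\<xi> j x, ?V y) \<partial>M) \<partial>M)\<bar>
      \<le> 2 * 3 * c + 2 * (\<integral>\<omega>. 3 * \<bar>\<xi> j \<omega>\<bar> * of_bool (3 < 3 * \<bar>\<xi> j \<omega>\<bar>) \<partial>M)"
    proof (rule decoupled_integral_truncated[OF subs decoupled_win[OF j] \<xi>S Vm h, where G="\<lambda>z. 3 * \<bar>z\<bar>"])
      show "\<bar>h (z, w)\<bar> \<le> 3 * \<bar>z\<bar>" for z w
        using mult_left_mono[OF tfD(3)[of w], of "\<bar>z\<bar>"] by (simp add: h_def abs_mult mult.commute)
    qed (use moment1(1)[OF j] in auto)
    also have "(\<integral>x. (\<integral>y. h (\<xi> j x, ?V y) \<partial>M) \<partial>M) = 0"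
      using \<xi>_centered[OF j] by (simp add: h_def)
    also have "(\<integral>\<omega>. h (\<xi> j \<omega>, ?V \<omega>) \<partial>M) = expectation (\<lambda>\<omega>. \<xi> j \<omega> * f (?V \<omega>))" by (simp add: h_def)
    also have "(\<integral>\<omega>. 3 * \<bar>\<xi> j \<omega>\<bar> * of_bool (3 < 3 * \<bar>\<xi> j \<omega>\<bar>) \<partial>M) \<le> 3 * \<beta> ^ 3"
    proof -
      have "\<bar>\<integral>\<omega>. 3 * \<bar>\<xi> j \<omega>\<bar> * of_bool (3 < 3 * \<bar>\<xi> j \<omega>\<bar>) \<partial>M\<bar> \<le> expectation (\<lambda>\<omega>. 3 * \<bar>\<xi> j \<omega>\<bar> ^ 3)"
      proof (rule dominated(2))
        show "\<bar>3 * \<bar>\<xi> j \<omega>\<bar> * of_bool (3 < 3 * \<bar>\<xi> j \<omega>\<bar>)\<bar> \<le> 3 * \<bar>\<xi> j \<omega>\<bar> ^ 3" for \<omega>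
          by (auto simp: self_le_power)
      qed (use \<xi>m \<xi>_integrable[OF j] in auto)
      then show ?thesis using \<xi>_third[OF j] by simp
    qed
    finally show ?thesis using p1 by linarith
  qed

  have step2: "\<bar>expectation (\<lambda>\<omega>. \<xi> j \<omega> * ?A \<omega>) - expectation (\<lambda>\<omega>. \<xi> j \<omega> * ?B \<omega>)\<bar>
    \<le> 8 * (\<beta> * d) + 2 * (L * (c0 * (L * \<beta>\<^sup>2) + 3 * c1 * (3 * (L\<^sup>2 * \<beta> ^ 3)) + (8 * c + 16 * (L\<^sup>2 * \<beta> ^ 3)))) + 12 * (L\<^sup>2 * \<beta> ^ 3)"
  proof -
    let ?o = "\<lambda>i \<omega>. a \<omega> * osc (U J j (Suc i) \<omega>) (3 * Y j (s \<omega>) i \<omega>)"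
    let ?e = "c0 * (L * \<beta>\<^sup>2) + 3 * c1 * (3 * (L\<^sup>2 * \<beta> ^ 3)) + (8 * c + 16 * (L\<^sup>2 * \<beta> ^ 3))"
    have o: "integrable M (?o i)" "expectation (?o i) \<le> ?e" if "i \<in> {1..k}" for i
    proof -
      have ik: "1 \<le> i" "i \<le> k" "Suc i \<in> {2..Suc k}" "i \<le> Suc k" using that by auto
      have aS': "a \<in> borel_measurable (\<S> (win i j))" unfolding a_def using XS[of i] sS[OF ik(1)] by measurable
      note eo = expectation_osc[OF tf J j ik(2) aS' a0 Y_meas[OF sS[OF ik(1)]] Y_bounds(1)[OF ik(4)] ai(1) aY(1)[OF ik(1,4)] H[OF ik(3)], of 4]
      show "integrable M (?o i)" by (rule eo(1)) auto
      have "expectation (?o i) \<le> c0 * expectation a + 3 * c1 * expectation (\<lambda>\<omega>. a \<omega> * Y j (s \<omega>) i \<omega>)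
        + (2 * 4 * c + 8 * expectation (\<lambda>\<omega>. a \<omega> * of_bool (4 < 4 * a \<omega>)))"
        by (rule eo(2)) auto
      also have "\<dots> \<le> c0 * (L * \<beta>\<^sup>2) + 3 * c1 * (3 * (L\<^sup>2 * \<beta> ^ 3)) + (2 * 4 * c + 8 * (2 * (L\<^sup>2 * \<beta> ^ 3)))"
        using ai(2) aY(2)[OF ik(1,4)] atail c01 by (intro add_mono mult_left_mono) auto
      finally show "expectation (?o i) \<le> ?e" by simp
    qed
    have e0: "0 \<le> ?e" using c01 L \<beta> c_d_nonneg by (intro add_nonneg_nonneg mult_nonneg_nonneg) auto
    let ?h = "\<lambda>\<omega>. 4 * (\<bar>\<xi> j \<omega>\<bar> * \<bar>D \<omega> - \<Delta>loc j \<omega>\<bar>) + (\<Sum>i=1..k. 2 * ?o i \<omega>) + 4 * (a \<omega> * Y j (s \<omega>) (Suc k) \<omega>)"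
    have aYk: "integrable M (\<lambda>\<omega>. a \<omega> * Y j (s \<omega>) (Suc k) \<omega>)" "expectation (\<lambda>\<omega>. a \<omega> * Y j (s \<omega>) (Suc k) \<omega>) \<le> 3 * (L\<^sup>2 * \<beta> ^ 3)"
      using aY[of "Suc k"] by auto
    have hi: "integrable M ?h" using o(1) aYk remainder_weighted(1)[OF D j j]
      by (intro Bochner_Integration.integrable_add Bochner_Integration.integrable_sum integrable_mult_right) auto
    have "\<bar>expectation (\<lambda>\<omega>. \<xi> j \<omega> * ?A \<omega> - \<xi> j \<omega> * ?B \<omega>)\<bar> \<le> expectation ?h"
    proof (rule dominated(2)[OF _ hi])
      fix \<omega>
      have "\<bar>\<xi> j \<omega> * ?A \<omega> - \<xi> j \<omega> * ?B \<omega>\<bar> = X \<omega> * \<bar>?A \<omega> - ?B \<omega>\<bar>"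
        by (simp only: right_diff_distrib[symmetric] abs_mult X_def)
      also have "\<dots> \<le> X \<omega> * (4 * \<bar>D \<omega> - \<Delta>loc j \<omega>\<bar> + (\<Sum>i=1..k. 2 * (\<bar>s \<omega>\<bar> * osc (U J j (Suc i) \<omega>) (3 * Y j (s \<omega>) i \<omega>)))
        + 4 * (\<bar>s \<omega>\<bar> * Y j (s \<omega>) (Suc k) \<omega>))"
        using X0 by (intro mult_left_mono increment_compare[OF tf J j])
      also have "\<dots> = ?h \<omega>"
        by (simp add: distrib_left sum_distrib_left a_def X_def mult_ac)
      finally show "\<bar>\<xi> j \<omega> * ?A \<omega> - \<xi> j \<omega> * ?B \<omega>\<bar> \<le> ?h \<omega>" .
    qed (use i3 i4 in auto)
    also have "expectation ?h = 4 * expectation (\<lambda>\<omega>. \<bar>\<xi> j \<omega>\<bar> * \<bar>D \<omega> - \<Delta>loc j \<omega>\<bar>)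
      + (\<Sum>i=1..k. 2 * expectation (?o i)) + 4 * expectation (\<lambda>\<omega>. a \<omega> * Y j (s \<omega>) (Suc k) \<omega>)"
      using o(1) aYk remainder_weighted(1)[OF D j j] by (intro expectation_majorant) auto
    also have "\<dots> \<le> 4 * (2 * (\<beta> * d)) + (\<Sum>i=1..k. 2 * ?e) + 4 * (3 * (L\<^sup>2 * \<beta> ^ 3))"
      using o(2) aYk remainder_weighted(2)[OF D j j] by (intro add_mono sum_mono mult_left_mono) auto
    also have "(\<Sum>i=1..k. 2 * ?e) = 2 * (real k * ?e)" by simp
    also have "\<dots> \<le> 2 * (L * ?e)" using L e0 by (intro mult_left_mono mult_right_mono) auto
    finally show ?thesis using i3 i4 by simp
  qed

  define F where "F = (\<lambda>s. expectation (\<lambda>\<omega>. f (?U \<omega>) - f (?U \<omega> - s)))"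
  have Fm: "(\<lambda>x. F (s x)) \<in> borel_measurable M" unfolding F_def using sm Um tfD(1) by measurable
  have step3: "\<bar>expectation (\<lambda>\<omega>. \<xi> j \<omega> * ?B \<omega>) - expectation (\<lambda>\<omega>. \<xi> j \<omega> * F (s \<omega>))\<bar> \<le> 4 * c + 8 * (L\<^sup>2 * \<beta> ^ 3)"
  proof -
    define h where "h = (\<lambda>(z :: real \<times> real, u). fst z * (f u - f (u - snd z)))"
    have h: "h \<in> borel_measurable ((borel \<Otimes>\<^sub>M borel) \<Otimes>\<^sub>M borel)" unfolding h_def using tfD(1) by measurable
    define Z where "Z = (\<lambda>\<omega>. (\<xi> j \<omega>, s \<omega>))"
    have Z: "Z \<in> measurable (\<S> (win 1 j)) (borel \<Otimes>\<^sub>M borel)" unfolding Z_def using \<xi>S[of 1] s1 by measurable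
    have subs: "subalgebra M (\<S> (win 1 j))" "subalgebra M (\<S> ({1..N} - win (Suc 1) j))" using \<S>_subalgebra by auto
    have UU: "?U \<in> borel_measurable (\<S> ({1..N} - win (Suc 1) j))" using U_meas[OF J j, of 2] k_gap by (simp add: numeral_2_eq_2)
    have "\<bar>(\<integral>\<omega>. h (Z \<omega>, ?U \<omega>) \<partial>M) - (\<integral>x. (\<integral>y. h (Z x, ?U y) \<partial>M) \<partial>M)\<bar>
      \<le> 2 * 2 * c + 2 * (\<integral>\<omega>. 2 * (\<bar>fst (Z \<omega>)\<bar> * \<bar>snd (Z \<omega>)\<bar>) * of_bool (2 < 2 * (\<bar>fst (Z \<omega>)\<bar> * \<bar>snd (Z \<omega>)\<bar>)) \<partial>M)"
    proof (rule decoupled_integral_truncated[OF subs decoupled_win[OF j k_gap(1)] Z UU h, where G="\<lambda>z. 2 * (\<bar>fst z\<bar> * \<bar>snd z\<bar>)"])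
      show "(\<lambda>z :: real \<times> real. 2 * (\<bar>fst z\<bar> * \<bar>snd z\<bar>)) \<in> borel_measurable (borel \<Otimes>\<^sub>M borel)" by measurable
      show "integrable M (\<lambda>\<omega>. 2 * (\<bar>fst (Z \<omega>)\<bar> * \<bar>snd (Z \<omega>)\<bar>))" using ai(1) by (simp add: Z_def a_def X_def)
      show "\<bar>h (z, u)\<bar> \<le> 2 * (\<bar>fst z\<bar> * \<bar>snd z\<bar>)" for z u
        using mult_left_mono[OF tfD(5)[of u "u - snd z"], of "\<bar>fst z\<bar>"] by (simp add: h_def abs_mult)
    qed auto
    moreover have "(\<integral>\<omega>. 2 * (\<bar>fst (Z \<omega>)\<bar> * \<bar>snd (Z \<omega>)\<bar>) * of_bool (2 < 2 * (\<bar>fst (Z \<omega>)\<bar> * \<bar>snd (Z \<omega>)\<bar>)) \<partial>M)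
      = 2 * expectation (\<lambda>\<omega>. a \<omega> * of_bool (1 < a \<omega>))"
      by (simp add: Z_def a_def X_def mult.assoc)
    moreover have "(\<integral>\<omega>. h (Z \<omega>, ?U \<omega>) \<partial>M) = expectation (\<lambda>\<omega>. \<xi> j \<omega> * ?B \<omega>)" by (simp add: h_def Z_def)
    moreover have "(\<integral>x. (\<integral>y. h (Z x, ?U y) \<partial>M) \<partial>M) = expectation (\<lambda>\<omega>. \<xi> j \<omega> * F (s \<omega>))"
      by (simp add: h_def Z_def F_def)
    ultimately show ?thesis using atail by linarith
  qed

  let ?f' = "expectation (\<lambda>\<omega>. f' (?T \<omega>))"
  have step4: "\<bar>expectation (\<lambda>\<omega>. \<xi> j \<omega> * F (s \<omega>)) - expectation (\<lambda>\<omega>. \<xi> j \<omega> * s \<omega>) * ?f'\<bar>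
    \<le> 8 * (\<beta> * d) + 2 * (L * (c0 * (L * \<beta>\<^sup>2) + 9 * c1 * (L\<^sup>2 * \<beta> ^ 3) + 8 * c * (L * \<beta>\<^sup>2))) + 12 * (L\<^sup>2 * \<beta> ^ 3)
        + (c0 * (L * \<beta>\<^sup>2) + c1 * (L\<^sup>2 * \<beta> ^ 3))"
  proof -
    let ?as = "\<lambda>\<omega>. a \<omega> * \<bar>s \<omega>\<bar>"
    have as: "integrable M ?as" "expectation ?as \<le> L\<^sup>2 * \<beta> ^ 3"
    proof -
      have m: "?as \<in> borel_measurable M" using am sm by measurable
      have b: "\<bar>?as \<omega>\<bar> \<le> a \<omega> * S j \<omega>" for \<omega>
        using sleS[of \<omega>] a0[of \<omega>] by (simp add: abs_mult mult_left_mono)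
      show "integrable M ?as" "expectation ?as \<le> L\<^sup>2 * \<beta> ^ 3" using dominated[OF m aS(1) b] aS(2) by auto
    qed
    \<comment> \<open>The bound of \<open>const_increment\<close>, multiplied by \<open>X\<close>,
      is sorted by powers of \<open>\<bar>s\<bar>\<close>: \<open>?p\<close> is the coefficient of
      \<open>a = X * \<bar>s\<bar>\<close> and \<open>?q\<close> that of
      \<open>a * \<bar>s\<bar>\<close>.\<close>
    let ?p = "2 * L * c0 + 12 * L * c1 * L * \<beta> + 16 * L * c + 8 * L * \<beta> + c0" and ?q = "6 * L * c1 + 4 + c1"
    let ?h = "\<lambda>\<omega>. 8 * d * X \<omega> + ?p * a \<omega> + ?q * ?as \<omega>"
    have hi: "integrable M ?h" using Xi ai as by auto
    have xs: "integrable M (\<lambda>\<omega>. \<xi> j \<omega> * s \<omega>)"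
      by (rule dominated(1)[OF _ ai(1)]) (use \<xi>m sm in \<open>auto simp: a_def X_def abs_mult\<close>)
    have F6: "\<bar>F x\<bar> \<le> 6" for x
    proof -
      have "\<bar>F x\<bar> \<le> expectation (\<lambda>_. 6)" unfolding F_def
        by (rule dominated(2)) (use Um tfD(1) b6 in auto)
      then show ?thesis by (simp add: prob_space)
    qed
    have iF: "integrable M (\<lambda>\<omega>. \<xi> j \<omega> * F (s \<omega>))" using Fm F6 by (intro bi)
    have "\<bar>expectation (\<lambda>\<omega>. \<xi> j \<omega> * F (s \<omega>) - \<xi> j \<omega> * s \<omega> * ?f')\<bar> \<le> expectation ?h"
    proof (rule dominated(2)[OF _ hi])
      fix \<omega>
      have "\<bar>\<xi> j \<omega> * F (s \<omega>) - \<xi> j \<omega> * s \<omega> * ?f'\<bar> = X \<omega> * \<bar>F (s \<omega>) - s \<omega> * ?f'\<bar>"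
        by (simp only: right_diff_distrib[symmetric] abs_mult X_def mult.assoc)
      also have "\<dots> \<le> X \<omega> * (8 * d + 2 * (L * (\<bar>s \<omega>\<bar> * (c0 + 3 * c1 * (\<bar>s \<omega>\<bar> + 2 * L * \<beta>) + 8 * c)))
        + 4 * (\<bar>s \<omega>\<bar> * (\<bar>s \<omega>\<bar> + 2 * L * \<beta>)) + \<bar>s \<omega>\<bar> * (c0 + c1 * \<bar>s \<omega>\<bar>))"
        unfolding F_def using X0 by (intro mult_left_mono const_increment[OF tf J j D H HT c01])
      also have "\<dots> = ?h \<omega>" by (simp add: a_def algebra_simps del: abs_mult_self_eq)
      finally show "\<bar>\<xi> j \<omega> * F (s \<omega>) - \<xi> j \<omega> * s \<omega> * ?f'\<bar> \<le> ?h \<omega>" .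
    qed (use iF xs in auto)
    also have "expectation ?h = 8 * d * expectation X + ?p * expectation a + ?q * expectation ?as"
      using Xi ai as by simp
    also have "\<dots> \<le> 8 * d * \<beta> + ?p * (L * \<beta>\<^sup>2) + ?q * (L\<^sup>2 * \<beta> ^ 3)"
      using Xi ai as c01 L \<beta> c_d_nonneg by (intro add_mono mult_left_mono) auto
    also have "\<dots> = 8 * (\<beta> * d) + 2 * (L * (c0 * (L * \<beta>\<^sup>2) + 9 * c1 * (L\<^sup>2 * \<beta> ^ 3) + 8 * c * (L * \<beta>\<^sup>2))) + 12 * (L\<^sup>2 * \<beta> ^ 3)
        + (c0 * (L * \<beta>\<^sup>2) + c1 * (L\<^sup>2 * \<beta> ^ 3))"
      by (simp add: power2_eq_square power3_eq_cube algebra_simps)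
    finally show ?thesis using iF xs by simp
  qed
  have "expectation (\<lambda>\<omega>. \<xi> j \<omega> * ?A \<omega>) = expectation (\<lambda>\<omega>. \<xi> j \<omega> * f (?T \<omega>)) - expectation (\<lambda>\<omega>. \<xi> j \<omega> * f (?T \<omega> - s \<omega>))"
    using i1 i2 by (simp add: right_diff_distrib)
  then show ?thesis
    using step1 step2 step3 step4 term_error_assemble[OF c01] unfolding s_def[symmetric] by linarith
qed


text \<open>Clipping \<open>\<xi> i\<close> at \<open>N\<close> provides a majorant in
  \<open>\<xi> j\<close> alone, as the truncated decoupling demands, and the product integral still
  vanishes because \<open>\<xi> j\<close> is centred. Clipping costs one
  \<open>\<beta> ^ 3 / N\<close>, the tail where \<open>\<bar>\<xi> j\<bar>\<close> exceeds
  \<open>N\<close> two more; over at most \<open>N\<^sup>2\<close> pairs this amounts to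
  \<open>3 * N * \<beta> ^ 3\<close>.\<close>

lemma far_covariance:
  assumes i: "i \<in> {1..N}" and j: "j \<in> {1..N}" and far: "i \<notin> win 1 j"
  shows "\<bar>expectation (\<lambda>\<omega>. \<xi> j \<omega> * \<xi> i \<omega>)\<bar> \<le> 3 * \<beta> ^ 3 / N + 2 * (real N)\<^sup>2 * c"
proof -
  define t where "t = real N"
  have t: "t \<ge> 1" using i by (auto simp: t_def)
  define clip where "clip = (\<lambda>y. max (- t) (min t y))"
  have clip_b: "\<bar>clip y\<bar> \<le> t" for y using t by (auto simp: clip_def)
  have clip_d: "\<bar>y - clip y\<bar> \<le> y\<^sup>2 / t" for y
  proof (cases "\<bar>y\<bar> \<le> t")
    case True
    then have "clip y = y" by (auto simp: clip_def)
    then show ?thesis using t by simp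
  next
    case False
    then have "\<bar>y - clip y\<bar> \<le> \<bar>y\<bar>" using t by (auto simp: clip_def)
    also have "\<dots> \<le> y\<^sup>2 / t"
      using False t mult_left_mono[of t "\<bar>y\<bar>" "\<bar>y\<bar>"] by (simp add: le_divide_eq power2_eq_square)
    finally show ?thesis .
  qed
  have clip_m: "clip \<in> borel_measurable borel" unfolding clip_def by measurable
  have jm: "\<xi> j \<in> borel_measurable (\<S> (win 0 j))"
    by (rule \<S>_meas_mono[OF \<xi>_measurable[OF j]]) (use win_self[OF j] in auto)
  have im: "\<xi> i \<in> borel_measurable (\<S> ({1..N} - win (Suc 0) j))"
    by (rule \<S>_meas_mono[OF \<xi>_measurable[OF i]]) (use far i in auto)
  have mM: "\<xi> j \<in> borel_measurable M" "\<xi> i \<in> borel_measurable M" using \<xi>_measM i j by auto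
  have mm: "(\<lambda>\<omega>. clip (\<xi> i \<omega>)) \<in> borel_measurable M" using mM clip_m by measurable
  have i1: "integrable M (\<lambda>\<omega>. \<xi> j \<omega> * \<xi> i \<omega>)"
    by (rule dominated(1)[OF _ moment2(1)[OF j i]]) (use mM in \<open>auto simp: abs_mult\<close>)
  have i2: "integrable M (\<lambda>\<omega>. \<xi> j \<omega> * clip (\<xi> i \<omega>))"
  proof (rule dominated(1))
    show "integrable M (\<lambda>\<omega>. t * \<bar>\<xi> j \<omega>\<bar>)" using moment1(1)[OF j] by auto
    show "\<bar>\<xi> j \<omega> * clip (\<xi> i \<omega>)\<bar> \<le> t * \<bar>\<xi> j \<omega>\<bar>" for \<omega>
      using mult_left_mono[OF clip_b[of "\<xi> i \<omega>"], of "\<bar>\<xi> j \<omega>\<bar>"] by (simp add: abs_mult mult.commute)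
  qed (use mM mm in measurable)
  have "\<bar>expectation (\<lambda>\<omega>. \<xi> j \<omega> * \<xi> i \<omega> - \<xi> j \<omega> * clip (\<xi> i \<omega>))\<bar> \<le> expectation (\<lambda>\<omega>. \<bar>\<xi> j \<omega>\<bar> * \<bar>\<xi> i \<omega>\<bar> * \<bar>\<xi> i \<omega>\<bar> / t)"
  proof (rule dominated(2))
    show "integrable M (\<lambda>\<omega>. \<bar>\<xi> j \<omega>\<bar> * \<bar>\<xi> i \<omega>\<bar> * \<bar>\<xi> i \<omega>\<bar> / t)" using moment3(1)[OF j i i] by auto
    show "\<bar>\<xi> j \<omega> * \<xi> i \<omega> - \<xi> j \<omega> * clip (\<xi> i \<omega>)\<bar> \<le> \<bar>\<xi> j \<omega>\<bar> * \<bar>\<xi> i \<omega>\<bar> * \<bar>\<xi> i \<omega>\<bar> / t" for \<omega>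
      using mult_left_mono[OF clip_d[of "\<xi> i \<omega>"], of "\<bar>\<xi> j \<omega>\<bar>"]
      by (simp add: right_diff_distrib[symmetric] abs_mult power2_eq_square mult.assoc)
  qed (use i1 i2 in auto)
  also have "\<dots> \<le> \<beta> ^ 3 / t" using moment3(2)[OF j i i] t by (simp add: divide_right_mono)
  finally have 1: "\<bar>expectation (\<lambda>\<omega>. \<xi> j \<omega> * \<xi> i \<omega>) - expectation (\<lambda>\<omega>. \<xi> j \<omega> * clip (\<xi> i \<omega>))\<bar> \<le> \<beta> ^ 3 / t"
    using i1 i2 by simp
  define h where "h = (\<lambda>(x::real, y). x * clip y)"
  have h: "h \<in> borel_measurable (borel \<Otimes>\<^sub>M borel)" unfolding h_def using clip_m by measurable
  have subs: "subalgebra M (\<S> (win 0 j))" "subalgebra M (\<S> ({1..N} - win (Suc 0) j))" using \<S>_subalgebra by auto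
  have "\<bar>(\<integral>\<omega>. h (\<xi> j \<omega>, \<xi> i \<omega>) \<partial>M) - (\<integral>x. (\<integral>y. h (\<xi> j x, \<xi> i y) \<partial>M) \<partial>M)\<bar>
    \<le> 2 * t\<^sup>2 * c + 2 * (\<integral>\<omega>. t * \<bar>\<xi> j \<omega>\<bar> * of_bool (t\<^sup>2 < t * \<bar>\<xi> j \<omega>\<bar>) \<partial>M)"
  proof (rule decoupled_integral_truncated[OF subs decoupled_win[OF j] jm im h, where G="\<lambda>z. t * \<bar>z\<bar>"])
    show "\<bar>h (z, w)\<bar> \<le> t * \<bar>z\<bar>" for z w
      using mult_left_mono[OF clip_b[of w], of "\<bar>z\<bar>"] by (simp add: h_def abs_mult mult.commute)
  qed (use moment1(1)[OF j] in auto)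
  also have "(\<integral>x. (\<integral>y. h (\<xi> j x, \<xi> i y) \<partial>M) \<partial>M) = 0" using \<xi>_centered[OF j] by (simp add: h_def)
  also have "(\<integral>\<omega>. h (\<xi> j \<omega>, \<xi> i \<omega>) \<partial>M) = expectation (\<lambda>\<omega>. \<xi> j \<omega> * clip (\<xi> i \<omega>))" by (simp add: h_def)
  also have "(\<integral>\<omega>. t * \<bar>\<xi> j \<omega>\<bar> * of_bool (t\<^sup>2 < t * \<bar>\<xi> j \<omega>\<bar>) \<partial>M) \<le> \<beta> ^ 3 / t"
  proof -
    have "\<bar>\<integral>\<omega>. t * \<bar>\<xi> j \<omega>\<bar> * of_bool (t\<^sup>2 < t * \<bar>\<xi> j \<omega>\<bar>) \<partial>M\<bar> \<le> expectation (\<lambda>\<omega>. \<bar>\<xi> j \<omega>\<bar> ^ 3 / t)"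
    proof (rule dominated(2))
      show "\<bar>t * \<bar>\<xi> j \<omega>\<bar> * of_bool (t\<^sup>2 < t * \<bar>\<xi> j \<omega>\<bar>)\<bar> \<le> \<bar>\<xi> j \<omega>\<bar> ^ 3 / t" for \<omega>
      proof (cases "t\<^sup>2 < t * \<bar>\<xi> j \<omega>\<bar>")
        case True
        then have "t \<le> \<bar>\<xi> j \<omega>\<bar>" using t by (simp add: power2_eq_square)
        then have "t * t * \<bar>\<xi> j \<omega>\<bar> \<le> \<bar>\<xi> j \<omega>\<bar> * \<bar>\<xi> j \<omega>\<bar> * \<bar>\<xi> j \<omega>\<bar>" using t by (intro mult_right_mono mult_mono) auto
        then show ?thesis using True t by (simp add: le_divide_eq power3_eq_cube mult_ac)
      qed (use t in auto)
    qed (use mM \<xi>_integrable[OF j] in auto)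
    also have "\<dots> \<le> \<beta> ^ 3 / t" using \<xi>_third[OF j] t by (simp add: divide_right_mono)
    finally show ?thesis by simp
  qed
  finally have "\<bar>expectation (\<lambda>\<omega>. \<xi> j \<omega> * clip (\<xi> i \<omega>))\<bar> \<le> 2 * t\<^sup>2 * c + 2 * (\<beta> ^ 3 / t)" by simp
  with 1 have "\<bar>expectation (\<lambda>\<omega>. \<xi> j \<omega> * \<xi> i \<omega>)\<bar> \<le> 3 * (\<beta> ^ 3 / t) + 2 * t\<^sup>2 * c" by linarith
  then show ?thesis by (simp add: t_def)
qed

section \<open>Second moments and summation over the array\<close>

lemma W_integrable: "J \<subseteq> {1..N} \<Longrightarrow> integrable M (W J)"
  unfolding W_def by (intro Bochner_Integration.integrable_sum moment1) auto

lemma W_square: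
  assumes "J \<subseteq> {1..N}"
  shows "integrable M (\<lambda>\<omega>. (W J \<omega>)\<^sup>2)" "expectation (\<lambda>\<omega>. (W J \<omega>)\<^sup>2) = (\<Sum>j\<in>J. \<Sum>i\<in>J. expectation (\<lambda>\<omega>. \<xi> j \<omega> * \<xi> i \<omega>))"
    "expectation (\<lambda>\<omega>. (W J \<omega>)\<^sup>2) \<le> (real (card J))\<^sup>2 * \<beta>\<^sup>2"
proof -
  have ii: "integrable M (\<lambda>\<omega>. \<xi> j \<omega> * \<xi> i \<omega>)" "expectation (\<lambda>\<omega>. \<xi> j \<omega> * \<xi> i \<omega>) \<le> \<beta>\<^sup>2"
    if "j \<in> J" "i \<in> J" for i j
  proof -
    have ij: "i \<in> {1..N}" "j \<in> {1..N}" using that assms by auto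
    have m: "(\<lambda>\<omega>. \<xi> j \<omega> * \<xi> i \<omega>) \<in> borel_measurable M" using ij[THEN \<xi>_measM] by measurable
    have b: "\<bar>\<xi> j \<omega> * \<xi> i \<omega>\<bar> \<le> \<bar>\<xi> j \<omega>\<bar> * \<bar>\<xi> i \<omega>\<bar>" for \<omega> by (simp add: abs_mult)
    show "integrable M (\<lambda>\<omega>. \<xi> j \<omega> * \<xi> i \<omega>)" "expectation (\<lambda>\<omega>. \<xi> j \<omega> * \<xi> i \<omega>) \<le> \<beta>\<^sup>2"
      using dominated[OF m moment2(1)[OF ij(2,1)] b] moment2(2)[OF ij(2,1)] by auto
  qed
  have eq: "(W J \<omega>)\<^sup>2 = (\<Sum>j\<in>J. \<Sum>i\<in>J. \<xi> j \<omega> * \<xi> i \<omega>)" for \<omega>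
    by (simp add: W_def power2_eq_square sum_product)
  show "integrable M (\<lambda>\<omega>. (W J \<omega>)\<^sup>2)" unfolding eq by (intro Bochner_Integration.integrable_sum ii)
  have "expectation (\<lambda>\<omega>. (W J \<omega>)\<^sup>2) = (\<Sum>j\<in>J. expectation (\<lambda>\<omega>. \<Sum>i\<in>J. \<xi> j \<omega> * \<xi> i \<omega>))"
    unfolding eq by (intro Bochner_Integration.integral_sum Bochner_Integration.integrable_sum ii)
  also have "\<dots> = (\<Sum>j\<in>J. \<Sum>i\<in>J. expectation (\<lambda>\<omega>. \<xi> j \<omega> * \<xi> i \<omega>))"
    by (intro sum.cong refl Bochner_Integration.integral_sum ii)
  finally show 1: "expectation (\<lambda>\<omega>. (W J \<omega>)\<^sup>2) = (\<Sum>j\<in>J. \<Sum>i\<in>J. expectation (\<lambda>\<omega>. \<xi> j \<omega> * \<xi> i \<omega>))" .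
  also have "\<dots> \<le> (\<Sum>j\<in>J. \<Sum>i\<in>J. \<beta>\<^sup>2)" by (intro sum_mono ii)
  also have "\<dots> = (real (card J))\<^sup>2 * \<beta>\<^sup>2" by (simp add: power2_eq_square)
  finally show "expectation (\<lambda>\<omega>. (W J \<omega>)\<^sup>2) \<le> (real (card J))\<^sup>2 * \<beta>\<^sup>2" .
qed

text \<open>\<open>76\<close> is \<open>70\<close> from the single terms plus \<open>6\<close> from
  the covariances outside the windows, where \<open>\<bar>f'\<bar> \<le> 2\<close> doubles
  \<open>3 * N * \<beta> ^ 3\<close>; in the same way \<open>4\<close> is twice
  \<open>2\<close>.\<close>

definition stein_error :: "real \<Rightarrow> real \<Rightarrow> real" where
  "stein_error c0 c1 = 76 * (real N * term_error c0 c1) + 4 * (real N ^ 4 * c)"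

text \<open>Summing \<open>one_term\<close> over \<open>J\<close> produces only the covariances
  inside the windows; \<open>far_covariance\<close> completes them to the full second moment of
  \<open>W J\<close>.\<close>

lemma approximate_stein_identity:
  assumes tf: "test_function f f' osc" and J: "J \<subseteq> {1..N}" and D: "D \<in> remainders"
    and H: "\<And>j i r. j \<in> {1..N} \<Longrightarrow> i \<in> {2..Suc k} \<Longrightarrow> 0 \<le> r \<Longrightarrow> expectation (\<lambda>\<omega>. osc (U J j i \<omega>) r) \<le> c0 + c1 * r"
    and HT: "\<And>r. 0 \<le> r \<Longrightarrow> expectation (\<lambda>\<omega>. osc (W J \<omega> + D \<omega>) r) \<le> c0 + c1 * r"
    and c01: "0 \<le> c0" "0 \<le> c1"
  shows "\<bar>expectation (\<lambda>\<omega>. W J \<omega> * f (W J \<omega> + D \<omega>))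
     - expectation (\<lambda>\<omega>. (W J \<omega>)\<^sup>2) * expectation (\<lambda>\<omega>. f' (W J \<omega> + D \<omega>))\<bar> \<le> stein_error c0 c1"
proof -
  note tfD = test_functionD[OF tf]
  let ?T = "\<lambda>\<omega>. W J \<omega> + D \<omega>"
  have fin: "finite J" using J finite_subset by blast
  have cJ: "real (card J) \<le> N" using card_mono[OF _ J] by simp
  have Tm: "?T \<in> borel_measurable M" using W_measM[OF J] remainders_meas[OF D] by measurable
  have jN: "j \<in> {1..N}" if "j \<in> J" for j using J that by auto
  have fi: "integrable M (\<lambda>\<omega>. \<xi> j \<omega> * f (?T \<omega>))" if "j \<in> J" for j
  proof (rule dominated(1))
    show "integrable M (\<lambda>\<omega>. 3 * \<bar>\<xi> j \<omega>\<bar>)" using moment1(1)[OF jN[OF that]] by auto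
    show "\<bar>\<xi> j \<omega> * f (?T \<omega>)\<bar> \<le> 3 * \<bar>\<xi> j \<omega>\<bar>" for \<omega>
      using mult_left_mono[OF tfD(3)[of "?T \<omega>"], of "\<bar>\<xi> j \<omega>\<bar>"] by (simp add: abs_mult mult.commute)
  qed (use \<xi>_measM[OF jN[OF that]] Tm tfD(1) in measurable)
  let ?v = "\<lambda>j. expectation (\<lambda>\<omega>. \<xi> j \<omega> * W (J \<inter> win 1 j) \<omega>)"
  let ?f' = "expectation (\<lambda>\<omega>. f' (?T \<omega>))"
  have f'2: "\<bar>?f'\<bar> \<le> 2"
  proof -
    have "\<bar>?f'\<bar> \<le> expectation (\<lambda>_. 2)"
      by (rule dominated(2)) (use Tm tfD in auto)
    then show ?thesis by (simp add: prob_space)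
  qed
  have W: "expectation (\<lambda>\<omega>. W J \<omega> * f (?T \<omega>)) = (\<Sum>j\<in>J. expectation (\<lambda>\<omega>. \<xi> j \<omega> * f (?T \<omega>)))"
    by (subst W_def) (simp add: sum_distrib_right Bochner_Integration.integral_sum fi)
  have "\<bar>\<Sum>j\<in>J. (expectation (\<lambda>\<omega>. \<xi> j \<omega> * f (?T \<omega>)) - ?v j * ?f')\<bar> \<le> (\<Sum>j\<in>J. \<bar>expectation (\<lambda>\<omega>. \<xi> j \<omega> * f (?T \<omega>)) - ?v j * ?f'\<bar>)"
    by (rule sum_abs)
  also have "\<dots> \<le> (\<Sum>j\<in>J. 70 * term_error c0 c1)"
    using jN by (intro sum_mono one_term[OF tf J _ D H HT c01]) auto
  also have "\<dots> = card J * (70 * term_error c0 c1)" by simp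
  also have "\<dots> \<le> N * (70 * term_error c0 c1)"
    using cJ c01 L \<beta> c_d_nonneg by (intro mult_right_mono) (auto simp: term_error_def)
  finally have 1: "\<bar>expectation (\<lambda>\<omega>. W J \<omega> * f (?T \<omega>)) - (\<Sum>j\<in>J. ?v j) * ?f'\<bar> \<le> N * (70 * term_error c0 c1)"
    by (simp add: W sum_subtractf sum_distrib_right)
  have vj: "?v j = (\<Sum>i\<in>J \<inter> win 1 j. expectation (\<lambda>\<omega>. \<xi> j \<omega> * \<xi> i \<omega>))" if "j \<in> J" for j
  proof -
    have "integrable M (\<lambda>\<omega>. \<xi> j \<omega> * \<xi> i \<omega>)" if "i \<in> J" for i
      by (rule dominated(1)[OF _ moment2(1)[OF jN[OF \<open>j \<in> J\<close>] jN[OF that]]]) 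
        (use \<xi>_measM[OF jN[OF \<open>j \<in> J\<close>]] \<xi>_measM[OF jN[OF that]] in \<open>auto simp: abs_mult\<close>)
    then show ?thesis unfolding W_def sum_distrib_left by (intro Bochner_Integration.integral_sum) auto
  qed
  let ?\<tau> = "3 * \<beta> ^ 3 / N + 2 * (real N)\<^sup>2 * c"
  have \<tau>0: "0 \<le> ?\<tau>" using \<beta> c_d_nonneg by simp
  have "expectation (\<lambda>\<omega>. (W J \<omega>)\<^sup>2) - (\<Sum>j\<in>J. ?v j) = (\<Sum>j\<in>J. \<Sum>i\<in>J - win 1 j. expectation (\<lambda>\<omega>. \<xi> j \<omega> * \<xi> i \<omega>))"
  proof -
    have "(\<Sum>i\<in>J. expectation (\<lambda>\<omega>. \<xi> j \<omega> * \<xi> i \<omega>)) = ?v j + (\<Sum>i\<in>J - win 1 j. expectation (\<lambda>\<omega>. \<xi> j \<omega> * \<xi> i \<omega>))"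
      if "j \<in> J" for j unfolding vj[OF that] by (rule sum.Int_Diff[OF fin])
    then show ?thesis unfolding W_square(2)[OF J] by (simp add: sum.distrib)
  qed
  also have "\<bar>\<dots>\<bar> \<le> (\<Sum>j\<in>J. \<Sum>i\<in>J - win 1 j. ?\<tau>)"
  proof -
    have "\<bar>\<Sum>j\<in>J. \<Sum>i\<in>J - win 1 j. expectation (\<lambda>\<omega>. \<xi> j \<omega> * \<xi> i \<omega>)\<bar>
       \<le> (\<Sum>j\<in>J. \<Sum>i\<in>J - win 1 j. \<bar>expectation (\<lambda>\<omega>. \<xi> j \<omega> * \<xi> i \<omega>)\<bar>)"
      by (intro order_trans[OF sum_abs] sum_mono sum_abs)
    also have "\<dots> \<le> (\<Sum>j\<in>J. \<Sum>i\<in>J - win 1 j. ?\<tau>)"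
      using jN by (intro sum_mono far_covariance) auto
    finally show ?thesis .
  qed
  also have "\<dots> \<le> (\<Sum>j\<in>J. N * ?\<tau>)"
  proof (intro sum_mono)
    fix j assume "j \<in> J"
    have "real (card (J - win 1 j)) \<le> N" using card_mono[OF fin, of "J - win 1 j"] cJ by auto
    then show "(\<Sum>i\<in>J - win 1 j. ?\<tau>) \<le> N * ?\<tau>" using \<tau>0 by (simp only: sum_constant mult_right_mono)
  qed
  also have "\<dots> \<le> N * (N * ?\<tau>)" using cJ \<tau>0 by (simp only: sum_constant) (intro mult_right_mono mult_nonneg_nonneg; simp)
  also have "\<dots> \<le> 3 * (N * \<beta> ^ 3) + 2 * (real N ^ 4 * c)"
    by (cases "N = 0") (auto simp: field_simps power2_eq_square numeral_eq_Suc)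
  finally have "\<bar>expectation (\<lambda>\<omega>. (W J \<omega>)\<^sup>2) - (\<Sum>j\<in>J. ?v j)\<bar> \<le> 3 * (N * \<beta> ^ 3) + 2 * (real N ^ 4 * c)" .
  then have "\<bar>expectation (\<lambda>\<omega>. (W J \<omega>)\<^sup>2) - (\<Sum>j\<in>J. ?v j)\<bar> * \<bar>?f'\<bar> \<le> (3 * (N * \<beta> ^ 3) + 2 * (real N ^ 4 * c)) * 2"
    using f'2 by (intro mult_mono) auto
  then have 2: "\<bar>expectation (\<lambda>\<omega>. (W J \<omega>)\<^sup>2) * ?f' - (\<Sum>j\<in>J. ?v j) * ?f'\<bar> \<le> 6 * (N * \<beta> ^ 3) + 4 * (real N ^ 4 * c)"
    by (simp add: left_diff_distrib[symmetric] abs_mult)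
  have "\<beta> ^ 3 \<le> term_error c0 c1"
  proof -
    have "1 * \<beta> ^ 3 \<le> L ^ 3 * \<beta> ^ 3" using L \<beta> by (intro mult_right_mono one_le_power) auto
    moreover have "0 \<le> \<beta> * d + L\<^sup>2 * c0 * \<beta>\<^sup>2 + L ^ 3 * c1 * \<beta> ^ 3 + L\<^sup>2 * c" using c01 L \<beta> c_d_nonneg by simp
    ultimately show ?thesis unfolding term_error_def by linarith
  qed
  then have "N * \<beta> ^ 3 \<le> N * term_error c0 c1" by (intro mult_left_mono) auto
  then show ?thesis using 1 2 unfolding stein_error_def by linarith
qed

end

section \<open>Concentration\<close>

text \<open>An interval of radius \<open>r\<close> is covered by at most \<open>r / l + 1\<close>
  intervals of radius \<open>l\<close>. Concentration at one scale thus gives a bound affine in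
  \<open>r\<close> at every scale, the form that \<open>expectation_osc\<close> expects.\<close>

lemma (in prob_space) concentration_cover:
  assumes V: "V \<in> borel_measurable M" and l: "0 < l" and r: "0 \<le> r"
    and q: "\<And>x. prob {\<omega>\<in>space M. \<bar>V \<omega> - x\<bar> \<le> l} \<le> q"
  shows "prob {\<omega>\<in>space M. \<bar>V \<omega> - m\<bar> \<le> r} \<le> (r / l + 1) * (q::real)"
proof -
  define n where "n = nat \<lfloor>r / l\<rfloor> + 1"
  have q0: "0 \<le> q" using q[of 0] measure_nonneg order_trans by blast
  have rl: "0 \<le> r / l" using l r by simp
  have n: "real n \<le> r / l + 1" "r / l \<le> n" using rl unfolding n_def by linarith+
  have meas: "{\<omega>\<in>space M. \<bar>V \<omega> - x\<bar> \<le> s} \<in> sets M" for x s using V by measurable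
  let ?x = "\<lambda>i. m - r + l * (2 * real i + 1)"
  have cov: "{\<omega>\<in>space M. \<bar>V \<omega> - m\<bar> \<le> r} \<subseteq> (\<Union>i<n. {\<omega>\<in>space M. \<bar>V \<omega> - ?x i\<bar> \<le> l})"
  proof
    fix \<omega> assume w: "\<omega> \<in> {\<omega>\<in>space M. \<bar>V \<omega> - m\<bar> \<le> r}"
    define y where "y = (V \<omega> - m + r) / (2 * l)"
    have "V \<omega> - m + r \<le> 2 * r" using w by auto
    then have "y \<le> 2 * r / (2 * l)" unfolding y_def using l by (intro divide_right_mono) auto
    then have y: "0 \<le> y" "y \<le> r / l" using w l by (auto simp: y_def)
    define i where "i = min (nat \<lfloor>y\<rfloor>) (n - 1)"
    have i: "i < n" "real i \<le> y" "y \<le> real i + 1"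
    proof -
      show "i < n" unfolding i_def n_def by simp
      show "real i \<le> y" using y unfolding i_def by linarith
      have "y \<le> real (n - 1) + 1" using y n by (simp add: n_def)
      then show "y \<le> real i + 1" using y unfolding i_def by linarith
    qed
    have "V \<omega> - ?x i = l * (2 * (y - i) - 1)" using l by (simp add: y_def field_simps)
    also have "\<bar>\<dots>\<bar> = l * \<bar>2 * (y - i) - 1\<bar>" using l by (simp add: abs_mult)
    also have "\<dots> \<le> l * 1" using i l by (intro mult_left_mono) auto
    finally show "\<omega> \<in> (\<Union>i<n. {\<omega>\<in>space M. \<bar>V \<omega> - ?x i\<bar> \<le> l})" using w i(1) by auto
  qed
  have "prob {\<omega>\<in>space M. \<bar>V \<omega> - m\<bar> \<le> r} \<le> prob (\<Union>i<n. {\<omega>\<in>space M. \<bar>V \<omega> - ?x i\<bar> \<le> l})"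
    using meas by (intro finite_measure_mono[OF cov]) auto
  also have "\<dots> \<le> (\<Sum>i<n. prob {\<omega>\<in>space M. \<bar>V \<omega> - ?x i\<bar> \<le> l})"
    using meas by (intro measure_UNION_le) auto
  also have "\<dots> \<le> (\<Sum>i<n. q)" by (intro sum_mono q)
  also have "\<dots> \<le> (r / l + 1) * q" using n(1) q0 by (simp add: mult_right_mono)
  finally show ?thesis .
qed

text \<open>There is no constant term because the trapezoid is Lipschitz. Covering the radius
  \<open>2 * l + r\<close> gives the factor \<open>3 + r / l\<close>; bounding the oscillation by
  \<open>2 * r / l\<close> for the first part and by \<open>1\<close> for the second yields
  \<open>6 + 1 = 7\<close>.\<close>

lemma (in prob_space) expectation_trapezoid_osc:
  assumes V: "V \<in> borel_measurable M" and l: "0 < l" and r: "0 \<le> r"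
    and q: "\<And>x. prob {\<omega>\<in>space M. \<bar>V \<omega> - x\<bar> \<le> l} \<le> q"
  shows "expectation (\<lambda>\<omega>. trapezoid_osc m l (V \<omega>) r) \<le> 0 + (7 * q / l) * r"
proof -
  have q0: "0 \<le> q" using q[of 0] measure_nonneg order_trans by blast
  have meas: "{\<omega>\<in>space M. \<bar>V \<omega> - m\<bar> \<le> 2 * l + r} \<in> sets M" using V by measurable
  have "expectation (\<lambda>\<omega>. trapezoid_osc m l (V \<omega>) r)
    = expectation (\<lambda>\<omega>. min 1 (2 * r / l) * indicator {\<omega>\<in>space M. \<bar>V \<omega> - m\<bar> \<le> 2 * l + r} \<omega>)"
    using r by (intro Bochner_Integration.integral_cong) (auto simp: trapezoid_osc_def indicator_def)
  also have "\<dots> = min 1 (2 * r / l) * prob {\<omega>\<in>space M. \<bar>V \<omega> - m\<bar> \<le> 2 * l + r}"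
    using meas by (simp add: Int_absorb2 Collect_restrict)
  also have "\<dots> \<le> min 1 (2 * r / l) * (((2 * l + r) / l + 1) * q)"
    using l r by (intro mult_left_mono concentration_cover[OF V l _ q]) auto
  also have "\<dots> = (min 1 (2 * r / l) * 3 + min 1 (2 * r / l) * (r / l)) * q"
    using l by (simp add: field_simps)
  also have "\<dots> \<le> ((2 * r / l) * 3 + 1 * (r / l)) * q"
    using l r q0 by (intro mult_right_mono add_mono mult_right_mono) auto
  also have "\<dots> = 0 + (7 * q / l) * r" by (simp add: field_simps)
  finally show ?thesis .
qed

text \<open>Layer by layer: at level \<open>a\<close> the event
  \<open>g (V - r) \<le> a < g (V + r)\<close> confines \<open>V\<close> to distance
  \<open>r\<close> from the point where \<open>g\<close> crosses \<open>a\<close>, whatever the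
  slope there. Each level costs \<open>q\<close>, and the levels fill an interval of length
  \<open>b\<close>.\<close>

lemma (in prob_space) expectation_mono_shift:
  fixes V :: "'a \<Rightarrow> real" and g :: "real \<Rightarrow> real"
  assumes V: "V \<in> borel_measurable M" and r: "0 \<le> r"
    and g: "mono g" "\<And>x. 0 \<le> g x" "\<And>x. g x \<le> b" "g \<in> borel_measurable borel" and b: "0 \<le> b"
    and q: "\<And>x. prob {\<omega>\<in>space M. \<bar>V \<omega> - x\<bar> \<le> r} \<le> (q::real)"
  shows "expectation (\<lambda>\<omega>. g (V \<omega> + r) - g (V \<omega> - r)) \<le> b * q"
proof -
  have level: "prob {\<omega>\<in>space M. g (V \<omega> - r) \<le> a \<and> a < g (V \<omega> + r)} \<le> q" for a
  proof -
    let ?E = "{\<omega>\<in>space M. g (V \<omega> - r) \<le> a \<and> a < g (V \<omega> + r)}"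
    let ?A = "{x. a < g x}"
    show ?thesis
    proof (cases "?E = {}")
      case True
      then show ?thesis using q[of 0] measure_nonneg order_trans by (metis measure_empty)
    next
      case False
      then obtain w where w: "g (V w - r) \<le> a" "a < g (V w + r)" by blast
      have below: "y \<le> x" if "g y \<le> a" "x \<in> ?A" for x y
        using that monoD[OF g(1), of x y] by (cases "x \<le> y") (auto simp: not_le)
      have bdd: "bdd_below ?A" using below[OF w(1)] by (auto simp: bdd_below_def)
      have "?E \<subseteq> {\<omega>\<in>space M. \<bar>V \<omega> - Inf ?A\<bar> \<le> r}"
      proof
        fix \<omega> assume e: "\<omega> \<in> ?E"
        have "Inf ?A \<le> V \<omega> + r" using e by (intro cInf_lower bdd) auto
        moreover have "V \<omega> - r \<le> Inf ?A" using e w(2) below by (intro cInf_greatest) auto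
        ultimately show "\<omega> \<in> {\<omega>\<in>space M. \<bar>V \<omega> - Inf ?A\<bar> \<le> r}" using e by auto
      qed
      then have "prob ?E \<le> prob {\<omega>\<in>space M. \<bar>V \<omega> - Inf ?A\<bar> \<le> r}" using V by (intro finite_measure_mono) measurable
      then show ?thesis using q[of "Inf ?A"] by linarith
    qed
  qed
  have main: "expectation (\<lambda>\<omega>. g (V \<omega> + r) - g (V \<omega> - r)) \<le> b * q + 2 * b / n" if n: "n > 0" for n :: nat
  proof -
    let ?E = "\<lambda>i. {\<omega>\<in>space M. g (V \<omega> - r) \<le> real i * b / n \<and> real i * b / n < g (V \<omega> + r)}"
    have E: "?E i \<in> sets M" for i using V g(4) by measurable
    have le: "g (V \<omega> + r) - g (V \<omega> - r) \<le> 2 * b / n + b / n * (\<Sum>i=1..n. indicator (?E i) \<omega>)" if w: "\<omega> \<in> space M" for \<omega>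
    proof -
      let ?s = "\<lambda>x. \<Sum>i=1..n. of_bool (real i * b / n < x) :: real"
      have "\<bar>g (V \<omega> + r) - b / n * ?s (g (V \<omega> + r))\<bar> \<le> b / n" "\<bar>g (V \<omega> - r) - b / n * ?s (g (V \<omega> - r))\<bar> \<le> b / n"
        by (rule staircase[OF g(2) g(3) n])+
      then have "g (V \<omega> + r) - g (V \<omega> - r) \<le> 2 * b / n + b / n * (?s (g (V \<omega> + r)) - ?s (g (V \<omega> - r)))"
        by (simp add: abs_le_iff right_diff_distrib)
      also have "\<dots> \<le> 2 * b / n + b / n * (\<Sum>i=1..n. indicator (?E i) \<omega>)"
      proof (intro add_left_mono mult_left_mono)
        show "?s (g (V \<omega> + r)) - ?s (g (V \<omega> - r)) \<le> (\<Sum>i=1..n. indicator (?E i) \<omega>)"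
          unfolding sum_subtractf[symmetric] using w by (intro sum_mono) (auto simp: indicator_def)
      qed (use b in simp)
      finally show ?thesis .
    qed
    have gi: "integrable M (\<lambda>\<omega>. g (V \<omega> + r) - g (V \<omega> - r))"
    proof (rule integrable_const_bound[of _ b])
      show "AE \<omega> in M. norm (g (V \<omega> + r) - g (V \<omega> - r)) \<le> b"
        using g(2,3) by (intro AE_I2) (smt (verit) real_norm_def)
    qed (use V g(4) in measurable)
    have si: "integrable M (\<lambda>\<omega>. \<Sum>i=1..n. indicator (?E i) \<omega> :: real)"
      using E by (intro Bochner_Integration.integrable_sum integrable_real_indicator) (auto simp: emeasure_eq_measure)
    have "expectation (\<lambda>\<omega>. \<Sum>i=1..n. indicator (?E i) \<omega> :: real) = (\<Sum>i=1..n. expectation (indicator (?E i)))"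
      using E by (intro Bochner_Integration.integral_sum integrable_real_indicator) (auto simp: emeasure_eq_measure)
    also have "\<dots> = (\<Sum>i=1..n. prob (?E i))" by (intro sum.cong refl) (simp add: Int_absorb2 Collect_restrict)
    also have "\<dots> \<le> (\<Sum>i=1..n. q)" by (intro sum_mono level)
    also have "\<dots> = n * q" by simp
    finally have ES: "expectation (\<lambda>\<omega>. \<Sum>i=1..n. indicator (?E i) \<omega> :: real) \<le> n * q" .
    have "expectation (\<lambda>\<omega>. g (V \<omega> + r) - g (V \<omega> - r)) \<le> expectation (\<lambda>\<omega>. 2 * b / n + b / n * (\<Sum>i=1..n. indicator (?E i) \<omega>))"
      using gi si le by (intro integral_mono) auto
    also have "\<dots> = 2 * b / n + b / n * expectation (\<lambda>\<omega>. \<Sum>i=1..n. indicator (?E i) \<omega> :: real)"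
      using si by (simp add: prob_space)
    also have "\<dots> \<le> 2 * b / n + b / n * (n * q)" using b by (intro add_left_mono mult_left_mono ES) auto
    also have "\<dots> = b * q + 2 * b / n" using n by simp
    finally show ?thesis .
  qed
  have "(\<lambda>n. b * q + 2 * b / real n) \<longlonglongrightarrow> b * q + 0"
    by (intro tendsto_intros lim_const_over_n)
  then have "expectation (\<lambda>\<omega>. g (V \<omega> + r) - g (V \<omega> - r)) \<le> b * q + 0"
    by (rule LIMSEQ_le_const) (use main in \<open>auto intro!: exI[of _ 1]\<close>)
  then show ?thesis by simp
qed

text \<open>The increasing part takes values in an interval of length \<open>2\<close> and the jump
  adds one event around \<open>z\<close>, so three copies of the covering bound
  \<open>(r / l + 1) * q\<close> arise. Unlike for the trapezoid, a constant term remains.\<close>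

lemma (in prob_space) expectation_stein_osc:
  assumes V: "V \<in> borel_measurable M" and l: "0 < l" and r: "0 \<le> r"
    and q: "\<And>x. prob {\<omega>\<in>space M. \<bar>V \<omega> - x\<bar> \<le> l} \<le> q"
  shows "expectation (\<lambda>\<omega>. stein_osc z (V \<omega>) r) \<le> 3 * q + (3 * q / l) * r"
proof -
  have qr: "prob {\<omega>\<in>space M. \<bar>V \<omega> - x\<bar> \<le> r} \<le> (r / l + 1) * q" for x
    by (rule concentration_cover[OF V l r q])
  let ?g = "\<lambda>x. 1 + x * stein_sol z x"
  have fm: "stein_sol z \<in> borel_measurable borel"
    using stein_sol_cont by (rule borel_measurable_continuous_onI)
  have g: "mono ?g" using stein_mult_mono[of z] by (simp add: mono_def)
  have gb: "0 \<le> ?g x" "?g x \<le> 2" for x using stein_mult_bound[of x z] by (auto simp: abs_le_iff)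
  have gm: "?g \<in> borel_measurable borel" using fm by measurable
  have 1: "expectation (\<lambda>\<omega>. ?g (V \<omega> + r) - ?g (V \<omega> - r)) \<le> 2 * ((r / l + 1) * q)"
    by (rule expectation_mono_shift[OF V r g gb gm _ qr]) auto
  have meas: "{\<omega>\<in>space M. \<bar>V \<omega> - z\<bar> \<le> r} \<in> sets M" using V by measurable
  have gi: "integrable M (\<lambda>\<omega>. ?g (V \<omega> + r) - ?g (V \<omega> - r))"
  proof (rule integrable_const_bound[of _ 2])
    show "AE \<omega> in M. norm (?g (V \<omega> + r) - ?g (V \<omega> - r)) \<le> 2"
      using gb by (intro AE_I2) (smt (verit) real_norm_def)
  qed (use V fm in measurable)
  have ind: "integrable M (indicator {\<omega>\<in>space M. \<bar>V \<omega> - z\<bar> \<le> r} :: _ \<Rightarrow> real)"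
    using meas by (intro integrable_real_indicator) (auto simp: emeasure_eq_measure)
  have "expectation (\<lambda>\<omega>. stein_osc z (V \<omega>) r) = expectation (\<lambda>\<omega>. (?g (V \<omega> + r) - ?g (V \<omega> - r))
     + indicator {\<omega>\<in>space M. \<bar>V \<omega> - z\<bar> \<le> r} \<omega>)"
    using r by (intro Bochner_Integration.integral_cong) (auto simp: stein_osc_def indicator_def)
  also have "\<dots> = expectation (\<lambda>\<omega>. ?g (V \<omega> + r) - ?g (V \<omega> - r)) + prob {\<omega>\<in>space M. \<bar>V \<omega> - z\<bar> \<le> r}"
    using gi ind by (subst Bochner_Integration.integral_add) (auto simp: Int_absorb2 Collect_restrict)
  also have "\<dots> \<le> 2 * ((r / l + 1) * q) + (r / l + 1) * q" using 1 qr by (intro add_mono)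
  also have "\<dots> = 3 * q + (3 * q / l) * r" by (simp add: algebra_simps)
  finally show ?thesis .
qed

text \<open>By \<open>small\<close>, deleting up to \<open>k + 1\<close> windows removes a part of
  mean square norm at most \<open>1 / 4\<close>, so the thinned sums keep a second moment of order
  one.\<close>

locale stein_array_normalised = stein_array +
  assumes variance_one: "expectation (\<lambda>\<omega>. (W {1..N} \<omega>)\<^sup>2) = 1"
    and small: "(real k + 1) * L * \<beta> \<le> 1 / 4"
    and N_pos: "1 \<le> N"
begin

text \<open>The deleted part has second moment at most \<open>1 / 16\<close>. Then
  \<open>(x + y)\<^sup>2 \<le> 3/2 * x\<^sup>2 + 3 * y\<^sup>2\<close> leaves at least
  \<open>(1 - 3/16) * 2/3\<close>, which is above \<open>1 / 2\<close>; conversely the second moment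
  is at most \<open>3\<close>, and the first absolute moment follows.\<close>

lemma W_square_lower:
  assumes J: "J \<subseteq> {1..N}" and m: "real (card ({1..N} - J)) * \<beta> \<le> 1 / 4"
  shows "1 / 2 \<le> expectation (\<lambda>\<omega>. (W J \<omega>)\<^sup>2)" "expectation (\<lambda>\<omega>. \<bar>W J \<omega>\<bar>) \<le> 2"
proof -
  let ?C = "{1..N} - J"
  have C: "?C \<subseteq> {1..N}" by auto
  have "(real (card ?C))\<^sup>2 * \<beta>\<^sup>2 = (real (card ?C) * \<beta>)\<^sup>2" by (simp add: power_mult_distrib)
  also have "\<dots> \<le> (1 / 4)\<^sup>2" using m \<beta> by (intro power_mono) auto
  finally have c: "expectation (\<lambda>\<omega>. (W ?C \<omega>)\<^sup>2) \<le> 1 / 16"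
    using W_square(3)[OF C] by (simp add: power2_eq_square)
  note i = W_square(1)[OF J] W_square(1)[OF C] W_square(1)[OF order_refl]
  have split: "W {1..N} \<omega> = W J \<omega> + W ?C \<omega>" for \<omega>
    using W_diff[of "{1..N}" \<omega> ?C] J by (simp add: double_diff Int_absorb1)
  have "(W {1..N} \<omega>)\<^sup>2 \<le> 3/2 * (W J \<omega>)\<^sup>2 + 3 * (W ?C \<omega>)\<^sup>2" for \<omega>
  proof -
    have "0 \<le> (W J \<omega> - 2 * W ?C \<omega>)\<^sup>2" by simp
    then show ?thesis unfolding split by (simp add: power2_eq_square algebra_simps)
  qed
  then have "expectation (\<lambda>\<omega>. (W {1..N} \<omega>)\<^sup>2) \<le> expectation (\<lambda>\<omega>. 3/2 * (W J \<omega>)\<^sup>2 + 3 * (W ?C \<omega>)\<^sup>2)"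
    using i by (intro integral_mono) auto
  also have "\<dots> = 3/2 * expectation (\<lambda>\<omega>. (W J \<omega>)\<^sup>2) + 3 * expectation (\<lambda>\<omega>. (W ?C \<omega>)\<^sup>2)" using i by simp
  finally show "1 / 2 \<le> expectation (\<lambda>\<omega>. (W J \<omega>)\<^sup>2)" using c variance_one by simp
  have "(W J \<omega>)\<^sup>2 \<le> 2 * (W {1..N} \<omega>)\<^sup>2 + 2 * (W ?C \<omega>)\<^sup>2" for \<omega>
  proof -
    have "0 \<le> (W {1..N} \<omega> + W ?C \<omega>)\<^sup>2" by simp
    moreover have eq: "W J \<omega> = W {1..N} \<omega> - W ?C \<omega>" using split by simp
    ultimately show ?thesis unfolding eq by (simp add: power2_eq_square algebra_simps)
  qed
  then have "expectation (\<lambda>\<omega>. (W J \<omega>)\<^sup>2) \<le> expectation (\<lambda>\<omega>. 2 * (W {1..N} \<omega>)\<^sup>2 + 2 * (W ?C \<omega>)\<^sup>2)"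
    using i by (intro integral_mono) auto
  also have "\<dots> = 2 * 1 + 2 * expectation (\<lambda>\<omega>. (W ?C \<omega>)\<^sup>2)" using i variance_one by simp
  finally have u: "expectation (\<lambda>\<omega>. (W J \<omega>)\<^sup>2) \<le> 3" using c by simp
  have "\<bar>W J \<omega>\<bar> \<le> ((W J \<omega>)\<^sup>2 + 1) / 2" for \<omega>
  proof -
    have "0 \<le> (\<bar>W J \<omega>\<bar> - 1)\<^sup>2" by simp
    then show ?thesis by (simp add: power2_eq_square algebra_simps)
  qed
  then have "expectation (\<lambda>\<omega>. \<bar>W J \<omega>\<bar>) \<le> expectation (\<lambda>\<omega>. ((W J \<omega>)\<^sup>2 + 1) / 2)"
    using i W_integrable[OF J] by (intro integral_mono) auto
  also have "\<dots> = (expectation (\<lambda>\<omega>. (W J \<omega>)\<^sup>2) + 1) / 2" using i by (simp add: prob_space)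
  finally show "expectation (\<lambda>\<omega>. \<bar>W J \<omega>\<bar>) \<le> 2" using u by simp
qed

text \<open>Uniform in the deleted indices, the remainder and the centre of the interval, so that
  each \<open>U J j i\<close> arising from the Stein identity is again covered, with one more window
  deleted.\<close>

definition concentrated :: "real \<Rightarrow> nat \<Rightarrow> real \<Rightarrow> bool" where
  "concentrated l n q \<longleftrightarrow> (\<forall>J D x. J \<subseteq> {1..N} \<longrightarrow> real (card ({1..N} - J)) \<le> n * L \<longrightarrow> D \<in> remainders \<longrightarrow>
     prob {\<omega>\<in>space M. \<bar>W J \<omega> + D \<omega> - x\<bar> \<le> l} \<le> q)"

lemma U_concentrated:
  assumes con: "concentrated l (Suc n) q" and J: "J \<subseteq> {1..N}" "real (card ({1..N} - J)) \<le> n * L"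
    and j: "j \<in> {1..N}" and i: "i \<in> {2..Suc k}"
  shows "prob {\<omega>\<in>space M. \<bar>U J j i \<omega> - x\<bar> \<le> l} \<le> q"
proof -
  have "{1..N} - (J - win i j) = ({1..N} - J) \<union> win i j" using win_sub by auto
  then have "card ({1..N} - (J - win i j)) \<le> card ({1..N} - J) + card (win i j)" by (simp add: card_Un_le)
  then have "real (card ({1..N} - (J - win i j))) \<le> real (card ({1..N} - J)) + real (card (win i j))" by linarith
  also have "\<dots> \<le> real (Suc n) * L" using J(2) card_win[of i j] i by (simp add: algebra_simps)
  finally have "real (card ({1..N} - (J - win i j))) \<le> real (Suc n) * L" .
  moreover have "\<Delta>loc j \<in> remainders" using j by (auto simp: remainders_def)
  moreover have "J - win i j \<subseteq> {1..N}" using J(1) by blast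
  ultimately show ?thesis using con unfolding concentrated_def U_def by blast
qed

lemma T_concentrated:
  assumes con: "concentrated l (Suc n) q" and J: "J \<subseteq> {1..N}" "real (card ({1..N} - J)) \<le> n * L" and D: "D \<in> remainders"
  shows "prob {\<omega>\<in>space M. \<bar>W J \<omega> + D \<omega> - x\<bar> \<le> l} \<le> q"
proof -
  have "real (card ({1..N} - J)) \<le> Suc n * L" using J(2) L by (simp add: algebra_simps)
  then show ?thesis using con J(1) D unfolding concentrated_def by blast
qed

text \<open>The trapezoid majorises the indicator of the interval of radius \<open>l\<close>, and
  its primitive is at most \<open>3 * l\<close>, so that the expectation of \<open>W J * f\<close>
  is at most \<open>6 * l\<close>. Dividing by a second moment of at least \<open>1 / 2\<close>
  doubles this and the Stein error.\<close>

lemma concentrated_step: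
  assumes con: "concentrated l (Suc n) q" and l: "0 < l" "l \<le> 1" and q: "0 \<le> q" and n: "n \<le> k"
  shows "concentrated l n (12 * l + 2 * stein_error 0 (7 * q / l))"
  unfolding concentrated_def
proof (intro allI impI)
  fix J D x assume J: "J \<subseteq> {1..N}" and cJ: "real (card ({1..N} - J)) \<le> n * L" and D: "D \<in> remainders"
  define f where "f = (\<lambda>y. l * trapezoid_int ((y - x) / l))"
  define f' where "f' = (\<lambda>y. trapezoid ((y - x) / l))"
  have tf: "test_function f f' (trapezoid_osc x l)"
    unfolding f_def f'_def by (rule trapezoid_test_function[OF l])
  note tfD = test_functionD[OF tf]
  let ?T = "\<lambda>\<omega>. W J \<omega> + D \<omega>"
  have Tm: "?T \<in> borel_measurable M" using W_measM[OF J] remainders_meas[OF D] by measurable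
  have "real (card ({1..N} - J)) * \<beta> \<le> (n * L) * \<beta>" using cJ \<beta> by (intro mult_right_mono) auto
  also have "\<dots> \<le> (real k + 1) * L * \<beta>" using n L \<beta> by (intro mult_right_mono) auto
  finally have m: "real (card ({1..N} - J)) * \<beta> \<le> 1 / 4" using small by linarith
  note W2 = W_square_lower[OF J m]
  have H: "expectation (\<lambda>\<omega>. trapezoid_osc x l (U J j i \<omega>) r) \<le> 0 + (7 * q / l) * r"
    if "j \<in> {1..N}" "i \<in> {2..Suc k}" "0 \<le> r" for i j r
    using that by (intro expectation_trapezoid_osc U_measM J l U_concentrated[OF con J cJ]) auto
  have HT: "expectation (\<lambda>\<omega>. trapezoid_osc x l (?T \<omega>) r) \<le> 0 + (7 * q / l) * r" if "0 \<le> r" for r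
    using that by (intro expectation_trapezoid_osc Tm l T_concentrated[OF con J cJ D]) auto
  have "\<bar>expectation (\<lambda>\<omega>. W J \<omega> * f (?T \<omega>)) - expectation (\<lambda>\<omega>. (W J \<omega>)\<^sup>2) * expectation (\<lambda>\<omega>. f' (?T \<omega>))\<bar>
     \<le> stein_error 0 (7 * q / l)"
    by (rule approximate_stein_identity[OF tf J D H HT]) (use q l in auto)
  moreover have "\<bar>expectation (\<lambda>\<omega>. W J \<omega> * f (?T \<omega>))\<bar> \<le> 6 * l"
  proof -
    have "\<bar>expectation (\<lambda>\<omega>. W J \<omega> * f (?T \<omega>))\<bar> \<le> expectation (\<lambda>\<omega>. 3 * l * \<bar>W J \<omega>\<bar>)"
    proof (rule dominated(2))
      show "\<bar>W J \<omega> * f (?T \<omega>)\<bar> \<le> 3 * l * \<bar>W J \<omega>\<bar>" for \<omega>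
      proof -
        have "\<bar>f y\<bar> \<le> 3 * l" for y
          using trapezoid_int_bounds[of "(y - x) / l"] l by (simp add: f_def abs_mult)
        from mult_left_mono[OF this[of "?T \<omega>"], of "\<bar>W J \<omega>\<bar>"] show ?thesis by (simp add: abs_mult mult_ac)
      qed
    qed (use W_integrable[OF J] W_measM[OF J] Tm tfD(1) in auto)
    also have "\<dots> \<le> 6 * l" using W2(2) l by simp
    finally show ?thesis .
  qed
  moreover have "prob {\<omega>\<in>space M. \<bar>?T \<omega> - x\<bar> \<le> l} \<le> expectation (\<lambda>\<omega>. f' (?T \<omega>))"
  proof -
    have meas: "{\<omega>\<in>space M. \<bar>?T \<omega> - x\<bar> \<le> l} \<in> sets M" using Tm by measurable
    have "prob {\<omega>\<in>space M. \<bar>?T \<omega> - x\<bar> \<le> l} = expectation (indicator {\<omega>\<in>space M. \<bar>?T \<omega> - x\<bar> \<le> l})"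
      by (simp add: Int_absorb2 Collect_restrict)
    also have "\<dots> \<le> expectation (\<lambda>\<omega>. f' (?T \<omega>))"
    proof (rule integral_mono)
      show "integrable M (indicator {\<omega>\<in>space M. \<bar>?T \<omega> - x\<bar> \<le> l} :: _ \<Rightarrow> real)"
        using meas by (intro integrable_real_indicator) (auto simp: emeasure_eq_measure)
      show "integrable M (\<lambda>\<omega>. f' (?T \<omega>))"
        using Tm tfD(2,4) by (intro integrable_const_bound[of _ 2]) auto
      show "indicator {\<omega>\<in>space M. \<bar>?T \<omega> - x\<bar> \<le> l} \<omega> \<le> f' (?T \<omega>)" for \<omega>
        using trapezoid_bounds(1,3)[of "(?T \<omega> - x) / l"] l by (auto simp: f'_def indicator_def)
    qed
    finally show ?thesis .
  qed
  moreover have "1 / 2 * expectation (\<lambda>\<omega>. f' (?T \<omega>)) \<le> expectation (\<lambda>\<omega>. (W J \<omega>)\<^sup>2) * expectation (\<lambda>\<omega>. f' (?T \<omega>))"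
    using W2(1) trapezoid_bounds(1) by (intro mult_right_mono Bochner_Integration.integral_nonneg) (auto simp: f'_def)
  ultimately show "prob {\<omega>\<in>space M. \<bar>?T \<omega> - x\<bar> \<le> l} \<le> 12 * l + 2 * stein_error 0 (7 * q / l)" by linarith
qed

text \<open>Since \<open>2128 = 2 * (2 * 76 * 7)\<close>, the term with
  \<open>c1 = 7 * q / scale\<close> contributes exactly \<open>q / 2\<close> to
  \<open>2 * stein_error\<close>.\<close>

definition scale :: real where "scale = 2128 * (real N * L ^ 3 * \<beta> ^ 3)"

text \<open>The part of \<open>12 * scale + 2 * stein_error\<close> that is free of
  \<open>q\<close>; the thirteenth \<open>scale\<close> absorbs the term
  \<open>L ^ 3 * \<beta> ^ 3\<close>.\<close>

definition base_error :: real where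
  "base_error = 13 * scale + 152 * (real N * (\<beta> * d + L\<^sup>2 * c)) + 8 * (real N ^ 4 * c)"

lemma scale_pos: "0 < scale" using N_pos L \<beta> by (simp add: scale_def)

lemma base_error_nonneg: "0 \<le> base_error"
  using scale_pos L \<beta> c_d_nonneg by (simp add: base_error_def)

text \<open>At scale \<open>scale\<close> the contribution of \<open>q\<close> to the error is at most \<open>q / 2\<close>, so the bound can be
  iterated, each time removing one more window from the sum.\<close>

lemma concentrated_iterate:
  assumes l: "scale \<le> 1" and "m \<le> k"
  shows "concentrated scale (Suc k - m) (2 * base_error + 1 / 2 ^ m)"
  using assms(2)
proof (induction m)
  case 0
  have "prob A \<le> 2 * base_error + 1 / 2 ^ 0" for A
  proof -
    have "prob A \<le> 1" by (rule prob_le_1)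
    also have "1 \<le> 2 * base_error + 1 / 2 ^ 0" using base_error_nonneg by simp
    finally show ?thesis .
  qed
  then show ?case unfolding concentrated_def by blast
next
  case (Suc m)
  \<comment> \<open>\<open>2 * base_error\<close> is the fixed point of
    \<open>q \<mapsto> base_error + q / 2\<close>, and the excess over it is halved in each round,
    starting from the trivial bound \<open>1\<close>.\<close>
  let ?q = "2 * base_error + 1 / 2 ^ m"
  have "Suc k - m = Suc (k - m)" using Suc by auto
  then have "concentrated scale (k - m) (12 * scale + 2 * stein_error 0 (7 * ?q / scale))"
    using Suc base_error_nonneg by (intro concentrated_step scale_pos l) auto
  moreover have "12 * scale + 2 * stein_error 0 (7 * ?q / scale) \<le> 2 * base_error + 1 / 2 ^ Suc m"
  proof -
    have "152 * (real N * (L ^ 3 * (7 * ?q / scale) * \<beta> ^ 3)) = ?q / scale * (scale / 2)"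
      by (simp add: scale_def)
    also have "\<dots> = ?q / 2" using scale_pos by simp
    finally have 1: "152 * (real N * (L ^ 3 * (7 * ?q / scale) * \<beta> ^ 3)) = ?q / 2" .
    have 2: "152 * (real N * (L ^ 3 * \<beta> ^ 3)) \<le> scale" 
      using L \<beta> by (simp add: scale_def mult_right_mono mult.assoc)
    have "12 * scale + 2 * stein_error 0 (7 * ?q / scale) = 12 * scale + 152 * (real N * (\<beta> * d + L\<^sup>2 * c))
      + 152 * (real N * (L ^ 3 * (7 * ?q / scale) * \<beta> ^ 3)) + 152 * (real N * (L ^ 3 * \<beta> ^ 3)) + 8 * (real N ^ 4 * c)"
      unfolding stein_error_def term_error_def by (simp add: algebra_simps)
    also have "\<dots> \<le> base_error + ?q / 2" unfolding 1 using 2 by (simp add: base_error_def)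
    also have "\<dots> = 2 * base_error + 1 / 2 ^ Suc m" by simp
    finally show ?thesis .
  qed
  ultimately show ?case unfolding concentrated_def by (auto intro: order_trans)
qed

text \<open>Stein's equation at \<open>T = W + \<Delta>\<close> involves \<open>T * f T\<close>,
  whereas the approximate identity controls \<open>W * f T\<close>. The difference
  \<open>\<Delta> * f T\<close>, with \<open>\<bar>f\<bar> \<le> 3\<close>, is the source of the
  first moment of \<open>\<Delta>\<close>. The value \<open>q\<close> is reached after
  \<open>k\<close> rounds because \<open>1 / 2 ^ k \<le> \<beta>\<close>; one deletable window must
  then be left for the centres \<open>U\<close>, hence the level \<open>Suc 0\<close>.\<close>

theorem berry_esseen:
  assumes l: "scale \<le> 1" and \<Delta>i: "integrable M \<Delta>"
  defines "q \<equiv> 2 * base_error + \<beta>"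
  shows "\<bar>prob {\<omega>\<in>space M. W {1..N} \<omega> + \<Delta> \<omega> < z} - std_normal_cdf z\<bar>
    \<le> stein_error (3 * q) (3 * q / scale) + 3 * expectation (\<lambda>\<omega>. \<bar>\<Delta> \<omega>\<bar>)"
proof -
  have "1 / 2 ^ k \<le> \<beta>" using \<beta>(3) by (simp add: divide_le_eq mult.commute)
  then have "2 * base_error + 1 / 2 ^ k \<le> q" by (simp add: q_def)
  then have con: "concentrated scale (Suc 0) q"
    using concentrated_iterate[OF l, of k] unfolding concentrated_def by (auto intro: order_trans)
  have q0: "0 \<le> q" using base_error_nonneg \<beta> by (simp add: q_def)
  define f where "f = stein_sol z"
  have tf: "test_function f (stein_deriv z) (stein_osc z)" unfolding f_def by (rule stein_test_function)
  note tfD = test_functionD[OF tf]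
  let ?J = "{1..N}"
  let ?T = "\<lambda>\<omega>. W ?J \<omega> + \<Delta> \<omega>"
  have D: "\<Delta> \<in> remainders" by (simp add: remainders_def)
  have J: "?J \<subseteq> {1..N}" "real (card ({1..N} - ?J)) \<le> real 0 * L" by auto
  have Tm: "?T \<in> borel_measurable M" using W_measM[OF J(1)] remainders_meas[OF D] by measurable
  have H: "expectation (\<lambda>\<omega>. stein_osc z (U ?J j i \<omega>) r) \<le> 3 * q + (3 * q / scale) * r"
    if "j \<in> {1..N}" "i \<in> {2..Suc k}" "0 \<le> r" for i j r
    using that by (intro expectation_stein_osc U_measM J scale_pos U_concentrated[OF con J]) auto
  have HT: "expectation (\<lambda>\<omega>. stein_osc z (?T \<omega>) r) \<le> 3 * q + (3 * q / scale) * r" if "0 \<le> r" for r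
    using that by (intro expectation_stein_osc Tm scale_pos T_concentrated[OF con J D]) auto
  have main: "\<bar>expectation (\<lambda>\<omega>. W ?J \<omega> * f (?T \<omega>)) - 1 * expectation (\<lambda>\<omega>. stein_deriv z (?T \<omega>))\<bar>
     \<le> stein_error (3 * q) (3 * q / scale)"
    unfolding variance_one[symmetric]
    by (rule approximate_stein_identity[OF tf J(1) D H HT]) (use q0 scale_pos in auto)
  have fm: "(\<lambda>\<omega>. f (?T \<omega>)) \<in> borel_measurable M" using Tm tfD(1) by measurable
  have fb: "\<bar>y * f x\<bar> \<le> 3 * \<bar>y\<bar>" for x y
    using mult_left_mono[OF tfD(3)[of x], of "\<bar>y\<bar>"] by (simp add: abs_mult mult.commute)
  have Wi: "integrable M (\<lambda>\<omega>. W ?J \<omega> * f (?T \<omega>))"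
    by (rule dominated(1)[of _ "\<lambda>\<omega>. 3 * \<bar>W ?J \<omega>\<bar>"]) (use fb fm W_measM[OF J(1)] W_integrable[OF J(1)] in auto)
  have \<Delta>fi: "integrable M (\<lambda>\<omega>. \<Delta> \<omega> * f (?T \<omega>))" and \<Delta>f: "\<bar>expectation (\<lambda>\<omega>. \<Delta> \<omega> * f (?T \<omega>))\<bar> \<le> 3 * expectation (\<lambda>\<omega>. \<bar>\<Delta> \<omega>\<bar>)"
  proof -
    have h: "integrable M (\<lambda>\<omega>. 3 * \<bar>\<Delta> \<omega>\<bar>)" using \<Delta>i by auto
    have m: "(\<lambda>\<omega>. \<Delta> \<omega> * f (?T \<omega>)) \<in> borel_measurable M" using fm \<Delta>_measurable by measurable
    show "integrable M (\<lambda>\<omega>. \<Delta> \<omega> * f (?T \<omega>))" "\<bar>expectation (\<lambda>\<omega>. \<Delta> \<omega> * f (?T \<omega>))\<bar> \<le> 3 * expectation (\<lambda>\<omega>. \<bar>\<Delta> \<omega>\<bar>)"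
      using dominated[OF m h fb] by auto
  qed
  have meas: "{\<omega>\<in>space M. ?T \<omega> < z} \<in> sets M" using Tm by measurable
  have ind: "integrable M (indicator {\<omega>\<in>space M. ?T \<omega> < z} :: _ \<Rightarrow> real)"
    using meas by (intro integrable_real_indicator) (auto simp: emeasure_eq_measure)
  have "expectation (\<lambda>\<omega>. stein_deriv z (?T \<omega>)) = expectation (\<lambda>\<omega>. W ?J \<omega> * f (?T \<omega>) + \<Delta> \<omega> * f (?T \<omega>)
     + indicator {\<omega>\<in>space M. ?T \<omega> < z} \<omega> - std_normal_cdf z)"
    by (intro Bochner_Integration.integral_cong)
      (auto simp: stein_deriv_def f_def indicator_def distrib_right)
  also have "\<dots> = expectation (\<lambda>\<omega>. W ?J \<omega> * f (?T \<omega>)) + expectation (\<lambda>\<omega>. \<Delta> \<omega> * f (?T \<omega>))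
     + prob {\<omega>\<in>space M. ?T \<omega> < z} - std_normal_cdf z"
    using Wi \<Delta>fi ind by (simp add: prob_space Int_absorb2 Collect_restrict)
  finally show ?thesis using main \<Delta>f by linarith
qed

end

section \<open>Mixing sequences\<close>

lemma sets_gen_sigma:
  "sets (gen_sigma M E X I) = sigma_sets (space M) (\<Union>j\<in>I. {X j -` B \<inter> space M | B. B \<in> sets (E j)})"
  "space (gen_sigma M E X I) = space M"
  unfolding gen_sigma_def by (auto simp: sets_measure_of_conv space_measure_of_conv)

lemma sets_gen_sigma_mono: "I \<subseteq> J \<Longrightarrow> sets (gen_sigma M E X I) \<subseteq> sets (gen_sigma M E X J)"
  unfolding sets_gen_sigma by (intro sigma_sets_mono') blast

lemma sets_gen_sigma_Un:
  assumes "I \<subseteq> J \<union> J'"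
  shows "sets (gen_sigma M E X I) \<subseteq> sigma_sets (space M) (sets (gen_sigma M E X J) \<union> sets (gen_sigma M E X J'))"
  unfolding sets_gen_sigma
proof (rule sigma_sets_mono, rule subsetI)
  fix A assume "A \<in> (\<Union>j\<in>I. {X j -` B \<inter> space M | B. B \<in> sets (E j)})"
  then obtain j where j: "j \<in> I" "A \<in> {X j -` B \<inter> space M | B. B \<in> sets (E j)}" by blast
  then have "A \<in> (\<Union>j\<in>J. {X j -` B \<inter> space M | B. B \<in> sets (E j)}) \<or> A \<in> (\<Union>j\<in>J'. {X j -` B \<inter> space M | B. B \<in> sets (E j)})"
    using assms by blast
  then show "A \<in> sigma_sets (space M) (sigma_sets (space M) (\<Union>j\<in>J. {X j -` B \<inter> space M | B. B \<in> sets (E j)}) \<union>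
      sigma_sets (space M) (\<Union>j\<in>J'. {X j -` B \<inter> space M | B. B \<in> sets (E j)}))"
    by (metis (no_types, lifting) UnI1 UnI2 sigma_sets.Basic)
qed

context nonlinear_statistic
begin

text \<open>Intersecting with \<open>{1..}\<close> makes this a sub-sigma-algebra of
  \<open>M\<close> for every \<open>I\<close>, since measurability of \<open>X j\<close> is assumed
  for \<open>j \<ge> 1\<close>.\<close>

abbreviation "\<S>X I \<equiv> gen_sigma M E X (I \<inter> {1..})"

lemma subalgebra_gen_sigma: "subalgebra M (\<S>X I)"
  unfolding subalgebra_def sets_gen_sigma
proof (intro conjI sets.sigma_sets_subset subsetI refl)
  fix A assume "A \<in> (\<Union>j\<in>I \<inter> {1..}. {X j -` B \<inter> space M | B. B \<in> sets (E j)})"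
  then show "A \<in> sets M" using X_measurable by (auto intro: measurable_sets)
qed

lemma X_gen_sigma: "j \<in> I \<Longrightarrow> 1 \<le> j \<Longrightarrow> X j \<in> measurable (\<S>X I) (E j)"
proof (rule measurableI)
  assume j: "j \<in> I" "1 \<le> j"
  show "X j x \<in> space (E j)" if "x \<in> space (\<S>X I)" for x
    using that X_measurable[OF j(2)] by (auto simp: sets_gen_sigma dest: measurable_space)
  show "X j -` A \<inter> space (\<S>X I) \<in> sets (\<S>X I)" if "A \<in> sets (E j)" for A
    unfolding sets_gen_sigma using that j by (intro sigma_sets.Basic) auto
qed

text \<open>A supremum of reals dominates its members only if the family is bounded above, so the
  three nested suprema are first bounded by \<open>1\<close>. Multiplying the conditional bound by
  \<open>prob A\<close> gives the form used in \<open>decoupled_of_phi\<close>; null events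
  \<open>A\<close>, over which the supremum does not range, are treated apart.\<close>

lemma phi_mixing_bound:
  assumes A: "A \<in> sets (gen_sigma M E X {1..k})" and B: "B \<in> sets (gen_sigma M E X {k + m..})"
    and k: "1 \<le> k" and phi: "phi_mixing M E X m \<le> \<eta>" and m: "1 \<le> m"
  shows "\<bar>prob (A \<inter> B) - prob A * prob B\<bar> \<le> \<eta> * prob A"
proof (cases "prob A = 0")
  case True
  have AM: "A \<in> sets M" using A subalgebra_gen_sigma[of "{1..k}"] by (auto simp: subalgebra_def Int_absorb2)
  have "prob (A \<inter> B) = 0" using finite_measure_mono[OF _ AM, of "A \<inter> B"] True by (simp add: measure_le_0_iff)
  then show ?thesis using True by simp
next
  case False
  then have pA: "prob A > 0" using measure_nonneg[of M A] by linarith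
  have AM: "A \<in> sets M" using A subalgebra_gen_sigma[of "{1..k}"] by (auto simp: subalgebra_def Int_absorb2)
  have "{k + m..} \<inter> {1..} = {k + m..}" using m by auto
  then have sBM: "B' \<in> sets M" if "B' \<in> sets (gen_sigma M E X {k + m..})" for B'
    using that subalgebra_gen_sigma[of "{k + m..}"] by (auto simp: subalgebra_def)
  let ?h = "\<lambda>A B. \<bar>\<P>(\<omega> in M. \<omega> \<in> B \<bar> \<omega> \<in> A) - measure M B\<bar>"
  have h1: "?h A' B' \<le> 1" for A' B'
  proof -
    have "{\<omega>\<in>space M. \<omega> \<in> A'} \<in> sets M" if "prob {\<omega>\<in>space M. \<omega> \<in> A'} \<noteq> 0"
      using that measure_notin_sets by blast
    then have "prob {\<omega>\<in>space M. \<omega> \<in> B' \<and> \<omega> \<in> A'} \<le> prob {\<omega>\<in>space M. \<omega> \<in> A'}"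
      if "prob {\<omega>\<in>space M. \<omega> \<in> A'} \<noteq> 0"
      using that by (intro finite_measure_mono) auto
    then have "0 \<le> \<P>(\<omega> in M. \<omega> \<in> B' \<bar> \<omega> \<in> A')" "\<P>(\<omega> in M. \<omega> \<in> B' \<bar> \<omega> \<in> A') \<le> 1"
      by (auto simp: cond_prob_def divide_le_eq_1 zero_less_measure_iff)
    then show ?thesis using prob_le_1[of B'] measure_nonneg[of M B'] by linarith
  qed
  let ?SA = "\<lambda>k. {A \<in> sets (gen_sigma M E X {1..k}). measure M A > 0}"
  let ?SB = "\<lambda>k. sets (gen_sigma M E X {k + m..})"
  have ne: "?SA k \<noteq> {}" "?SB k \<noteq> {}" for k
  proof -
    have "space M \<in> ?SA k" using sets.top[of "gen_sigma M E X {1..k}"] by (simp add: sets_gen_sigma prob_space)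
    then show "?SA k \<noteq> {}" by blast
    show "?SB k \<noteq> {}" by auto
  qed
  have b1: "bdd_above (?h A' ` ?SB k)" for A' k using h1 by (intro bdd_aboveI2[of _ _ 1])
  have i1: "(SUP B\<in>?SB k. ?h A' B) \<le> 1" for A' k by (rule cSUP_least[OF ne(2) h1])
  have b2: "bdd_above ((\<lambda>A. SUP B\<in>?SB k. ?h A B) ` ?SA k)" for k using i1 by (intro bdd_aboveI2[of _ _ 1])
  have i2: "(SUP A\<in>?SA k. SUP B\<in>?SB k. ?h A B) \<le> 1" for k by (rule cSUP_least[OF ne(1) i1])
  have b3: "bdd_above ((\<lambda>k. SUP A\<in>?SA k. SUP B\<in>?SB k. ?h A B) ` {1..})" using i2 by (intro bdd_aboveI2[of _ _ 1])
  have "?h A B \<le> (SUP B\<in>?SB k. ?h A B)" using B by (intro cSUP_upper b1)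
  also have "\<dots> \<le> (SUP A\<in>?SA k. SUP B\<in>?SB k. ?h A B)" using A pA by (intro cSUP_upper[OF _ b2]) auto
  also have "\<dots> \<le> phi_mixing M E X m" unfolding phi_mixing_def using k by (intro cSUP_upper[OF _ b3]) auto
  finally have "?h A B \<le> \<eta>" using phi by linarith
  moreover have "\<P>(\<omega> in M. \<omega> \<in> B \<bar> \<omega> \<in> A) = prob (A \<inter> B) / prob A"
  proof -
    have "{\<omega>\<in>space M. \<omega> \<in> B \<and> \<omega> \<in> A} = A \<inter> B" "{\<omega>\<in>space M. \<omega> \<in> A} = A"
      using sets.sets_into_space[OF AM] by auto
    then show ?thesis by (simp add: cond_prob_def)
  qed
  ultimately have "\<bar>prob (A \<inter> B) / prob A - prob B\<bar> \<le> \<eta>" by simp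
  then have "\<bar>prob (A \<inter> B) / prob A - prob B\<bar> * prob A \<le> \<eta> * prob A" by (intro mult_right_mono) auto
  moreover have "\<bar>prob (A \<inter> B) / prob A - prob B\<bar> * prob A = \<bar>prob (A \<inter> B) - prob A * prob B\<bar>"
  proof -
    have "\<bar>prob (A \<inter> B) / prob A - prob B\<bar> * prob A = \<bar>(prob (A \<inter> B) / prob A - prob B) * prob A\<bar>"
      by (simp add: abs_mult)
    also have "(prob (A \<inter> B) / prob A - prob B) * prob A = prob (A \<inter> B) - prob A * prob B"
      using pA by (simp add: field_simps)
    finally show ?thesis .
  qed
  ultimately show ?thesis by simp
qed

lemma phi_mixing_nonneg:
  assumes phi: "phi_mixing M E X m \<le> \<eta>" and m: "1 \<le> m"
  shows "0 \<le> \<eta>"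
proof -
  have "\<bar>prob (space M \<inter> space M) - prob (space M) * prob (space M)\<bar> \<le> \<eta> * prob (space M)"
    using sets.top[of "gen_sigma M E X {1..1}"] sets.top[of "gen_sigma M E X {1 + m..}"]
    by (intro phi_mixing_bound[OF _ _ _ phi m, of _ 1]) (auto simp: sets_gen_sigma)
  then show ?thesis by (simp add: prob_space)
qed

lemma decoupled_empty:
  assumes "0 \<le> \<eta>"
  shows "decoupled (\<S>X {}) (\<S>X J) \<eta>"
proof (rule decoupled_of_phi[OF subalgebra_gen_sigma subalgebra_gen_sigma])
  fix A B assume A: "A \<in> sets (\<S>X {})" and B: "B \<in> sets (\<S>X J)"
  have "A \<in> {{}, space M}" using A by (auto simp: sets_gen_sigma sigma_sets_empty_eq)
  moreover have "B \<in> sets M" using B subalgebra_gen_sigma[of J] by (auto simp: subalgebra_def)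
  ultimately show "\<bar>prob (A \<inter> B) - prob A * prob B\<bar> \<le> \<eta> * prob A"
    using assms prob_space sets.sets_into_space[of B M] by (auto simp: Int_absorb1)
qed

text \<open>An empty past (\<open>k = 0\<close>) is not covered by the definition of the mixing coefficient and is treated
  separately.\<close>

lemma decoupled_past_future:
  assumes F: "k \<noteq> 0 \<Longrightarrow> J \<subseteq> {k + m..}" and I: "I \<subseteq> {1..k}" and phi: "phi_mixing M E X m \<le> \<eta>" and m: "1 \<le> m"
  shows "decoupled (\<S>X I) (\<S>X J) \<eta>"
proof (cases "k = 0")
  case True
  then have "I = {}" using I by simp
  then show ?thesis using decoupled_empty phi_mixing_nonneg[OF phi m] by blast
next
  case False
  show ?thesis
  proof (rule decoupled_of_phi[OF subalgebra_gen_sigma subalgebra_gen_sigma])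
    fix A B assume A: "A \<in> sets (\<S>X I)" and B: "B \<in> sets (\<S>X J)"
    have "A \<in> sets (gen_sigma M E X {1..k})" "B \<in> sets (gen_sigma M E X {k + m..})"
      using A B I F[OF False] sets_gen_sigma_mono[of "I \<inter> {1..}" "{1..k}"] sets_gen_sigma_mono[of "J \<inter> {1..}" "{k + m..}"]
      by blast+
    then show "\<bar>prob (A \<inter> B) - prob A * prob B\<bar> \<le> \<eta> * prob A"
      using False by (intro phi_mixing_bound[OF _ _ _ phi m]) auto
  qed
qed

lemma decoupled_window:
  assumes phi: "phi_mixing M E X l \<le> \<eta>" and l: "1 \<le> l"
  shows "decoupled (\<S>X ({j - i * l..j + i * l} \<inter> {1..N})) (\<S>X ({1..N} - {j - Suc i * l..j + Suc i * l} \<inter> {1..N})) (3 * \<eta>)"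
    (is "decoupled (\<S>X ?L) (\<S>X ?Q) _")
proof -
  \<comment> \<open>\<open>a\<close> is the last index to the left of the window of level
    \<open>i + 1\<close>, or \<open>0\<close> if there is none; \<open>b\<close> bounds the window
    of level \<open>i\<close> on the right. From \<open>a\<close> to the inner window, and from
    \<open>b\<close> to the right part of the complement, there are at least \<open>l\<close>
    steps.\<close>
  define a where "a = j - Suc i * l - 1"
  define b where "b = j + i * l"
  have La: "?L \<subseteq> {a + l..}" if "a \<noteq> 0" using that by (auto simp: a_def)
  have Q: "?Q \<inter> {1..} \<subseteq> {1..a} \<inter> {1..} \<union> {b + l..} \<inter> {1..}" by (auto simp: a_def b_def)
  have ab: "a \<le> b" by (simp add: a_def b_def)
  have dPL: "decoupled (\<S>X {1..a}) (\<S>X ?L) \<eta>"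
    by (rule decoupled_past_future[OF La _ phi l]) auto
  show ?thesis
  proof (rule decoupled_two_sided[OF subalgebra_gen_sigma subalgebra_gen_sigma subalgebra_gen_sigma subalgebra_gen_sigma])
    show "decoupled (\<S>X {1..b}) (\<S>X {b + l..}) \<eta>" "decoupled (\<S>X {1..a}) (\<S>X {b + l..}) \<eta>"
      by (rule decoupled_past_future[OF _ _ phi l, of b]; use ab in auto)+
    show "decoupled (\<S>X {1..a}) (\<S>X ?L) \<eta>" by (rule dPL)
    show "sets (\<S>X {1..a}) \<subseteq> sets (\<S>X {1..b})" "sets (\<S>X ?L) \<subseteq> sets (\<S>X {1..b})"
      using ab by (auto intro!: sets_gen_sigma_mono simp: b_def)
    show "sets (\<S>X ?Q) \<subseteq> sigma_sets (space M) (sets (\<S>X {1..a}) \<union> sets (\<S>X {b + l..}))"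
      by (rule sets_gen_sigma_Un[OF Q])
  qed (simp add: sets_gen_sigma)
qed

end

text \<open>Young's inequality for \<open>\<bar>x\<bar> / B\<close> and
  \<open>\<bar>y\<bar> / G\<close>, integrated: the weights \<open>1/3\<close> and
  \<open>2/3\<close> add up to \<open>1\<close>. Integrability comes from the finiteness of
  \<open>norm_3_2\<close>, which is a value in \<open>ennreal\<close>.\<close>

lemma (in prob_space) holder_3:
  fixes x y :: "'a \<Rightarrow> real"
  assumes x: "x \<in> borel_measurable M" "integrable M (\<lambda>\<omega>. \<bar>x \<omega>\<bar> ^ 3)" "expectation (\<lambda>\<omega>. \<bar>x \<omega>\<bar> ^ 3) \<le> B ^ 3" "0 < B"
    and y: "y \<in> borel_measurable M" "norm_3_2 M y \<le> ennreal G" "0 < G"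
  shows "integrable M (\<lambda>\<omega>. \<bar>x \<omega>\<bar> * \<bar>y \<omega>\<bar>)" "expectation (\<lambda>\<omega>. \<bar>x \<omega>\<bar> * \<bar>y \<omega>\<bar>) \<le> B * G"
proof -
  let ?I = "\<integral>\<^sup>+\<omega>. ennreal (\<bar>y \<omega>\<bar> powr (3/2)) \<partial>M"
  have fin: "?I \<noteq> \<infinity>"
  proof
    assume "?I = \<infinity>"
    then have "norm_3_2 M y = \<infinity>" unfolding norm_3_2_def Let_def by simp
    then show False using y(2) by (simp add: top_unique)
  qed
  have ym: "(\<lambda>\<omega>. \<bar>y \<omega>\<bar> powr (3/2)) \<in> borel_measurable M" using y by measurable
  have yi: "integrable M (\<lambda>\<omega>. \<bar>y \<omega>\<bar> powr (3/2))"
    using fin ym by (intro integrableI_bounded) (auto simp: top.not_eq_extremum less_top)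
  have I: "enn2real ?I = expectation (\<lambda>\<omega>. \<bar>y \<omega>\<bar> powr (3/2))"
    using ym by (subst integral_eq_nn_integral) auto
  have "ennreal (enn2real ?I powr (2/3)) \<le> ennreal G"
    using y(2) fin unfolding norm_3_2_def Let_def by simp
  then have "enn2real ?I powr (2/3) \<le> G" using y(3) by (simp add: ennreal_le_iff)
  then have "(enn2real ?I powr (2/3)) powr (3/2) \<le> G powr (3/2)" by (intro powr_mono2) auto
  then have EI: "expectation (\<lambda>\<omega>. \<bar>y \<omega>\<bar> powr (3/2)) \<le> G powr (3/2)" unfolding I by (simp add: powr_powr)
  let ?h = "\<lambda>\<omega>. B * G * (\<bar>x \<omega>\<bar> ^ 3 / B ^ 3 / 3 + 2/3 * (\<bar>y \<omega>\<bar> powr (3/2) / G powr (3/2)))"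
  have hi: "integrable M ?h" using x yi by auto
  have le: "\<bar>x \<omega>\<bar> * \<bar>y \<omega>\<bar> \<le> ?h \<omega>" for \<omega>
  proof -
    have "\<bar>x \<omega>\<bar> / B * (\<bar>y \<omega>\<bar> / G) \<le> (\<bar>x \<omega>\<bar> / B) powr 3 / 3 + (\<bar>y \<omega>\<bar> / G) powr (3/2) / (3/2)"
      using x(4) y(3) by (intro Youngs_inequality) auto
    also have "(\<bar>x \<omega>\<bar> / B) powr 3 = (\<bar>x \<omega>\<bar> / B) ^ 3" using x(4) by (simp add: powr_numeral)
    also have "(\<bar>y \<omega>\<bar> / G) powr (3/2) = \<bar>y \<omega>\<bar> powr (3/2) / G powr (3/2)" using y(3) by (simp add: powr_divide)
    finally have "\<bar>x \<omega>\<bar> / B * (\<bar>y \<omega>\<bar> / G) \<le> \<bar>x \<omega>\<bar> ^ 3 / B ^ 3 / 3 + 2/3 * (\<bar>y \<omega>\<bar> powr (3/2) / G powr (3/2))"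
      by (simp add: power_divide field_simps)
    then have "B * G * (\<bar>x \<omega>\<bar> / B * (\<bar>y \<omega>\<bar> / G)) \<le> ?h \<omega>" using x(4) y(3) by (intro mult_left_mono) auto
    then show ?thesis using x(4) y(3) by simp
  qed
  have xy0: "0 \<le> \<bar>x \<omega>\<bar> * \<bar>y \<omega>\<bar>" for \<omega> by simp
  have m: "(\<lambda>\<omega>. \<bar>x \<omega>\<bar> * \<bar>y \<omega>\<bar>) \<in> borel_measurable M" using x y by measurable
  show i: "integrable M (\<lambda>\<omega>. \<bar>x \<omega>\<bar> * \<bar>y \<omega>\<bar>)"
    by (rule Bochner_Integration.integrable_bound[OF hi m]) (use le in \<open>auto intro!: AE_I2 order_trans[OF _ abs_ge_self]\<close>)
  have "expectation (\<lambda>\<omega>. \<bar>x \<omega>\<bar> * \<bar>y \<omega>\<bar>) \<le> expectation ?h" using i hi le by (intro integral_mono) auto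
  also have "\<dots> = B * G * (expectation (\<lambda>\<omega>. \<bar>x \<omega>\<bar> ^ 3) / B ^ 3 / 3 + 2/3 * (expectation (\<lambda>\<omega>. \<bar>y \<omega>\<bar> powr (3/2)) / G powr (3/2)))"
    using x yi by simp
  also have "\<dots> \<le> B * G * (1 / 3 + 2/3 * 1)"
    using x y EI by (intro mult_left_mono add_mono divide_right_mono) (auto simp: divide_le_eq)
  finally show "expectation (\<lambda>\<omega>. \<bar>x \<omega>\<bar> * \<bar>y \<omega>\<bar>) \<le> B * G" by simp
qed

lemma (in nonlinear_statistic) window_remainder:
  assumes N: "1 \<le> a" "a \<le> b" "b \<le> N" and len: "real b - real a \<le> real N powr \<epsilon>"
    and gam: "gamma_coeff M R' \<epsilon> N \<le> ennreal G" "0 < G"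
    and x: "x \<in> borel_measurable M" "integrable M (\<lambda>\<omega>. \<bar>x \<omega>\<bar> ^ 3)" "expectation (\<lambda>\<omega>. \<bar>x \<omega>\<bar> ^ 3) \<le> B ^ 3" "0 < B"
  shows "integrable M (\<lambda>\<omega>. \<bar>x \<omega>\<bar> * \<bar>R N \<omega> - R' N a b \<omega>\<bar>)"
    "expectation (\<lambda>\<omega>. \<bar>x \<omega>\<bar> * \<bar>R N \<omega> - R' N a b \<omega>\<bar>) \<le> (real b - real a + 1) * (B * G)"
proof -
  have RM: "R N \<in> borel_measurable M"
    using R_measurable[of N] N subalgebra_gen_sigma[of "{1..N}"]
    by (auto simp: Int_absorb2 intro: measurable_from_subalg)
  have R'M: "R' N a m \<in> borel_measurable M" if "a \<le> m" "m \<le> b" for m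
  proof -
    have "{1..N} - {a..m} \<subseteq> {1..}" by auto
    then show ?thesis using R'_measurable[of a m N] N that subalgebra_gen_sigma[of "{1..N} - {a..m}"]
      by (auto simp: Int_absorb2 intro: measurable_from_subalg)
  qed
  have R'M0: "(\<lambda>\<omega>. R' N a (m - 1) \<omega>) \<in> borel_measurable M" if "a \<le> m" "m \<le> b" for m
  proof (cases "m = a")
    case True
    then show ?thesis using RM R'_base[of a N] N by (subst measurable_cong[where g="R N"]) auto
  next
    case False
    then show ?thesis using R'M[of "m - 1"] that by auto
  qed
  have step: "integrable M (\<lambda>\<omega>. \<bar>x \<omega>\<bar> * \<bar>R' N a m \<omega> - R' N a (m - 1) \<omega>\<bar>)"
    "expectation (\<lambda>\<omega>. \<bar>x \<omega>\<bar> * \<bar>R' N a m \<omega> - R' N a (m - 1) \<omega>\<bar>) \<le> B * G" if m: "a \<le> m" "m \<le> b" for m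
  proof -
    let ?S = "{norm_3_2 M (\<lambda>\<omega>. R' N j k \<omega> - R' N j (k - 1) \<omega>) | j k.
            1 \<le> j \<and> j \<le> k \<and> k \<le> N \<and> \<bar>real j - real k\<bar> \<le> real N powr \<epsilon>}"
    have "?S \<subseteq> (\<lambda>(j, k). norm_3_2 M (\<lambda>\<omega>. R' N j k \<omega> - R' N j (k - 1) \<omega>)) ` ({1..N} \<times> {1..N})" by force
    then have fin: "finite ?S" using finite_subset by blast
    have "\<bar>real a - real m\<bar> \<le> real N powr \<epsilon>" using m len by linarith
    then have "norm_3_2 M (\<lambda>\<omega>. R' N a m \<omega> - R' N a (m - 1) \<omega>) \<in> ?S"
      using N m by (intro CollectI exI[of _ a] exI[of _ m]) auto
    then have "norm_3_2 M (\<lambda>\<omega>. R' N a m \<omega> - R' N a (m - 1) \<omega>) \<le> gamma_coeff M R' \<epsilon> N"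
      unfolding gamma_coeff_def using fin by (intro Max_ge)
    then have le: "norm_3_2 M (\<lambda>\<omega>. R' N a m \<omega> - R' N a (m - 1) \<omega>) \<le> ennreal G" using gam(1) by (rule order_trans)
    have ym: "(\<lambda>\<omega>. R' N a m \<omega> - R' N a (m - 1) \<omega>) \<in> borel_measurable M"
      using R'M[OF m] R'M0[OF m] by measurable
    show "integrable M (\<lambda>\<omega>. \<bar>x \<omega>\<bar> * \<bar>R' N a m \<omega> - R' N a (m - 1) \<omega>\<bar>)"
      "expectation (\<lambda>\<omega>. \<bar>x \<omega>\<bar> * \<bar>R' N a m \<omega> - R' N a (m - 1) \<omega>\<bar>) \<le> B * G"
      by (rule holder_3[OF x ym le gam(2)])+
  qed
  let ?h = "\<lambda>\<omega>. \<Sum>m=a..b. \<bar>x \<omega>\<bar> * \<bar>R' N a m \<omega> - R' N a (m - 1) \<omega>\<bar>"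
  have hi: "integrable M ?h" using step(1) by (intro Bochner_Integration.integrable_sum) auto
  have tel: "\<bar>x \<omega>\<bar> * \<bar>R N \<omega> - R' N a b \<omega>\<bar> \<le> ?h \<omega>" if "\<omega> \<in> space M" for \<omega>
  proof -
    have "(\<Sum>m=a..b. R' N a m \<omega> - R' N a (m - 1) \<omega>) = R' N a b \<omega> - R' N a (a - 1) \<omega>"
      using N(2) by (induction b rule: dec_induct) auto
    then have "R N \<omega> - R' N a b \<omega> = - (\<Sum>m=a..b. R' N a m \<omega> - R' N a (m - 1) \<omega>)"
      using R'_base[of a N \<omega>] N that by simp
    then have "\<bar>R N \<omega> - R' N a b \<omega>\<bar> \<le> (\<Sum>m=a..b. \<bar>R' N a m \<omega> - R' N a (m - 1) \<omega>\<bar>)" by (simp add: sum_abs)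
    then show ?thesis by (simp add: sum_distrib_left[symmetric] mult_left_mono)
  qed
  have m: "(\<lambda>\<omega>. \<bar>x \<omega>\<bar> * \<bar>R N \<omega> - R' N a b \<omega>\<bar>) \<in> borel_measurable M" using x RM R'M[of b] N by measurable
  show i: "integrable M (\<lambda>\<omega>. \<bar>x \<omega>\<bar> * \<bar>R N \<omega> - R' N a b \<omega>\<bar>)"
    by (rule Bochner_Integration.integrable_bound[OF hi m]) (use tel in \<open>auto intro!: AE_I2 order_trans[OF _ abs_ge_self]\<close>)
  have "expectation (\<lambda>\<omega>. \<bar>x \<omega>\<bar> * \<bar>R N \<omega> - R' N a b \<omega>\<bar>) \<le> expectation ?h" using i hi tel by (intro integral_mono) auto
  also have "\<dots> = (\<Sum>m=a..b. expectation (\<lambda>\<omega>. \<bar>x \<omega>\<bar> * \<bar>R' N a m \<omega> - R' N a (m - 1) \<omega>\<bar>))"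
    using step(1) by (intro Bochner_Integration.integral_sum) auto
  also have "\<dots> \<le> (\<Sum>m=a..b. B * G)" using step(2) by (intro sum_mono) auto
  also have "\<dots> = (real b - real a + 1) * (B * G)" using N by (simp add: of_nat_diff)
  finally show "expectation (\<lambda>\<omega>. \<bar>x \<omega>\<bar> * \<bar>R N \<omega> - R' N a b \<omega>\<bar>) \<le> (real b - real a + 1) * (B * G)" .
qed

text \<open>The array is formed with gap and number of levels both equal to \<open>l\<close>. By the
  lower variance bound \<open>s0 * h\<close> dominates \<open>1 / \<sigma>\<close>. The
  \<open>1\<close> added in \<open>\<beta>\<close> secures
  \<open>\<beta> \<ge> N powr (- 1/2)\<close> even for small \<open>\<rho>\<close>, so that a
  logarithmic \<open>l\<close> is enough for \<open>1 \<le> 2 ^ l * \<beta>\<close>. The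
  \<open>3\<close> in \<open>c\<close> counts the one-sided decouplings.\<close>

lemma (in nonlinear_statistic) berry_esseen_fixed_N:
  fixes N l :: nat and p K \<rho> b' G \<epsilon> z :: real
  defines "h \<equiv> real N powr (- 1/2)"
  defines "s0 \<equiv> 1 / sqrt b'"
  defines "\<beta> \<equiv> (root 3 \<rho> * s0 + 1) * h"
  defines "L \<equiv> 2 * (real l + 1) * real l + 1"
  defines "c \<equiv> 3 * (K * real l powr (- p))"
  defines "d \<equiv> L * G * s0 * h"
  defines "s \<equiv> 2128 * (real N * L ^ 3 * \<beta> ^ 3)"
  defines "q \<equiv> 2 * (13 * s + 152 * (real N * (\<beta> * d + L\<^sup>2 * c)) + 8 * (real N ^ 4 * c)) + \<beta>"
  assumes N: "1 \<le> N" and l: "1 \<le> l" and pos: "0 < K" "0 < \<rho>" "0 < b'" "0 < G"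
    and mix: "phi_mixing M E X l \<le> K * real l powr (- p)"
    and var: "b' * real N \<le> variance (lin_sum g X N)"
    and third: "\<And>j. j \<in> {1..N} \<Longrightarrow> (\<integral>\<^sup>+\<omega>. ennreal (\<bar>g N j (X j \<omega>)\<bar> ^ 3) \<partial>M) \<le> ennreal \<rho>"
    and small: "\<beta> \<le> 1" "1 \<le> 2 ^ l * \<beta>" "(real l + 1) * L * \<beta> \<le> 1 / 4" "s \<le> 1" "L \<le> real N powr \<epsilon>"
    and gam: "gamma_coeff M R' \<epsilon> N \<le> ennreal G"
    and Ri: "integrable M (R N)"
  shows "\<bar>\<P>(\<omega> in M. lin_sum g X N \<omega> + R N \<omega> < sqrt (expectation (\<lambda>\<omega>. (lin_sum g X N \<omega>)\<^sup>2)) * z) - std_normal_cdf z\<bar>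
    \<le> 76 * (real N * (\<beta> * d + L\<^sup>2 * (3 * q) * \<beta>\<^sup>2 + L ^ 3 * (3 * q / s) * \<beta> ^ 3 + L ^ 3 * \<beta> ^ 3 + L\<^sup>2 * c))
      + 4 * (real N ^ 4 * c) + 3 * (s0 * h * expectation (\<lambda>\<omega>. \<bar>R N \<omega>\<bar>))"
proof -
  define v where "v = expectation (\<lambda>\<omega>. (lin_sum g X N \<omega>)\<^sup>2)"
  define \<sigma> where "\<sigma> = sqrt v"
  have ES: "expectation (lin_sum g X N) = 0"
  proof -
    have "expectation (\<lambda>\<omega>. \<Sum>j=1..N. g N j (X j \<omega>)) = (\<Sum>j=1..N. expectation (\<lambda>\<omega>. g N j (X j \<omega>)))"
      using g_integrable by (intro Bochner_Integration.integral_sum) auto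
    then show ?thesis using g_centered by (simp add: lin_sum_def[abs_def])
  qed
  have vv: "b' * real N \<le> v" using var ES by (simp add: v_def)
  have v0: "0 < v"
  proof -
    have "0 < b' * real N" using pos N by simp
    then show ?thesis using vv by linarith
  qed
  have \<sigma>0: "0 < \<sigma>" using v0 by (simp add: \<sigma>_def)
  have h: "h = 1 / sqrt (real N)" "0 < h"
  proof -
    have "(- 1/2 :: real) = - (1/2)" by simp
    then show "h = 1 / sqrt (real N)" unfolding h_def by (simp only: powr_minus_divide powr_half_sqrt of_nat_0_le_iff)
    then show "0 < h" using N by simp
  qed
  have s0: "0 < s0" using pos by (simp add: s0_def)
  have sig_inv: "1 / \<sigma> \<le> s0 * h"
  proof -
    have "sqrt (b' * real N) \<le> \<sigma>" unfolding \<sigma>_def using vv by simp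
    moreover have "0 < sqrt (b' * real N)" using pos N by simp
    ultimately have "1 / \<sigma> \<le> 1 / sqrt (b' * real N)" by (intro divide_left_mono) (auto simp: \<sigma>0)
    then show ?thesis by (simp add: s0_def h real_sqrt_mult)
  qed
  have \<beta>0: "0 < \<beta>" using h(2) s0 pos by (simp add: \<beta>_def add_nonneg_pos)
  define \<xi> where "\<xi> = (\<lambda>j \<omega>. g N j (X j \<omega>) / \<sigma>)"
  define \<Delta> where "\<Delta> = (\<lambda>\<omega>. R N \<omega> / \<sigma>)"
  \<comment> \<open>The end points of the largest window, clipped to the index range, so that
    \<open>R'\<close> may be evaluated there.\<close>
  define a where "a = (\<lambda>j. max 1 (j - Suc l * l))"
  define b where "b = (\<lambda>j. min N (j + Suc l * l))"
  define \<Delta>loc where "\<Delta>loc = (\<lambda>j \<omega>. R' N (a j) (b j) \<omega> / \<sigma>)"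
  have gM: "(\<lambda>\<omega>. g N j (X j \<omega>)) \<in> borel_measurable (\<S>X I)" if "j \<in> I" "j \<in> {1..N}" for j I
    using measurable_compose[OF X_gen_sigma[OF that(1)] g_measurable[of j N]] that(2) by auto
  have \<xi>M: "\<xi> j \<in> borel_measurable (\<S>X I)" if "j \<in> I" "j \<in> {1..N}" for j I
    using gM[OF that] unfolding \<xi>_def by measurable
  have \<xi>MM: "\<xi> j \<in> borel_measurable M" if "j \<in> {1..N}" for j
    using measurable_from_subalg[OF subalgebra_gen_sigma \<xi>M[of j "{j}"]] that by auto
  have third_g: "integrable M (\<lambda>\<omega>. \<bar>g N j (X j \<omega>)\<bar> ^ 3)" "expectation (\<lambda>\<omega>. \<bar>g N j (X j \<omega>)\<bar> ^ 3) \<le> \<rho>" if "j \<in> {1..N}" for j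
  proof -
    have m: "(\<lambda>\<omega>. g N j (X j \<omega>)) \<in> borel_measurable M"
      using measurable_from_subalg[OF subalgebra_gen_sigma gM[of j "{j}"]] that by auto
    have "(\<integral>\<^sup>+\<omega>. ennreal (\<bar>g N j (X j \<omega>)\<bar> ^ 3) \<partial>M) < \<infinity>" using third[OF that] by (rule le_less_trans) simp
    then show "integrable M (\<lambda>\<omega>. \<bar>g N j (X j \<omega>)\<bar> ^ 3)" using m by (intro integrableI_bounded) auto
    show "expectation (\<lambda>\<omega>. \<bar>g N j (X j \<omega>)\<bar> ^ 3) \<le> \<rho>"
      using m enn2real_mono[OF third[OF that]] pos by (subst integral_eq_nn_integral) auto
  qed
  have third_\<xi>: "integrable M (\<lambda>\<omega>. \<bar>\<xi> j \<omega>\<bar> ^ 3)" "expectation (\<lambda>\<omega>. \<bar>\<xi> j \<omega>\<bar> ^ 3) \<le> \<beta> ^ 3" if "j \<in> {1..N}" for j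
  proof -
    have eq: "\<bar>\<xi> j \<omega>\<bar> ^ 3 = (1 / \<sigma>) ^ 3 * \<bar>g N j (X j \<omega>)\<bar> ^ 3" for \<omega>
      using \<sigma>0 by (simp add: \<xi>_def abs_divide power_divide)
    show "integrable M (\<lambda>\<omega>. \<bar>\<xi> j \<omega>\<bar> ^ 3)" unfolding eq using third_g[OF that] by auto
    have "expectation (\<lambda>\<omega>. \<bar>\<xi> j \<omega>\<bar> ^ 3) = (1 / \<sigma>) ^ 3 * expectation (\<lambda>\<omega>. \<bar>g N j (X j \<omega>)\<bar> ^ 3)"
      unfolding eq by simp
    also have "\<dots> \<le> (s0 * h) ^ 3 * \<rho>"
      using third_g[OF that] sig_inv \<sigma>0 s0 h(2) by (intro mult_mono power_mono) auto
    also have "\<dots> = (root 3 \<rho> * s0 * h) ^ 3" using pos by (simp add: power_mult_distrib)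
    also have "\<dots> \<le> \<beta> ^ 3"
      using pos s0 h(2) unfolding \<beta>_def by (intro power_mono) (auto simp: distrib_right)
    finally show "expectation (\<lambda>\<omega>. \<bar>\<xi> j \<omega>\<bar> ^ 3) \<le> \<beta> ^ 3" .
  qed
  have ab: "1 \<le> a j" "a j \<le> b j" "b j \<le> N" "real (b j) - real (a j) + 1 \<le> L" "{1..N} - {a j..b j} = {1..N} - {j - Suc l * l..j + Suc l * l} \<inter> {1..N}"
    if "j \<in> {1..N}" for j
  proof -
    show "1 \<le> a j" "b j \<le> N" by (auto simp: a_def b_def)
    show "a j \<le> b j" using that by (auto simp: a_def b_def)
    have "b j \<le> a j + 2 * (Suc l * l)" unfolding a_def b_def by linarith
    then have "real (b j) \<le> real (a j + 2 * (Suc l * l))" by (simp only: of_nat_le_iff)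
    then show "real (b j) - real (a j) + 1 \<le> L" by (simp add: L_def algebra_simps)
    show "{1..N} - {a j..b j} = {1..N} - {j - Suc l * l..j + Suc l * l} \<inter> {1..N}"
      by (auto simp: a_def b_def)
  qed
  have L1: "1 \<le> L" by (simp add: L_def)
  have weighted: "integrable M (\<lambda>\<omega>. \<bar>x \<omega>\<bar> * \<bar>\<Delta> \<omega> - \<Delta>loc i \<omega>\<bar>)" "expectation (\<lambda>\<omega>. \<bar>x \<omega>\<bar> * \<bar>\<Delta> \<omega> - \<Delta>loc i \<omega>\<bar>) \<le> B * d"
    if i: "i \<in> {1..N}" and x: "x \<in> borel_measurable M" "integrable M (\<lambda>\<omega>. \<bar>x \<omega>\<bar> ^ 3)" "expectation (\<lambda>\<omega>. \<bar>x \<omega>\<bar> ^ 3) \<le> B ^ 3" "0 < B" for i x B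
  proof -
    have "real (b i) - real (a i) \<le> real N powr \<epsilon>" using ab(4)[OF i] small(5) by linarith
    note wr = window_remainder[OF ab(1-3)[OF i] this gam pos(4) x]
    have eq: "\<bar>x \<omega>\<bar> * \<bar>\<Delta> \<omega> - \<Delta>loc i \<omega>\<bar> = (1 / \<sigma>) * (\<bar>x \<omega>\<bar> * \<bar>R N \<omega> - R' N (a i) (b i) \<omega>\<bar>)" for \<omega>
      using \<sigma>0 by (simp add: \<Delta>_def \<Delta>loc_def diff_divide_distrib[symmetric] abs_divide)
    show "integrable M (\<lambda>\<omega>. \<bar>x \<omega>\<bar> * \<bar>\<Delta> \<omega> - \<Delta>loc i \<omega>\<bar>)" unfolding eq using wr(1) by auto
    have "expectation (\<lambda>\<omega>. \<bar>x \<omega>\<bar> * \<bar>\<Delta> \<omega> - \<Delta>loc i \<omega>\<bar>) = (1 / \<sigma>) * expectation (\<lambda>\<omega>. \<bar>x \<omega>\<bar> * \<bar>R N \<omega> - R' N (a i) (b i) \<omega>\<bar>)"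
      unfolding eq by simp
    also have "\<dots> \<le> (s0 * h) * ((real (b i) - real (a i) + 1) * (B * G))"
      using wr(2) sig_inv \<sigma>0 s0 h(2) by (intro mult_mono) auto
    also have "\<dots> \<le> (s0 * h) * (L * (B * G))"
      using ab(4)[OF i] s0 h(2) x(4) pos(4) by (intro mult_left_mono mult_right_mono) auto
    also have "\<dots> = B * d" by (simp add: d_def mult_ac)
    finally show "expectation (\<lambda>\<omega>. \<bar>x \<omega>\<bar> * \<bar>\<Delta> \<omega> - \<Delta>loc i \<omega>\<bar>) \<le> B * d" .
  qed
  have RM: "R N \<in> borel_measurable M" using Ri by auto
  interpret A: stein_array M N l l \<S>X \<xi> \<Delta> \<Delta>loc \<beta> d c "\<lambda>i j. {j - i * l..j + i * l} \<inter> {1..N}" L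
  proof unfold_locales
    show "\<Delta>loc j \<in> borel_measurable (\<S>X ({1..N} - {j - Suc l * l..j + Suc l * l} \<inter> {1..N}))" if "j \<in> {1..N}" for j
    proof -
      have "R' N (a j) (b j) \<in> borel_measurable (gen_sigma M E X ({1..N} - {a j..b j}))"
        using ab[OF that] by (intro R'_measurable) auto
      moreover have "({1..N} - {a j..b j}) \<inter> {1..} = {1..N} - {a j..b j}" by auto
      ultimately show ?thesis unfolding \<Delta>loc_def ab(5)[OF that, symmetric] by simp
    qed
    show "integrable M (\<lambda>\<omega>. \<bar>\<xi> j \<omega>\<bar> * \<bar>\<Delta> \<omega> - \<Delta>loc i \<omega>\<bar>)" "expectation (\<lambda>\<omega>. \<bar>\<xi> j \<omega>\<bar> * \<bar>\<Delta> \<omega> - \<Delta>loc i \<omega>\<bar>) \<le> \<beta> * d"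
      if "i \<in> {1..N}" "j \<in> {1..N}" for i j
      using weighted[OF that(1) \<xi>MM[OF that(2)] third_\<xi>[OF that(2)] \<beta>0] by auto
    show "integrable M (\<lambda>\<omega>. \<bar>\<Delta> \<omega> - \<Delta>loc i \<omega>\<bar>)" "expectation (\<lambda>\<omega>. \<bar>\<Delta> \<omega> - \<Delta>loc i \<omega>\<bar>) \<le> d"
      if "i \<in> {1..N}" for i
      using weighted[OF that(1), of "\<lambda>_. 1" 1] by (auto simp: prob_space)
    show "decoupled (\<S>X ({j - i * l..j + i * l} \<inter> {1..N})) (\<S>X ({1..N} - {j - Suc i * l..j + Suc i * l} \<inter> {1..N})) c" for i j
      unfolding c_def by (rule decoupled_window[OF mix l])
    show "expectation (\<xi> j) = 0" if "j \<in> {1..N}" for j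
      using g_centered[of j N] that by (simp add: \<xi>_def)
    show "sets (\<S>X I) \<subseteq> sets (\<S>X I')" if "I \<subseteq> I'" for I I'
      using that by (intro sets_gen_sigma_mono) auto
    show "\<xi> j \<in> borel_measurable (\<S>X {j})" if "j \<in> {1..N}" for j using \<xi>M[of j "{j}"] that by auto
    show "0 \<le> c" using pos by (simp add: c_def)
    show "0 \<le> d" using pos L1 s0 h(2) by (simp add: d_def)
    show "\<Delta> \<in> borel_measurable M" unfolding \<Delta>_def using RM by measurable
  qed (use subalgebra_gen_sigma third_\<xi> \<beta>0 small l L_def in auto)
  have WS: "A.W {1..N} \<omega> = lin_sum g X N \<omega> / \<sigma>" for \<omega>
    unfolding A.W_def lin_sum_def by (simp add: \<xi>_def sum_divide_distrib)
  interpret A: stein_array_normalised M N l l \<S>X \<xi> \<Delta> \<Delta>loc \<beta> d c "\<lambda>i j. {j - i * l..j + i * l} \<inter> {1..N}" L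
  proof unfold_locales
    have "expectation (\<lambda>\<omega>. (A.W {1..N} \<omega>)\<^sup>2) = v / \<sigma>\<^sup>2" unfolding WS by (simp add: power_divide v_def)
    also have "\<dots> = 1" using v0 by (simp add: \<sigma>_def)
    finally show "expectation (\<lambda>\<omega>. (A.W {1..N} \<omega>)\<^sup>2) = 1" .
  qed (use small[unfolded L_def] N in auto)
  have sc: "A.scale = s" by (simp add: A.scale_def s_def)
  have be: "A.base_error = 13 * s + 152 * (real N * (\<beta> * d + L\<^sup>2 * c)) + 8 * (real N ^ 4 * c)"
    by (simp add: A.base_error_def sc)
  have "\<bar>prob {\<omega>\<in>space M. A.W {1..N} \<omega> + \<Delta> \<omega> < z} - std_normal_cdf z\<bar>
    \<le> A.stein_error (3 * q) (3 * q / s) + 3 * expectation (\<lambda>\<omega>. \<bar>\<Delta> \<omega>\<bar>)"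
    using A.berry_esseen[of z] small(4) Ri unfolding sc be q_def[symmetric] by (simp add: \<Delta>_def)
  moreover have "{\<omega>\<in>space M. A.W {1..N} \<omega> + \<Delta> \<omega> < z} = {\<omega>\<in>space M. lin_sum g X N \<omega> + R N \<omega> < \<sigma> * z}"
  proof -
    have "A.W {1..N} \<omega> + \<Delta> \<omega> < z \<longleftrightarrow> lin_sum g X N \<omega> + R N \<omega> < \<sigma> * z" for \<omega>
      using \<sigma>0 unfolding WS \<Delta>_def by (simp add: add_divide_distrib[symmetric] divide_less_eq mult.commute)
    then show ?thesis by simp
  qed
  moreover have "expectation (\<lambda>\<omega>. \<bar>\<Delta> \<omega>\<bar>) \<le> s0 * h * expectation (\<lambda>\<omega>. \<bar>R N \<omega>\<bar>)"
  proof -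
    have "expectation (\<lambda>\<omega>. \<bar>\<Delta> \<omega>\<bar>) = (1 / \<sigma>) * expectation (\<lambda>\<omega>. \<bar>R N \<omega>\<bar>)"
      using \<sigma>0 by (simp add: \<Delta>_def abs_divide)
    also have "\<dots> \<le> (s0 * h) * expectation (\<lambda>\<omega>. \<bar>R N \<omega>\<bar>)" using sig_inv by (intro mult_right_mono) auto
    finally show ?thesis .
  qed
  ultimately show ?thesis
    unfolding A.stein_error_def A.term_error_def \<sigma>_def v_def by simp
qed

text \<open>With \<open>N * h\<^sup>2 = 1\<close> everything is measured against
  \<open>H = L ^ 3 * (h + G)\<close>, which dominates \<open>s\<close> and hence \<open>q\<close> up
  to constants. The factor \<open>L\<^sup>2\<close> in front of \<open>c0 = 3 * q\<close> raises
  this to \<open>L ^ 5\<close>, while in the \<open>c1\<close> term the denominator \<open>s\<close>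
  cancels \<open>N * L ^ 3 * \<beta> ^ 3\<close>. \<open>27664\<close> is
  \<open>13 * 2128\<close>.\<close>

lemma error_bound_numeric:
  fixes N L h \<beta> d c G s0 K C1 s q :: real
  assumes N: "N * h\<^sup>2 = 1" "1 \<le> N" and h: "0 < h" and L: "1 \<le> L" and G: "0 \<le> G"
    and \<beta>: "\<beta> = C1 * h" "0 < C1" and d: "d = L * G * s0 * h" and s0: "0 \<le> s0" and K: "0 \<le> K" 
    and c: "0 \<le> c" "N ^ 4 * c \<le> K * h"
    and s: "s = 2128 * (N * L ^ 3 * \<beta> ^ 3)"
    and q: "q = 2 * (13 * s + 152 * (N * (\<beta> * d + L\<^sup>2 * c)) + 8 * (N ^ 4 * c)) + \<beta>"
  shows "76 * (N * (\<beta> * d + L\<^sup>2 * (3 * q) * \<beta>\<^sup>2 + L ^ 3 * (3 * q / s) * \<beta> ^ 3 + L ^ 3 * \<beta> ^ 3 + L\<^sup>2 * c)) + 4 * (N ^ 4 * c)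
    \<le> (let Cq = 2 * (27664 * C1 ^ 3 + 152 * (C1 * s0 + K) + 8 * K) + C1
        in 76 * (C1 * s0 + 3 * C1\<^sup>2 * Cq + 3 * Cq + C1 ^ 3 + K) + 4 * K) * (L ^ 5 * (h + G))"
proof -
  define H where "H = L ^ 3 * (h + G)"
  define H5 where "H5 = L ^ 5 * (h + G)"
  define Cq where "Cq = 2 * (27664 * C1 ^ 3 + 152 * (C1 * s0 + K) + 8 * K) + C1"
  have Lp: "1 \<le> L ^ 3" "L \<le> L ^ 3" "L\<^sup>2 \<le> L ^ 3" "1 \<le> L\<^sup>2" "L ^ 3 \<le> L ^ 5"
    using L by (auto simp: one_le_power self_le_power power_increasing)
  have L0: "0 \<le> L" using L by simp
  have H0: "0 \<le> H" unfolding H_def using L0 h G by simp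
  have HH5: "H \<le> H5" unfolding H_def H5_def using h G by (intro mult_right_mono Lp) auto
  have hH: "h \<le> H"
  proof -
    have "1 * h \<le> L ^ 3 * (h + G)" using L0 Lp h G by (intro mult_mono) auto
    then show ?thesis by (simp add: H_def)
  qed
  have Nh3: "N * h ^ 3 = h" using N(1) by (simp add: power3_eq_cube power2_eq_square mult.assoc[symmetric])
  have b3: "N * L ^ 3 * \<beta> ^ 3 = C1 ^ 3 * (L ^ 3 * h)"
    unfolding \<beta> power_mult_distrib using Nh3 by (simp add: mult_ac)
  have "L ^ 3 * h \<le> H" unfolding H_def using L0 Lp G by (intro mult_left_mono) auto
  then have B3: "N * L ^ 3 * \<beta> ^ 3 \<le> C1 ^ 3 * H" unfolding b3 using \<beta>(2) by (intro mult_left_mono) auto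
  have bd: "N * (\<beta> * d) = C1 * s0 * (L * G)"
  proof -
    have "N * (\<beta> * d) = (N * h\<^sup>2) * (C1 * s0 * (L * G))" unfolding \<beta> d by (simp add: power2_eq_square mult_ac)
    then show ?thesis using N by simp
  qed
  have "L * G \<le> H" unfolding H_def using L0 Lp G h by (intro mult_mono) auto
  then have BD: "N * (\<beta> * d) \<le> C1 * s0 * H" unfolding bd using \<beta>(2) s0 by (intro mult_left_mono) auto
  have N4: "N ^ 4 * c \<le> K * H" using c(2) mult_left_mono[OF hH K] by linarith
  have NL: "N * (L\<^sup>2 * c) \<le> K * H"
  proof -
    have "N \<le> N ^ 4" using N(2) by (simp add: self_le_power)
    then have "N * c \<le> N ^ 4 * c" using c(1) by (intro mult_right_mono) auto
    then have "N * c \<le> K * h" using c(2) by linarith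
    then have "L\<^sup>2 * (N * c) \<le> L ^ 3 * (K * h)"
      using L0 Lp c(1) N(2) by (intro mult_mono[of "L\<^sup>2" "L ^ 3" "N * c" "K * h"]) auto
    also have "\<dots> \<le> K * H"
    proof -
      have "L ^ 3 * (K * h) = K * (L ^ 3 * h)" by simp
      also have "\<dots> \<le> K * H" using \<open>L ^ 3 * h \<le> H\<close> K by (intro mult_left_mono) auto
      finally show ?thesis .
    qed
    finally show ?thesis by (simp add: mult_ac)
  qed
  have s0': "0 < s" unfolding s b3 using \<beta>(2) h L by simp
  have qH: "q \<le> Cq * H"
  proof -
    have "s \<le> 2128 * (C1 ^ 3 * H)" using B3 by (simp add: s)
    moreover have "\<beta> \<le> C1 * H" unfolding \<beta> using hH \<beta>(2) by (intro mult_left_mono) auto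
    moreover have "N * (\<beta> * d + L\<^sup>2 * c) \<le> (C1 * s0 + K) * H"
      using BD NL by (simp add: distrib_left distrib_right)
    ultimately have "q \<le> 2 * (13 * (2128 * (C1 ^ 3 * H)) + 152 * ((C1 * s0 + K) * H) + 8 * (K * H)) + C1 * H"
      unfolding q using N4 by (intro add_mono mult_left_mono) auto
    then show ?thesis by (simp add: Cq_def algebra_simps)
  qed
  have \<beta>0: "0 < \<beta>" using \<beta> h by simp
  have d0: "0 \<le> d" using d L G s0 h by simp
  have q0: "0 \<le> q" unfolding q using s0' \<beta>0 d0 c N L by (intro add_nonneg_nonneg mult_nonneg_nonneg) auto
  have Cq0: "0 \<le> Cq" using \<beta>(2) s0 K by (simp add: Cq_def)
  have Nb2: "N * \<beta>\<^sup>2 = C1\<^sup>2"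
    unfolding \<beta> power_mult_distrib using N(1) by (metis mult.left_commute mult.right_neutral)
  have t2: "N * (L\<^sup>2 * (3 * q) * \<beta>\<^sup>2) \<le> 3 * C1\<^sup>2 * Cq * H5"
  proof -
    have "N * (L\<^sup>2 * (3 * q) * \<beta>\<^sup>2) = 3 * (N * \<beta>\<^sup>2) * (L\<^sup>2 * q)" by (simp add: mult_ac)
    also have "\<dots> \<le> 3 * C1\<^sup>2 * (L\<^sup>2 * (Cq * H))" unfolding Nb2 using qH by (intro mult_left_mono) auto
    also have "L\<^sup>2 * (Cq * H) = Cq * H5" by (simp add: H_def H5_def power2_eq_square power_numeral_reduce mult_ac)
    finally show ?thesis by simp
  qed
  have t3: "N * (L ^ 3 * (3 * q / s) * \<beta> ^ 3) \<le> 3 * Cq * H5"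
  proof -
    have "N * (L ^ 3 * (3 * q / s) * \<beta> ^ 3) = (s / 2128) * (3 * q / s)" by (simp add: s)
    also have "\<dots> = 3 * q / 2128" using s0' by simp
    also have "\<dots> \<le> 3 * q" using q0 by simp
    also have "\<dots> \<le> 3 * (Cq * H)" using qH by simp
    also have "\<dots> \<le> 3 * (Cq * H5)" using HH5 Cq0 by (intro mult_left_mono) auto
    finally show ?thesis by simp
  qed
  have up: "x * H \<le> x * H5" if "0 \<le> x" for x using HH5 that by (intro mult_left_mono)
  have "76 * (N * (\<beta> * d + L\<^sup>2 * (3 * q) * \<beta>\<^sup>2 + L ^ 3 * (3 * q / s) * \<beta> ^ 3 + L ^ 3 * \<beta> ^ 3 + L\<^sup>2 * c)) + 4 * (N ^ 4 * c)
    = 76 * (N * (\<beta> * d) + N * (L\<^sup>2 * (3 * q) * \<beta>\<^sup>2) + N * (L ^ 3 * (3 * q / s) * \<beta> ^ 3) + N * L ^ 3 * \<beta> ^ 3 + N * (L\<^sup>2 * c)) + 4 * (N ^ 4 * c)"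
    by (simp add: distrib_left mult.assoc)
  also have "\<dots> \<le> 76 * (C1 * s0 * H5 + 3 * C1\<^sup>2 * Cq * H5 + 3 * Cq * H5 + C1 ^ 3 * H5 + K * H5) + 4 * (K * H5)"
  proof (intro add_mono mult_left_mono t2 t3)
    show "N * (\<beta> * d) \<le> C1 * s0 * H5" using BD up[of "C1 * s0"] \<beta>(2) s0 by (meson less_imp_le mult_nonneg_nonneg order_trans)
    show "N * L ^ 3 * \<beta> ^ 3 \<le> C1 ^ 3 * H5" using B3 up[of "C1 ^ 3"] \<beta>(2) by (meson less_imp_le order_trans zero_le_power)
    show "N * (L\<^sup>2 * c) \<le> K * H5" "N ^ 4 * c \<le> K * H5" using NL N4 up[OF K] by linarith+
  qed auto
  also have "\<dots> = (76 * (C1 * s0 + 3 * C1\<^sup>2 * Cq + 3 * Cq + C1 ^ 3 + K) + 4 * K) * H5" by (simp add: algebra_simps)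
  finally show ?thesis unfolding H5_def Cq_def Let_def .
qed

section \<open>Parameters as powers of \<open>N\<close>, and the final rate\<close>

lemma eventually_small_powr:
  assumes "a < 0" "0 < e"
  shows "\<forall>\<^sub>F x in at_top. C * x powr a \<le> (e :: real)"
proof -
  have "((\<lambda>x::real. C * x powr a) \<longlongrightarrow> C * 0) at_top"
    using assms(1) by (intro tendsto_mult_left tendsto_neg_powr filterlim_ident)
  then have "\<forall>\<^sub>F x in at_top. C * x powr a < e" using assms(2) by (intro order_tendstoD(2)) auto
  then show ?thesis by eventually_elim simp
qed

text \<open>Rounding up at most doubles \<open>y \<ge> 1\<close>, and then
  \<open>2 * (3 * y) * (2 * y) + 1 \<le> 13 * y\<^sup>2\<close>.\<close>

lemma window_parameters:
  fixes \<delta> x :: real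
  assumes x: "1 \<le> x" and \<delta>: "0 < \<delta>"
  defines "y \<equiv> x powr \<delta>" and "l \<equiv> nat \<lceil>x powr \<delta>\<rceil>"
  shows "1 \<le> l" "y \<le> real l" "real l + 1 \<le> 3 * y" "2 * (real l + 1) * real l + 1 \<le> 13 * y\<^sup>2" "1 \<le> y"
proof -
  show y: "1 \<le> y" using x \<delta> by (simp add: y_def ge_one_powr_ge_zero)
  show yl: "y \<le> real l" unfolding l_def y_def by linarith
  show "1 \<le> l" using y yl by linarith
  have l: "real l \<le> 2 * y" using y unfolding l_def y_def[symmetric] by linarith
  then show l1: "real l + 1 \<le> 3 * y" using y by simp
  have "2 * (real l + 1) * real l + 1 \<le> 2 * (3 * y) * (2 * y) + 1"
    using l l1 by (intro add_right_mono mult_mono) auto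
  also have "\<dots> \<le> 13 * y\<^sup>2" using y by (simp add: power2_eq_square) (metis mult_mono' one_le_numeral mult_1 zero_le_one)
  finally show "2 * (real l + 1) * real l + 1 \<le> 13 * y\<^sup>2" .
qed

text \<open>The choice \<open>\<delta> = 10 / p\<close> makes
  \<open>l powr (- p) \<le> N powr (- 10)\<close>. The conditions \<open>big\<close> are the
  hypotheses \<open>small\<close> of the bound for fixed \<open>N\<close> after inserting
  \<open>L \<le> 13 * N powr (2 * \<delta>)\<close>; the factor
  \<open>N powr (10 * \<delta>)\<close> is \<open>L ^ 5\<close> without its constant.\<close>

lemma (in nonlinear_statistic) berry_esseen_rate:
  fixes N :: nat and p K \<rho> b' \<gamma> \<epsilon> :: real
  defines "\<delta> \<equiv> 10 / p" and "C1 \<equiv> root 3 \<rho> * (1 / sqrt b') + 1"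
  defines "Cq \<equiv> 2 * (27664 * C1 ^ 3 + 152 * (C1 * (1 / sqrt b') + 3 * K) + 8 * (3 * K)) + C1"
  defines "CS \<equiv> 76 * (C1 * (1 / sqrt b') + 3 * C1\<^sup>2 * Cq + 3 * Cq + C1 ^ 3 + 3 * K) + 4 * (3 * K)"
  assumes N: "1 \<le> N" and pos: "0 < K" "0 < \<rho>" "0 < b'" "0 \<le> \<gamma>" and p: "200 \<le> p"
    and mix: "\<And>m. 1 \<le> m \<Longrightarrow> phi_mixing M E X m \<le> K * real m powr (- p)"
    and var: "b' * real N \<le> variance (lin_sum g X N)"
    and third: "\<And>j. j \<in> {1..N} \<Longrightarrow> (\<integral>\<^sup>+\<omega>. ennreal (\<bar>g N j (X j \<omega>)\<bar> ^ 3) \<partial>M) \<le> ennreal \<rho>"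
    and big: "C1 * real N powr (- 1/2) \<le> 1" "real N \<le> 2 powr (real N powr \<delta>)" "13 * real N powr (2 * \<delta>) \<le> real N powr \<epsilon>"
      "2128 * 13 ^ 3 * C1 ^ 3 * real N powr (6 * \<delta> - 1/2) \<le> 1" "39 * C1 * real N powr (3 * \<delta> - 1/2) \<le> 1 / 4"
    and gam: "gamma_coeff M R' \<epsilon> N \<le> ennreal \<gamma>"
    and Ri: "integrable M (R N)"
  shows "\<bar>\<P>(\<omega> in M. lin_sum g X N \<omega> + R N \<omega> < sqrt (expectation (\<lambda>\<omega>. (lin_sum g X N \<omega>)\<^sup>2)) * z) - std_normal_cdf z\<bar>
    \<le> 13 ^ 5 * CS * real N powr (10 * \<delta>) * (2 * real N powr (- 1/2) + \<gamma>)
      + 3 * (1 / sqrt b') * real N powr (- 1/2) * expectation (\<lambda>\<omega>. \<bar>R N \<omega>\<bar>)"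
proof -
  define x where "x = real N"
  define y where "y = x powr \<delta>"
  define l where "l = nat \<lceil>x powr \<delta>\<rceil>"
  define h where "h = x powr (- 1/2)"
  define L where "L = 2 * (real l + 1) * real l + 1"
  define s0 where "s0 = 1 / sqrt b'"
  \<comment> \<open>\<open>\<gamma>\<close> may vanish, whereas the inequality of Hoelder type was
    normalised by a positive \<open>G\<close>. Adding \<open>h\<close> only enlarges a term that is
    present anyway.\<close>
  define G where "G = \<gamma> + h"
  define \<beta> where "\<beta> = C1 * h"
  define c where "c = 3 * (K * real l powr (- p))"
  have x: "1 \<le> x" using N by (simp add: x_def)
  have \<delta>: "0 < \<delta>" using p by (simp add: \<delta>_def)
  note wp = window_parameters[OF x \<delta>, folded l_def y_def, folded L_def]
  have h0: "0 < h" using x by (simp add: h_def)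
  have s00: "0 < s0" using pos by (simp add: s0_def)
  have C10: "1 \<le> C1" using pos by (simp add: C1_def)
  have Nh: "x * h\<^sup>2 = 1" 
  proof -
    have "h\<^sup>2 = x powr (- 1)" unfolding h_def power2_eq_square powr_add[symmetric] by simp
    then show ?thesis using x by (simp add: powr_minus)
  qed
  have L1: "1 \<le> L" by (simp add: L_def)
  have ypow: "y ^ n = x powr (n * \<delta>)" for n using x by (simp add: y_def powr_powr powr_realpow[symmetric] mult.commute)
  have Ly: "L ^ n \<le> 13 ^ n * x powr (2 * real n * \<delta>)" for n
  proof -
    have "L ^ n \<le> (13 * y\<^sup>2) ^ n" using wp(4) L1 by (intro power_mono) auto
    also have "\<dots> = 13 ^ n * y ^ (2 * n)" by (simp add: power_mult_distrib power_mult)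
    also have "\<dots> = 13 ^ n * x powr (2 * real n * \<delta>)" unfolding ypow by simp
    finally show ?thesis .
  qed
  have \<beta>0: "0 < \<beta>" using C10 h0 by (simp add: \<beta>_def)
  have b1: "\<beta> \<le> 1" using big(1) by (simp add: \<beta>_def h_def x_def)
  have b2: "1 \<le> 2 ^ l * \<beta>"
  proof -
    have "x * h \<le> 2 ^ l * \<beta>"
    proof (rule mult_mono)
      have "x \<le> 2 powr y" using big(2) by (simp add: x_def y_def)
      also have "\<dots> \<le> 2 powr real l" using wp(2) by simp
      finally show "x \<le> 2 ^ l" by (simp add: powr_realpow)
      show "h \<le> \<beta>" using C10 h0 by (simp add: \<beta>_def)
    qed (use h0 in auto)
    moreover have "1 \<le> x * h"
    proof -
      have "x * h = x powr 1 * x powr (- 1/2)" using x by (simp add: h_def)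
      also have "\<dots> = x powr (1/2)" by (simp only: powr_add[symmetric]) simp
      finally show ?thesis using x by (simp add: ge_one_powr_ge_zero)
    qed
    ultimately show ?thesis by linarith
  qed
  have b3: "(real l + 1) * L * \<beta> \<le> 1 / 4"
  proof -
    have "(real l + 1) * L * \<beta> \<le> (3 * y) * (13 * y\<^sup>2) * \<beta>"
      using wp L1 \<beta>0 by (intro mult_right_mono mult_mono) auto
    also have "\<dots> = 39 * C1 * (y ^ 3 * h)" by (simp add: \<beta>_def power2_eq_square power3_eq_cube)
    also have "y ^ 3 * h = x powr (3 * \<delta> - 1/2)" unfolding ypow h_def by (simp add: powr_add[symmetric])
    finally show ?thesis using big(5) by (simp add: x_def)
  qed
  have b4: "2128 * (x * L ^ 3 * \<beta> ^ 3) \<le> 1"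
  proof -
    have "x * L ^ 3 * \<beta> ^ 3 = C1 ^ 3 * (x * h\<^sup>2) * (L ^ 3 * h)"
      by (simp add: \<beta>_def power_mult_distrib power3_eq_cube power2_eq_square mult_ac)
    also have "\<dots> \<le> C1 ^ 3 * 1 * ((13 ^ 3 * x powr (2 * real 3 * \<delta>)) * h)"
      unfolding Nh using Ly[of 3] h0 C10 by (intro mult_left_mono mult_right_mono) auto
    also have "\<dots> = 13 ^ 3 * C1 ^ 3 * x powr (6 * \<delta> - 1/2)"
      unfolding h_def by (simp add: powr_add[symmetric])
    finally show ?thesis using big(4) by (simp add: x_def)
  qed
  have b5: "L \<le> x powr \<epsilon>"
    using Ly[of 1] big(3) by (simp add: x_def)
  have c: "0 \<le> c" "x ^ 4 * c \<le> 3 * K * h"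
  proof -
    show "0 \<le> c" using pos by (simp add: c_def)
    have "real l powr (- p) \<le> y powr (- p)" using wp(2,5) p by (intro powr_mono2') auto
    also have "y powr (- p) = x powr (- 10)" using p by (simp add: y_def powr_powr \<delta>_def)
    finally have "c \<le> 3 * (K * x powr (- 10))" using pos by (simp add: c_def)
    then have "x ^ 4 * c \<le> x ^ 4 * (3 * (K * x powr (- 10)))" using x by (intro mult_left_mono) auto
    also have "\<dots> = 3 * K * (x powr 4 * x powr (- 10))" using x by (simp add: powr_numeral)
    also have "x powr 4 * x powr (- 10) = x powr (- 6)" by (simp add: powr_add[symmetric])
    also have "3 * K * x powr (- 6) \<le> 3 * K * h" unfolding h_def using x pos by (intro mult_left_mono powr_mono) auto
    finally show "x ^ 4 * c \<le> 3 * K * h" .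
  qed
  have G: "0 < G" using pos h0 by (simp add: G_def)
  have gamG: "gamma_coeff M R' \<epsilon> N \<le> ennreal G"
    using gam pos h0 by (intro order_trans[OF gam] ennreal_leI) (simp add: G_def)
  define d where "d = L * G * s0 * h"
  define s where "s = 2128 * (x * L ^ 3 * \<beta> ^ 3)"
  define q where "q = 2 * (13 * s + 152 * (x * (\<beta> * d + L\<^sup>2 * c)) + 8 * (x ^ 4 * c)) + \<beta>"
  have "\<bar>\<P>(\<omega> in M. lin_sum g X N \<omega> + R N \<omega> < sqrt (expectation (\<lambda>\<omega>. (lin_sum g X N \<omega>)\<^sup>2)) * z) - std_normal_cdf z\<bar>
    \<le> 76 * (x * (\<beta> * d + L\<^sup>2 * (3 * q) * \<beta>\<^sup>2 + L ^ 3 * (3 * q / s) * \<beta> ^ 3 + L ^ 3 * \<beta> ^ 3 + L\<^sup>2 * c))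
      + 4 * (x ^ 4 * c) + 3 * (s0 * h * expectation (\<lambda>\<omega>. \<bar>R N \<omega>\<bar>))"
    using berry_esseen_fixed_N[OF N wp(1) pos(1-3) G mix[OF wp(1)] var third _ _ _ _ _ gamG Ri, of z] b1 b2 b3 b4 b5
    unfolding q_def s_def d_def c_def \<beta>_def L_def s0_def h_def x_def C1_def by blast
  also have "76 * (x * (\<beta> * d + L\<^sup>2 * (3 * q) * \<beta>\<^sup>2 + L ^ 3 * (3 * q / s) * \<beta> ^ 3 + L ^ 3 * \<beta> ^ 3 + L\<^sup>2 * c)) + 4 * (x ^ 4 * c)
    \<le> CS * (L ^ 5 * (h + G))"
    using error_bound_numeric[OF Nh x h0 L1 _ \<beta>_def _ d_def _ _ c s_def q_def] G C10 s00 pos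
    unfolding CS_def Cq_def s0_def Let_def by simp
  also have "\<dots> \<le> CS * ((13 ^ 5 * x powr (2 * real 5 * \<delta>)) * (h + G))"
  proof (intro mult_left_mono mult_right_mono Ly)
    show "0 \<le> h + G" using h0 G by simp
    show "0 \<le> CS" using C10 pos unfolding CS_def Cq_def by (intro add_nonneg_nonneg mult_nonneg_nonneg) auto
  qed
  also have "\<dots> = 13 ^ 5 * CS * x powr (10 * \<delta>) * (2 * h + \<gamma>)" by (simp add: G_def)
  finally show ?thesis by (simp add: x_def h_def s0_def mult.assoc)
qed

theorem theorem1:
  fixes \<epsilon> :: real
  assumes "\<epsilon> > 0"
  shows "\<exists>p0 > 0. \<exists>e :: real \<Rightarrow> real. (e \<longlongrightarrow> 0) at_top \<and>
    (\<forall>p \<ge> p0. \<forall>K > 0. \<forall>\<Sigma> > 0. \<forall>\<rho> > 0. \<forall>b' > 0. \<forall>N0 \<ge> 1. \<exists>A > 0.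
      \<forall>(M :: 'w measure) (E :: nat \<Rightarrow> 'x measure) X g R R' b.
        nonlinear_statistic M E X g R R' \<longrightarrow>
        (\<forall>m \<ge> 1. phi_mixing M E X m \<le> K * real m powr (- p)) \<longrightarrow>
        b > 0 \<longrightarrow>
        (\<forall>N \<ge> N0. b' * real N \<le> prob_space.variance M (lin_sum g X N) \<and>
                   prob_space.variance M (lin_sum g X N) \<le> b * real N) \<longrightarrow>
        (SUP N\<in>{1..}. SUP j\<in>{1..N}. \<integral>\<^sup>+\<omega>. ennreal (\<bar>g N j (X j \<omega>)\<bar> ^ 3) \<partial>M) \<le> ennreal \<rho> \<longrightarrow>
        (\<forall>N \<ge> 1. \<Sigma>\<^sup>2 \<le> prob_space.variance M (lin_sum g X N)) \<longrightarrow>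
        (\<forall>N \<ge> 1.
          let S = lin_sum g X N;
              T = (\<lambda>\<omega>. S \<omega> + R N \<omega>);
              \<sigma> = sqrt (prob_space.expectation M (\<lambda>\<omega>. (S \<omega>)\<^sup>2))
          in ennreal (SUP x. \<bar>\<P>(\<omega> in M. T \<omega> < \<sigma> * x) - std_normal_cdf x\<bar>)
               \<le> ennreal (A * real N powr (- 1/2 + e p))
                 + ennreal (A * real N powr (- 1/2)) * (\<integral>\<^sup>+\<omega>. ennreal \<bar>R N \<omega>\<bar> \<partial>M)
                 + ennreal (A * real N powr (e p)) * gamma_coeff M R' \<epsilon> N))"
proof (rule exI[of _ "200 + 40 / \<epsilon>"], rule conjI, goal_cases)
  case 1
  then show ?case using assms by (simp add: add_pos_pos)
next
  case 2
  \<comment> \<open>\<open>100 / p\<close> is \<open>10 * \<delta>\<close>, the exponent contributed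
    by \<open>L ^ 5\<close>.\<close>
  define e :: "real \<Rightarrow> real" where "e = (\<lambda>p. 100 / p)"
  have e_lim: "(e \<longlongrightarrow> 0) at_top" unfolding e_def by real_asymp
  show ?case
  proof (rule exI[of _ e], intro conjI e_lim allI impI, goal_cases)
    case (1 p K \<Sigma> \<rho> b' N0)
    have p: "200 \<le> p" and p\<epsilon>: "40 / \<epsilon> \<le> p" using 1(1) assms by (auto simp: add_increasing2 intro: order_trans[rotated])
    define \<delta> where "\<delta> = 10 / p"
    \<comment> \<open>\<open>p \<ge> 200\<close> keeps the exponent
      \<open>6 * \<delta> - 1/2\<close> negative, and \<open>p \<ge> 40 / \<epsilon>\<close> gives
      \<open>2 * \<delta> < \<epsilon>\<close>, so that for large \<open>N\<close> the windows are
      shorter than \<open>N powr \<epsilon>\<close>.\<close>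
    have \<delta>: "0 < \<delta>" "\<delta> \<le> 1 / 20" "2 * \<delta> < \<epsilon>"
    proof -
      show "0 < \<delta>" "\<delta> \<le> 1 / 20" using p by (auto simp: \<delta>_def field_simps)
      have "40 \<le> p * \<epsilon>" using p\<epsilon> assms by (simp add: divide_le_eq mult.commute)
      then show "2 * \<delta> < \<epsilon>" using p by (simp add: \<delta>_def field_simps)
    qed
    have ep: "e p = 10 * \<delta>" by (simp add: e_def \<delta>_def)
    define C1 where "C1 = root 3 \<rho> * (1 / sqrt b') + 1"
    define Cq where "Cq = 2 * (27664 * C1 ^ 3 + 152 * (C1 * (1 / sqrt b') + 3 * K) + 8 * (3 * K)) + C1"
    define CS where "CS = 76 * (C1 * (1 / sqrt b') + 3 * C1\<^sup>2 * Cq + 3 * Cq + C1 ^ 3 + 3 * K) + 4 * (3 * K)"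
    have C10: "0 \<le> C1" using 1 by (simp add: C1_def)
    have CS0: "0 \<le> CS" using C10 1 unfolding CS_def Cq_def by (intro add_nonneg_nonneg mult_nonneg_nonneg) auto
    have "\<forall>\<^sub>F x in at_top. C1 * x powr (- 1/2) \<le> 1 \<and> x \<le> 2 powr (x powr \<delta>) \<and> 13 * x powr (2 * \<delta> - \<epsilon>) \<le> 1
      \<and> 2128 * 13 ^ 3 * C1 ^ 3 * x powr (6 * \<delta> - 1/2) \<le> 1 \<and> 39 * C1 * x powr (3 * \<delta> - 1/2) \<le> 1 / 4"
      using \<delta> by (intro eventually_conj eventually_small_powr) (auto, real_asymp)
    then obtain x0 where x0: "\<And>x. x0 \<le> x \<Longrightarrow> C1 * x powr (- 1/2) \<le> 1 \<and> x \<le> 2 powr (x powr \<delta>) \<and> 13 * x powr (2 * \<delta> - \<epsilon>) \<le> 1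
      \<and> 2128 * 13 ^ 3 * C1 ^ 3 * x powr (6 * \<delta> - 1/2) \<le> 1 \<and> 39 * C1 * x powr (3 * \<delta> - 1/2) \<le> 1 / 4"
      unfolding eventually_at_top_linorder by blast
    define N1 where "N1 = max N0 (nat \<lceil>x0\<rceil>)"
    have N1: "N0 \<le> N" "x0 \<le> real N" if "N1 \<le> N" for N using that unfolding N1_def by linarith+
    \<comment> \<open>The summand \<open>sqrt N1\<close> serves the finitely many \<open>N\<close>
      below \<open>N1\<close>: there the left side is at most
      \<open>1 = sqrt N * N powr (- 1/2)\<close>.\<close>
    define A where "A = 1 + 2 * (13 ^ 5 * CS) + 3 * (1 / sqrt b') + sqrt (real N1)"
    have A: "1 + sqrt (real N1) \<le> A" "2 * (13 ^ 5 * CS) \<le> A" "13 ^ 5 * CS \<le> A" "3 * (1 / sqrt b') \<le> A" "0 < A"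
      using CS0 1 by (auto simp: A_def add_increasing add_increasing2 add_pos_nonneg)
    show ?case
    proof (rule exI[of _ A], intro conjI A(5) allI impI, goal_cases)
      case (1 M E X g R R' b N)
      interpret nonlinear_statistic M E X g R R' by (rule 1(1))
      have N: "1 \<le> N" by (rule 1(7))
      define F where "F = (\<lambda>x. \<bar>\<P>(\<omega> in M. lin_sum g X N \<omega> + R N \<omega> < sqrt (expectation (\<lambda>\<omega>. (lin_sum g X N \<omega>)\<^sup>2)) * x) - std_normal_cdf x\<bar>)"
      let ?r = "\<integral>\<^sup>+\<omega>. ennreal \<bar>R N \<omega>\<bar> \<partial>M" and ?\<gamma> = "gamma_coeff M R' \<epsilon> N"
      have pN: "0 < real N powr a" for a using N by simp
      have "ennreal (SUP x. F x) \<le> ennreal (A * real N powr (- 1/2 + e p)) + ennreal (A * real N powr (- 1/2)) * ?r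
          + ennreal (A * real N powr (e p)) * ?\<gamma>"
      \<comment> \<open>An infinite moment makes the right side infinite, its coefficient being
        positive. Otherwise \<open>R N\<close> is integrable and the claim is an inequality between
        reals.\<close>
      proof (cases "?r = \<infinity> \<or> ?\<gamma> = \<infinity>")
        case True
        then show ?thesis using A(5) pN[of "- 1/2"] pN[of "e p"] by (auto simp: ennreal_mult_top)
      next
        case False
        have RM: "R N \<in> borel_measurable M"
          using R_measurable[OF N] subalgebra_gen_sigma[of "{1..N}"]
          by (auto simp: Int_absorb2 intro: measurable_from_subalg)
        have Ri: "integrable M (R N)" using False RM by (intro integrableI_bounded) (auto simp: less_top)
        define r where "r = expectation (\<lambda>\<omega>. \<bar>R N \<omega>\<bar>)"
        have r: "?r = ennreal r" "0 \<le> r" using Ri by (auto simp: r_def nn_integral_eq_integral)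
        define \<gamma> where "\<gamma> = enn2real ?\<gamma>"
        have \<gamma>: "?\<gamma> = ennreal \<gamma>" "0 \<le> \<gamma>" using False by (auto simp: \<gamma>_def ennreal_enn2real_if)
        have "F x \<le> A * real N powr (- 1/2 + e p) + A * real N powr (- 1/2) * r + A * real N powr (e p) * \<gamma>" for x
        proof (cases "N1 \<le> N")
          case True
          note big = x0[OF N1(2)[OF True]]
          have third: "(\<integral>\<^sup>+\<omega>. ennreal (\<bar>g N j (X j \<omega>)\<bar> ^ 3) \<partial>M) \<le> ennreal \<rho>" if "j \<in> {1..N}" for j
          proof -
            have "(\<integral>\<^sup>+\<omega>. ennreal (\<bar>g N j (X j \<omega>)\<bar> ^ 3) \<partial>M) \<le> (SUP j\<in>{1..N}. \<integral>\<^sup>+\<omega>. ennreal (\<bar>g N j (X j \<omega>)\<bar> ^ 3) \<partial>M)"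
              using that by (rule SUP_upper)
            also have "\<dots> \<le> (SUP N\<in>{1..}. SUP j\<in>{1..N}. \<integral>\<^sup>+\<omega>. ennreal (\<bar>g N j (X j \<omega>)\<bar> ^ 3) \<partial>M)"
              using N by (intro SUP_upper) auto
            finally show ?thesis using 1(5) by (rule order_trans)
          qed
          have 13: "13 * real N powr (2 * \<delta>) \<le> real N powr \<epsilon>"
          proof -
            have "13 * real N powr (2 * \<delta>) = (13 * real N powr (2 * \<delta> - \<epsilon>)) * real N powr \<epsilon>"
              by (simp add: powr_add[symmetric])
            also have "\<dots> \<le> 1 * real N powr \<epsilon>" using big by (intro mult_right_mono) auto
            finally show ?thesis by simp
          qed
          have "F x \<le> 13 ^ 5 * CS * real N powr (10 * \<delta>) * (2 * real N powr (- 1/2) + \<gamma>)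
            + 3 * (1 / sqrt b') * real N powr (- 1/2) * r"
            unfolding F_def r_def CS_def Cq_def C1_def \<delta>_def
            by (rule berry_esseen_rate)
              (use N p 1 \<gamma> Ri third 13 big N1(1)[OF True] \<open>0 < K\<close> \<open>0 < \<rho>\<close> \<open>0 < b'\<close> in \<open>auto simp: C1_def \<delta>_def\<close>)
          also have "\<dots> = 2 * (13 ^ 5 * CS) * real N powr (- 1/2 + e p) + 13 ^ 5 * CS * real N powr (e p) * \<gamma>
            + 3 * (1 / sqrt b') * real N powr (- 1/2) * r"
          proof -
            have "real N powr (- 1/2 + e p) = real N powr (- 1/2) * real N powr (10 * \<delta>)"
              by (simp only: powr_add ep)
            then show ?thesis by (simp add: ep algebra_simps)
          qed
          also have "\<dots> \<le> A * real N powr (- 1/2 + e p) + A * real N powr (e p) * \<gamma> + A * real N powr (- 1/2) * r"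
            using A r \<gamma> by (intro add_mono mult_right_mono) auto
          finally show ?thesis by simp
        next
          case False
          have "F x \<le> 1"
          proof -
            have "0 \<le> std_normal_cdf x" "std_normal_cdf x \<le> 1" by (rule std_normal_cdf_bounds)+
            then show ?thesis unfolding F_def using prob_le_1 measure_nonneg by (smt (verit))
          qed
          also have "1 \<le> A * real N powr (- 1/2 + e p)"
          proof -
            have "1 = sqrt (real N) * real N powr (- 1/2)"
              using N by (simp add: powr_half_sqrt[symmetric] powr_add[symmetric])
            also have "\<dots> \<le> A * real N powr (- 1/2 + e p)"
            proof (intro mult_mono powr_mono)
              show "sqrt (real N) \<le> A" using A(1) False by (smt (verit) real_sqrt_le_iff of_nat_le_iff nat_le_linear)
              show "- 1/2 \<le> - 1/2 + e p" using p by (simp add: e_def)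
            qed (use N A(5) in auto)
            finally show ?thesis .
          qed
          also have "\<dots> \<le> A * real N powr (- 1/2 + e p) + A * real N powr (- 1/2) * r + A * real N powr (e p) * \<gamma>"
            using A(5) r \<gamma> by simp
          finally show ?thesis .
        qed
        then have "(SUP x. F x) \<le> A * real N powr (- 1/2 + e p) + A * real N powr (- 1/2) * r + A * real N powr (e p) * \<gamma>"
          by (intro cSUP_least) auto
        then have "ennreal (SUP x. F x) \<le> ennreal (A * real N powr (- 1/2 + e p) + A * real N powr (- 1/2) * r + A * real N powr (e p) * \<gamma>)"
          by (rule ennreal_leI)
        also have "\<dots> = ennreal (A * real N powr (- 1/2 + e p)) + ennreal (A * real N powr (- 1/2)) * ?r + ennreal (A * real N powr (e p)) * ?\<gamma>"
          unfolding r(1) \<gamma>(1) using A(5) r(2) \<gamma>(2) by (simp add: ennreal_plus ennreal_mult)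
        finally show ?thesis .
      qed
      then show ?case unfolding Let_def F_def .
    qed
  qed
qed

end
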